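(* Let $k$ be a commutative ring, $\mathcal{A}$ a unital associative $k$-algebra, $r\ge1$ an integer, and $\mathcal{M}_r(\mathcal{A})$ the algebra of $r\times r$ matrices over $\mathcal{A}$. Then $E(\mathcal{A})\cong E(\mathcal{M}_r(\mathcal{A}))$; that is, there exist an isomorphism of $k$-modules $\phi:H_0(\mathcal{A},\mathcal{A})\to H_0(\mathcal{M}_r(\mathcal{A}),\mathcal{M}_r(\mathcal{A}))$ and an isomorphism of $k$-modules $\Phi:E(\mathcal{A})\to E(\mathcal{M}_r(\mathcal{A}))$ such that for all $e_1,e_2\in E(\mathcal{A})$, $\Phi[\![e_1,e_2]\!]=[\![\Phi(e_1),\Phi(e_2)]\!]$ and $(\Phi(e_1),\Phi(e_2))=\phi((e_1,e_2))$.
   Context: For a unital associative $k$-algebra $\mathcal{A}$ let $C_n(\mathcal{A},\mathcal{A})=\mathcal{A}\otimes_k\mathcal{A}^{\otimes n}$ with Hochschild boundary $b(a_0\otimes\dots\otimes a_n)=\sum_{i=0}^{n-1}(-1)^i a_0\otimes\dots\otimes a_ia_{i+1}\otimes\dots\otimes a_n+(-1)^n a_na_0\otimes a_1\otimes\dots\otimes a_{n-1}$, and let $H_n(\mathcal{A},\mathcal{A})$ be its homology; in particular $H_0(\mathcal{A},\mathcal{A})=\mathcal{A}/[\mathcal{A},\mathcal{A}]$. Let $H^1(\mathcal{A},\mathcal{A})=\mathrm{Der}_k(\mathcal{A})/\{[a,\cdot]:a\in\mathcal{A}\}$ (derivations modulo inner derivations), with the Lie bracket induced by the commutator. For $X\in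 H^1(\mathcal{A},\mathcal{A})$, represented by a derivation again denoted $X$, the following operations, given on the level of chains, are well defined on homology: the Lie derivative $\mathcal{L}_X(a_0\otimes a_1)=X(a_0)\otimes a_1+a_0\otimes X(a_1)$ on $H_1$; the interior product $i_X:H_1(\mathcal{A},\mathcal{A})\to H_0(\mathcal{A},\mathcal{A})$, $i_X(a_0\otimes a_1)=X(a_1)a_0$; and Connes' map $B:H_0(\mathcal{A},\mathcal{A})\to H_1(\mathcal{A},\mathcal{A})$, $B(a)=1\otimes a+a\otimes1$ (homologous to $1\otimes a$). The pairing is $\langle X,\alpha\rangle:=i_X\alpha\in H_0(\mathcal{A},\mathcal{A})$. Let $E(\mathcal{A}):=H^1(\mathcal{A},\mathcal{A})\oplus H_1(\mathcal{A},\mathcal{A})$, with Courant bracket $[\![(X_1,\alpha_1),(X_2,\alpha_2)]\!]=([X_1,X_2],\ \mathcal{L}_{X_1}\alpha_2-\mathcal{L}_{X_2}\alpha_1+B\langle X_2,\alpha_1\rangle)$ and $H_0(\mathcal{A},\mathcal{A})$-valued symmetric bilinear form $((X_1,\alpha_1),(X_2,\alpha_2))=\langle X_2,\alpha_1\rangle+\langle X_1,\alpha_2\rangle$. *)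

theory Defs
  imports "HOL-Algebra.Module" "HOL-Algebra.AbelCoset" "HOL-Library.FuncSet"
begin

section \<open>Modules and algebras\<close>

text \<open>
  In the module records below the fields \<open>mult\<close> and \<open>one\<close>, which are inherited from the record
  type \<open>ring\<close> but play no role for a module, are left \<open>undefined\<close>.
  The locale \<open>algebra\<close> of the library demands a commutative multiplication, hence the following one.
\<close>

locale assoc_algebra = module K A + A?: ring A for K (structure) and A (structure) +
  assumes smult_mult_left:
      "\<lbrakk>c \<in> carrier K; x \<in> carrier A; y \<in> carrier A\<rbrakk>
        \<Longrightarrow> c \<odot>\<^bsub>A\<^esub> (x \<otimes>\<^bsub>A\<^esub> y) = (c \<odot>\<^bsub>A\<^esub> x) \<otimes>\<^bsub>A\<^esub> y"
    and smult_mult_right: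
      "\<lbrakk>c \<in> carrier K; x \<in> carrier A; y \<in> carrier A\<rbrakk>
        \<Longrightarrow> c \<odot>\<^bsub>A\<^esub> (x \<otimes>\<^bsub>A\<^esub> y) = x \<otimes>\<^bsub>A\<^esub> (c \<odot>\<^bsub>A\<^esub> y)"

definition module_iso ::
  "('k, 'r) ring_scheme \<Rightarrow> ('k, 'b) module \<Rightarrow> ('k, 'c) module \<Rightarrow> ('b \<Rightarrow> 'c) set" where
  "module_iso K M N =
    {f \<in> iso (add_monoid M) (add_monoid N).
       \<forall>c\<in>carrier K. \<forall>x\<in>carrier M. f (c \<odot>\<^bsub>M\<^esub> x) = c \<odot>\<^bsub>N\<^esub> f x}"

text \<open>
  The map into the cosets of \<open>N\<close> in \<open>M\<close> induced by \<open>f\<close>, applied to a coset \<open>X\<close> (of some submodule of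
  the source of \<open>f\<close>). As for the multiplication of \<open>FactRing\<close>, the union is over all
  representatives; it is a single coset if \<open>f\<close> descends to the quotients.
\<close>

definition quot_map :: "('c, 'm) ring_scheme \<Rightarrow> 'c set \<Rightarrow> ('b \<Rightarrow> 'c) \<Rightarrow> 'b set \<Rightarrow> 'c set" where
  "quot_map M N f X = (\<Union>x\<in>X. N +>\<^bsub>M\<^esub> f x)"

definition quot_module :: "('k, 'b) module \<Rightarrow> 'b set \<Rightarrow> ('k, 'b set) module" where
  "quot_module M N =
    \<lparr>carrier = a_rcosets\<^bsub>M\<^esub> N, mult = undefined, one = undefined,
     zero = N, add = set_add M, smult = (\<lambda>c. quot_map M N (\<lambda>x. c \<odot>\<^bsub>M\<^esub> x))\<rparr>"

definition prod_module :: "('k, 'b) module \<Rightarrow> ('k, 'c) module \<Rightarrow> ('k, 'b \<times> 'c) module" where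
  "prod_module M N =
    \<lparr>carrier = carrier M \<times> carrier N, mult = undefined, one = undefined,
     zero = (\<zero>\<^bsub>M\<^esub>, \<zero>\<^bsub>N\<^esub>),
     add = (\<lambda>(x, y) (x', y'). (x \<oplus>\<^bsub>M\<^esub> x', y \<oplus>\<^bsub>N\<^esub> y')),
     smult = (\<lambda>c (x, y). (c \<odot>\<^bsub>M\<^esub> x, c \<odot>\<^bsub>N\<^esub> y))\<rparr>"

definition submodule_generated ::
  "('k, 'r) ring_scheme \<Rightarrow> ('k, 'b) module \<Rightarrow> 'b set \<Rightarrow> 'b set" where
  "submodule_generated K M G = \<Inter>{H. submodule H K M \<and> G \<subseteq> H}"

definition free_module :: "('k, 'r) ring_scheme \<Rightarrow> 'i set \<Rightarrow> ('k, 'i \<Rightarrow> 'k) module" where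
  "free_module K S =
    \<lparr>carrier = {f. range f \<subseteq> carrier K \<and> finite {i. f i \<noteq> \<zero>\<^bsub>K\<^esub>} \<and> {i. f i \<noteq> \<zero>\<^bsub>K\<^esub>} \<subseteq> S},
     mult = undefined, one = undefined,
     zero = (\<lambda>_. \<zero>\<^bsub>K\<^esub>),
     add = (\<lambda>f g i. f i \<oplus>\<^bsub>K\<^esub> g i),
     smult = (\<lambda>c f i. c \<otimes>\<^bsub>K\<^esub> f i)\<rparr>"

definition free_gen :: "('k, 'r) ring_scheme \<Rightarrow> 'i \<Rightarrow> 'i \<Rightarrow> 'k" where
  "free_gen K s = (\<lambda>i. if i = s then \<one>\<^bsub>K\<^esub> else \<zero>\<^bsub>K\<^esub>)"

definition lin_ext ::
  "('k, 'r) ring_scheme \<Rightarrow> ('k, 'b) module \<Rightarrow> ('i \<Rightarrow> 'b) \<Rightarrow> ('i \<Rightarrow> 'k) \<Rightarrow> 'b" where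
  "lin_ext K M g f = (\<Oplus>\<^bsub>M\<^esub>i\<in>{i. f i \<noteq> \<zero>\<^bsub>K\<^esub>}. f i \<odot>\<^bsub>M\<^esub> g i)"

text \<open>
  A matrix is a function on pairs of indices below \<open>r\<close>, extended by \<open>undefined\<close>.
\<close>

definition mat_algebra :: "('k, 'a) module \<Rightarrow> nat \<Rightarrow> ('k, nat \<times> nat \<Rightarrow> 'a) module" where
  "mat_algebra A r =
    (let I = {..<r} \<times> {..<r} in
    \<lparr>carrier = I \<rightarrow>\<^sub>E carrier A,
     mult = (\<lambda>M N. \<lambda>(i, j)\<in>I. \<Oplus>\<^bsub>A\<^esub>l\<in>{..<r}. M (i, l) \<otimes>\<^bsub>A\<^esub> N (l, j)),
     one = (\<lambda>(i, j)\<in>I. if i = j then \<one>\<^bsub>A\<^esub> else \<zero>\<^bsub>A\<^esub>),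
     zero = (\<lambda>_\<in>I. \<zero>\<^bsub>A\<^esub>),
     add = (\<lambda>M N. \<lambda>p\<in>I. M p \<oplus>\<^bsub>A\<^esub> N p),
     smult = (\<lambda>c M. \<lambda>p\<in>I. c \<odot>\<^bsub>A\<^esub> M p)\<rparr>)"


section \<open>Hochschild homology\<close>

text \<open>
  The chain module \<open>A \<otimes> A\<^sup>\<otimes>\<^sup>n\<close> is the free \<open>K\<close>-module on the tuples of \<open>n + 1\<close> elements of \<open>A\<close>
  (lists of length \<open>n + 1\<close>) modulo the relations of multilinearity. For \<open>n = 0\<close> this is \<open>A\<close>
  itself, via the class of the one-element list \<open>[a]\<close>.
\<close>

definition free_chains :: "('k, 'r) ring_scheme \<Rightarrow> ('k, 'a) module \<Rightarrow> nat \<Rightarrow> ('k, 'a list \<Rightarrow> 'k) module" where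
  "free_chains K A n = free_module K {as. set as \<subseteq> carrier A \<and> length as = Suc n}"

definition multilinear_rels ::
  "('k, 'r) ring_scheme \<Rightarrow> ('k, 'a) module \<Rightarrow> nat \<Rightarrow> ('a list \<Rightarrow> 'k) set" where
  "multilinear_rels K A n =
    {free_gen K (us @ [x \<oplus>\<^bsub>A\<^esub> y] @ vs)
       \<ominus>\<^bsub>free_chains K A n\<^esub> (free_gen K (us @ [x] @ vs) \<oplus>\<^bsub>free_chains K A n\<^esub> free_gen K (us @ [y] @ vs))
     | us vs x y. set us \<subseteq> carrier A \<and> set vs \<subseteq> carrier A \<and> length us + length vs = n
         \<and> x \<in> carrier A \<and> y \<in> carrier A} \<union>
    {free_gen K (us @ [c \<odot>\<^bsub>A\<^esub> x] @ vs)
       \<ominus>\<^bsub>free_chains K A n\<^esub> (c \<odot>\<^bsub>free_chains K A n\<^esub> free_gen K (us @ [x] @ vs))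
     | us vs c x. set us \<subseteq> carrier A \<and> set vs \<subseteq> carrier A \<and> length us + length vs = n
         \<and> c \<in> carrier K \<and> x \<in> carrier A}"

definition tensor_rels ::
  "('k, 'r) ring_scheme \<Rightarrow> ('k, 'a) module \<Rightarrow> nat \<Rightarrow> ('a list \<Rightarrow> 'k) set" where
  "tensor_rels K A n = submodule_generated K (free_chains K A n) (multilinear_rels K A n)"

definition hoch_chains ::
  "('k, 'r) ring_scheme \<Rightarrow> ('k, 'a) module \<Rightarrow> nat \<Rightarrow> ('k, ('a list \<Rightarrow> 'k) set) module" where
  "hoch_chains K A n = quot_module (free_chains K A n) (tensor_rels K A n)"

text \<open>
  The map into the chains of degree \<open>m\<close> sending an elementary tensor, given by the list \<open>as\<close> of its
  factors, to the class of \<open>g as\<close>.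
\<close>

definition tensor_map ::
  "('k, 'r) ring_scheme \<Rightarrow> ('k, 'a) module \<Rightarrow> nat \<Rightarrow> ('a list \<Rightarrow> 'a list \<Rightarrow> 'k)
    \<Rightarrow> ('a list \<Rightarrow> 'k) set \<Rightarrow> ('a list \<Rightarrow> 'k) set" where
  "tensor_map K A m g =
    quot_map (free_chains K A m) (tensor_rels K A m) (lin_ext K (free_chains K A m) g)"

text \<open>The \<open>i\<close>-th summand, without sign, of the boundary of a tensor of degree \<open>n > 0\<close>.\<close>

definition hoch_face :: "('k, 'a) module \<Rightarrow> nat \<Rightarrow> nat \<Rightarrow> 'a list \<Rightarrow> 'a list" where
  "hoch_face A n i as =
    (if i < n then take i as @ [as ! i \<otimes>\<^bsub>A\<^esub> as ! Suc i] @ drop (i + 2) as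
     else (last as \<otimes>\<^bsub>A\<^esub> hd as) # tl (butlast as))"

text \<open>The boundary from degree \<open>n\<close> to degree \<open>n - 1\<close>, used for \<open>n > 0\<close> only.\<close>

definition hoch_boundary ::
  "('k, 'r) ring_scheme \<Rightarrow> ('k, 'a) module \<Rightarrow> nat \<Rightarrow> ('a list \<Rightarrow> 'k) set \<Rightarrow> ('a list \<Rightarrow> 'k) set" where
  "hoch_boundary K A n =
    tensor_map K A (n - 1)
      (\<lambda>as. \<Oplus>\<^bsub>free_chains K A (n - 1)\<^esub>i\<in>{..n}.
        ((\<ominus>\<^bsub>K\<^esub> \<one>\<^bsub>K\<^esub>) [^]\<^bsub>K\<^esub> i) \<odot>\<^bsub>free_chains K A (n - 1)\<^esub> free_gen K (hoch_face A n i as))"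

definition hoch_cycles ::
  "('k, 'r) ring_scheme \<Rightarrow> ('k, 'a) module \<Rightarrow> nat \<Rightarrow> ('a list \<Rightarrow> 'k) set set" where
  "hoch_cycles K A n =
    {c \<in> carrier (hoch_chains K A n).
       n > 0 \<longrightarrow> hoch_boundary K A n c = \<zero>\<^bsub>hoch_chains K A (n - 1)\<^esub>}"

definition hoch_boundaries ::
  "('k, 'r) ring_scheme \<Rightarrow> ('k, 'a) module \<Rightarrow> nat \<Rightarrow> ('a list \<Rightarrow> 'k) set set" where
  "hoch_boundaries K A n = hoch_boundary K A (Suc n) ` carrier (hoch_chains K A (Suc n))"

definition hoch_homology ::
  "('k, 'r) ring_scheme \<Rightarrow> ('k, 'a) module \<Rightarrow> nat \<Rightarrow> ('k, ('a list \<Rightarrow> 'k) set set) module" where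
  "hoch_homology K A n =
    quot_module ((hoch_chains K A n)\<lparr>carrier := hoch_cycles K A n\<rparr>) (hoch_boundaries K A n)"

text \<open>
  The map into homology of degree \<open>m\<close> induced by the map \<^term>\<open>tensor_map K A m g\<close> of chains.
\<close>

definition homology_map ::
  "('k, 'r) ring_scheme \<Rightarrow> ('k, 'a) module \<Rightarrow> nat \<Rightarrow> ('a list \<Rightarrow> 'a list \<Rightarrow> 'k)
    \<Rightarrow> ('a list \<Rightarrow> 'k) set set \<Rightarrow> ('a list \<Rightarrow> 'k) set set" where
  "homology_map K A m g =
    quot_map (hoch_chains K A m) (hoch_boundaries K A m) (tensor_map K A m g)"


section \<open>Outer derivations\<close>

text \<open>Derivations are extended by \<open>undefined\<close> outside \<^term>\<open>carrier A\<close>.\<close>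

definition derivations :: "('k, 'r) ring_scheme \<Rightarrow> ('k, 'a) module \<Rightarrow> ('a \<Rightarrow> 'a) set" where
  "derivations K A =
    {D \<in> carrier A \<rightarrow>\<^sub>E carrier A.
       (\<forall>x\<in>carrier A. \<forall>y\<in>carrier A. D (x \<oplus>\<^bsub>A\<^esub> y) = D x \<oplus>\<^bsub>A\<^esub> D y) \<and>
       (\<forall>c\<in>carrier K. \<forall>x\<in>carrier A. D (c \<odot>\<^bsub>A\<^esub> x) = c \<odot>\<^bsub>A\<^esub> D x) \<and>
       (\<forall>x\<in>carrier A. \<forall>y\<in>carrier A.
          D (x \<otimes>\<^bsub>A\<^esub> y) = D x \<otimes>\<^bsub>A\<^esub> y \<oplus>\<^bsub>A\<^esub> x \<otimes>\<^bsub>A\<^esub> D y)}"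

definition der_module :: "('k, 'r) ring_scheme \<Rightarrow> ('k, 'a) module \<Rightarrow> ('k, 'a \<Rightarrow> 'a) module" where
  "der_module K A =
    \<lparr>carrier = derivations K A, mult = undefined, one = undefined,
     zero = (\<lambda>_\<in>carrier A. \<zero>\<^bsub>A\<^esub>),
     add = (\<lambda>D D'. \<lambda>x\<in>carrier A. D x \<oplus>\<^bsub>A\<^esub> D' x),
     smult = (\<lambda>c D. \<lambda>x\<in>carrier A. c \<odot>\<^bsub>A\<^esub> D x)\<rparr>"

definition inner_derivations :: "('k, 'a) module \<Rightarrow> ('a \<Rightarrow> 'a) set" where
  "inner_derivations A = {\<lambda>x\<in>carrier A. a \<otimes>\<^bsub>A\<^esub> x \<ominus>\<^bsub>A\<^esub> x \<otimes>\<^bsub>A\<^esub> a | a. a \<in> carrier A}"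

definition outer_der :: "('k, 'r) ring_scheme \<Rightarrow> ('k, 'a) module \<Rightarrow> ('k, ('a \<Rightarrow> 'a) set) module" where
  "outer_der K A = quot_module (der_module K A) (inner_derivations A)"

definition der_commutator :: "('k, 'a) module \<Rightarrow> ('a \<Rightarrow> 'a) \<Rightarrow> ('a \<Rightarrow> 'a) \<Rightarrow> 'a \<Rightarrow> 'a" where
  "der_commutator A D D' = (\<lambda>x\<in>carrier A. D (D' x) \<ominus>\<^bsub>A\<^esub> D' (D x))"

definition outer_bracket ::
  "('k, 'r) ring_scheme \<Rightarrow> ('k, 'a) module \<Rightarrow> ('a \<Rightarrow> 'a) set \<Rightarrow> ('a \<Rightarrow> 'a) set \<Rightarrow> ('a \<Rightarrow> 'a) set" where
  "outer_bracket K A X Y =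
    (\<Union>D\<in>X. \<Union>D'\<in>Y. inner_derivations A +>\<^bsub>der_module K A\<^esub> der_commutator A D D')"


section \<open>Calculus and the Courant bracket\<close>

text \<open>
  A class \<open>X\<close> of derivations acts through its representatives; as in \<open>quot_map\<close> the union
  is over all of them. In \<open>lie_derivative\<close> and \<open>interior_product\<close> the list is \<open>[a\<^sub>0, a\<^sub>1]\<close>, in
  \<open>connes_B\<close> it is \<open>[a]\<close>.
\<close>

definition lie_derivative ::
  "('k, 'r) ring_scheme \<Rightarrow> ('k, 'a) module \<Rightarrow> ('a \<Rightarrow> 'a) set
    \<Rightarrow> ('a list \<Rightarrow> 'k) set set \<Rightarrow> ('a list \<Rightarrow> 'k) set set" where
  "lie_derivative K A X \<alpha> =
    (\<Union>D\<in>X. homology_map K A 1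
      (\<lambda>as. free_gen K [D (as ! 0), as ! 1] \<oplus>\<^bsub>free_chains K A 1\<^esub> free_gen K [as ! 0, D (as ! 1)]) \<alpha>)"

definition interior_product ::
  "('k, 'r) ring_scheme \<Rightarrow> ('k, 'a) module \<Rightarrow> ('a \<Rightarrow> 'a) set
    \<Rightarrow> ('a list \<Rightarrow> 'k) set set \<Rightarrow> ('a list \<Rightarrow> 'k) set set" where
  "interior_product K A X \<alpha> =
    (\<Union>D\<in>X. homology_map K A 0 (\<lambda>as. free_gen K [D (as ! 1) \<otimes>\<^bsub>A\<^esub> as ! 0]) \<alpha>)"

definition connes_B ::
  "('k, 'r) ring_scheme \<Rightarrow> ('k, 'a) module
    \<Rightarrow> ('a list \<Rightarrow> 'k) set set \<Rightarrow> ('a list \<Rightarrow> 'k) set set" where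
  "connes_B K A =
    homology_map K A 1
      (\<lambda>as. free_gen K [\<one>\<^bsub>A\<^esub>, as ! 0] \<oplus>\<^bsub>free_chains K A 1\<^esub> free_gen K [as ! 0, \<one>\<^bsub>A\<^esub>])"

type_synonym ('k, 'a) courant = "('a \<Rightarrow> 'a) set \<times> ('a list \<Rightarrow> 'k) set set"

definition courant_module ::
  "('k, 'r) ring_scheme \<Rightarrow> ('k, 'a) module \<Rightarrow> ('k, ('k, 'a) courant) module" where
  "courant_module K A = prod_module (outer_der K A) (hoch_homology K A 1)"

definition courant_bracket ::
  "('k, 'r) ring_scheme \<Rightarrow> ('k, 'a) module
    \<Rightarrow> ('k, 'a) courant \<Rightarrow> ('k, 'a) courant \<Rightarrow> ('k, 'a) courant" where
  "courant_bracket K A = (\<lambda>(X\<^sub>1, \<alpha>\<^sub>1) (X\<^sub>2, \<alpha>\<^sub>2).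
    (outer_bracket K A X\<^sub>1 X\<^sub>2,
     (lie_derivative K A X\<^sub>1 \<alpha>\<^sub>2 \<ominus>\<^bsub>hoch_homology K A 1\<^esub> lie_derivative K A X\<^sub>2 \<alpha>\<^sub>1)
       \<oplus>\<^bsub>hoch_homology K A 1\<^esub> connes_B K A (interior_product K A X\<^sub>2 \<alpha>\<^sub>1)))"

definition courant_form ::
  "('k, 'r) ring_scheme \<Rightarrow> ('k, 'a) module
    \<Rightarrow> ('k, 'a) courant \<Rightarrow> ('k, 'a) courant \<Rightarrow> ('a list \<Rightarrow> 'k) set set" where
  "courant_form K A = (\<lambda>(X\<^sub>1, \<alpha>\<^sub>1) (X\<^sub>2, \<alpha>\<^sub>2).
    interior_product K A X\<^sub>2 \<alpha>\<^sub>1 \<oplus>\<^bsub>hoch_homology K A 0\<^esub> interior_product K A X\<^sub>1 \<alpha>\<^sub>2)"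

end

theory Submission
  imports Defs
begin

text \<open>
The isomorphism is induced by the corner inclusion \<open>a \<mapsto> a e\<^sub>0\<^sub>0\<close> of the algebra into its matrices on
  homology, and by applying a derivation to every entry of a matrix on outer derivations.

  On homology, the trace \<open>M \<otimes> N \<mapsto> \<Sum> M\<^sub>i\<^sub>j \<otimes> N\<^sub>j\<^sub>i\<close> is a chain map with \<open>tr \<circ> inc = id\<close>, while
  \<open>id - inc \<circ> tr\<close> is null homotopic. Only the degrees zero and one matter, and there the homotopy is
  explicit (\<open>inc_tr_homotopy0\<close>, \<open>inc_tr_homotopy1\<close>). Every linear identity on matrix chains is
  checked on tensors of matrices with a single nonzero entry, which generate the chains because such
  matrices generate all matrices additively (\<open>mat_induct\<close>); this keeps sums over indices out of the
  argument.

  On derivations, a derivation of the matrices differs from an entrywise one by an inner one, which is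
  read off from its values on the matrix units (\<open>mat_derivation_decomposition\<close>), and an entrywise
  derivation is inner only if it comes from an inner one (\<open>inner_of_mat_der_inner\<close>).

  Lie derivative and interior product commute with the corner inclusion already on chains. The map of
  Connes does not, because the inclusion is not unital, but the difference is a boundary
  (\<open>connes_chain_inc\<close>). To pass from representatives to classes, it is needed that inner derivations
  act on cycles by boundaries (\<open>lie_chain_inner\<close>, \<open>interior_chain_inner\<close>) and that they form an ideal
  of the derivations (\<open>outer_bracket_coset\<close>).

  The chains are quotients of free modules, with operations given on representatives. The lemma
  \<open>tensor_map_eq_lift\<close> replaces them by linear maps obtained from the universal property of the
  tensor product, which are determined by their values on elementary tensors.
\<close>

section \<open>Sums and differences in abelian groups\<close>

lemma (in abelian_group) diff_eq_iff:
  "\<lbrakk>x \<in> carrier G; y \<in> carrier G; z \<in> carrier G\<rbrakk> \<Longrightarrow> x \<ominus> y = z \<longleftrightarrow> x = z \<oplus> y"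
  by (metis a_inv_closed a_minus_def add.inv_solve_right)

lemma (in abelian_group) eq_diff_iff:
  "\<lbrakk>x \<in> carrier G; y \<in> carrier G; z \<in> carrier G\<rbrakk> \<Longrightarrow> z = x \<ominus> y \<longleftrightarrow> z \<oplus> y = x"
  by (metis diff_eq_iff)

lemma (in abelian_group) add_diff_eq:
  "\<lbrakk>x \<in> carrier G; y \<in> carrier G; z \<in> carrier G\<rbrakk> \<Longrightarrow> x \<oplus> (y \<ominus> z) = (x \<oplus> y) \<ominus> z"
  by (simp add: a_minus_def a_assoc)

lemma (in abelian_group) diff_add_eq:
  "\<lbrakk>x \<in> carrier G; y \<in> carrier G; z \<in> carrier G\<rbrakk> \<Longrightarrow> (x \<ominus> y) \<oplus> z = (x \<oplus> z) \<ominus> y"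
  by (simp add: a_minus_def a_ac)

lemma (in abelian_group) diff_diff_eq:
  "\<lbrakk>x \<in> carrier G; y \<in> carrier G; z \<in> carrier G\<rbrakk> \<Longrightarrow> (x \<ominus> y) \<ominus> z = x \<ominus> (y \<oplus> z)"
  by (simp add: a_minus_def a_ac minus_add)

lemma (in abelian_group) diff_diff_eq2:
  "\<lbrakk>x \<in> carrier G; y \<in> carrier G; z \<in> carrier G\<rbrakk> \<Longrightarrow> x \<ominus> (y \<ominus> z) = (x \<oplus> z) \<ominus> y"
  by (simp add: a_minus_def a_ac minus_add)

lemma (in abelian_group) diff_self: "x \<in> carrier G \<Longrightarrow> x \<ominus> x = \<zero>"
  by (simp add: a_minus_def r_neg)

lemma (in abelian_group) diff_zero: "x \<in> carrier G \<Longrightarrow> x \<ominus> \<zero> = x"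
  by (simp add: diff_eq_iff)

text \<open>Together with associativity and commutativity, these rules clear all differences from an equation:
  an identity that holds in every abelian group becomes one between two sums with the same summands.\<close>

lemmas (in abelian_group) diff_simps =
  diff_eq_iff eq_diff_iff add_diff_eq diff_add_eq diff_diff_eq diff_diff_eq2

lemma (in abelian_group) self_eq_double_iff:
  "x \<in> carrier G \<Longrightarrow> x = x \<oplus> x \<longleftrightarrow> x = \<zero>"
  by (metis add.l_cancel_one' )

lemma (in ring) diff_l_distr:
  "\<lbrakk>x \<in> carrier R; y \<in> carrier R; z \<in> carrier R\<rbrakk> \<Longrightarrow> (x \<ominus> y) \<otimes> z = x \<otimes> z \<ominus> y \<otimes> z"
  by (simp add: a_minus_def l_distr l_minus)

lemma (in ring) diff_r_distr:
  "\<lbrakk>x \<in> carrier R; y \<in> carrier R; z \<in> carrier R\<rbrakk> \<Longrightarrow> z \<otimes> (x \<ominus> y) = z \<otimes> x \<ominus> z \<otimes> y"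
  by (simp add: a_minus_def r_distr r_minus)

lemma (in module) smult_diff:
  "\<lbrakk>a \<in> carrier R; x \<in> carrier M; y \<in> carrier M\<rbrakk> \<Longrightarrow>
    a \<odot>\<^bsub>M\<^esub> (x \<ominus>\<^bsub>M\<^esub> y) = a \<odot>\<^bsub>M\<^esub> x \<ominus>\<^bsub>M\<^esub> a \<odot>\<^bsub>M\<^esub> y"
  by (simp add: a_minus_def smult_r_distr smult_r_minus)

lemma (in abelian_monoid) finsum_delta:
  assumes "finite S" "c \<in> carrier G"
  shows "(\<Oplus>j\<in>S. if j = i then c else \<zero>) = (if i \<in> S then c else \<zero>)"
proof (cases "i \<in> S")
  case True
  have "(\<Oplus>j\<in>S. if j = i then c else \<zero>) = (\<Oplus>j\<in>{i}. c)"
    by (rule add.finprod_mono_neutral_cong_right) (use assms True in auto)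
  then show ?thesis using assms True by simp
next
  case False
  then have "(\<Oplus>j\<in>S. if j = i then c else \<zero>) = (\<Oplus>j\<in>S. \<zero>)"
    by (intro finsum_cong') auto
  then show ?thesis using False by simp
qed

lemma (in abelian_monoid) finsum_swap:
  assumes "finite S" "finite T" "\<And>i j. \<lbrakk>i \<in> S; j \<in> T\<rbrakk> \<Longrightarrow> f i j \<in> carrier G"
  shows "(\<Oplus>i\<in>S. \<Oplus>j\<in>T. f i j) = (\<Oplus>j\<in>T. \<Oplus>i\<in>S. f i j)"
  using assms(1,3)
proof (induction S rule: finite_induct)
  case empty
  then show ?case by simp
next
  case (insert s S)
  have "(\<Oplus>j\<in>T. \<Oplus>i\<in>insert s S. f i j) = (\<Oplus>j\<in>T. f s j \<oplus> (\<Oplus>i\<in>S. f i j))"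
    by (rule finsum_cong') (use insert in \<open>auto intro!: finsum_insert finsum_closed\<close>)
  also have "\<dots> = (\<Oplus>j\<in>T. f s j) \<oplus> (\<Oplus>j\<in>T. \<Oplus>i\<in>S. f i j)"
    by (rule finsum_addf) (use insert in \<open>auto intro!: finsum_closed\<close>)
  also have "\<dots> = (\<Oplus>i\<in>insert s S. \<Oplus>j\<in>T. f i j)"
    using insert by (subst finsum_insert) (auto intro!: finsum_closed)
  finally show ?case by simp
qed

lemma restrict_eqI:
  assumes "f \<in> extensional S" "\<And>x. x \<in> S \<Longrightarrow> f x = g x"
  shows "f = restrict g S"
  using assms by (auto simp: fun_eq_iff extensional_def)

section \<open>Linear maps and quotients of modules\<close>

definition linear_map ::
  "('k, 'r) ring_scheme \<Rightarrow> ('k, 'b) module \<Rightarrow> ('k, 'c) module \<Rightarrow> ('b \<Rightarrow> 'c) \<Rightarrow> bool" where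
  "linear_map K M N f \<longleftrightarrow>
     (\<forall>x\<in>carrier M. f x \<in> carrier N) \<and>
     (\<forall>x\<in>carrier M. \<forall>y\<in>carrier M. f (x \<oplus>\<^bsub>M\<^esub> y) = f x \<oplus>\<^bsub>N\<^esub> f y) \<and>
     (\<forall>c\<in>carrier K. \<forall>x\<in>carrier M. f (c \<odot>\<^bsub>M\<^esub> x) = c \<odot>\<^bsub>N\<^esub> f x)"

lemma linear_mapI:
  assumes "\<And>x. x \<in> carrier M \<Longrightarrow> f x \<in> carrier N"
    and "\<And>x y. \<lbrakk>x \<in> carrier M; y \<in> carrier M\<rbrakk> \<Longrightarrow> f (x \<oplus>\<^bsub>M\<^esub> y) = f x \<oplus>\<^bsub>N\<^esub> f y"
    and "\<And>c x. \<lbrakk>c \<in> carrier K; x \<in> carrier M\<rbrakk> \<Longrightarrow> f (c \<odot>\<^bsub>M\<^esub> x) = c \<odot>\<^bsub>N\<^esub> f x"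
  shows "linear_map K M N f"
  using assms by (simp add: linear_map_def)

lemma linear_map_closed: "linear_map K M N f \<Longrightarrow> x \<in> carrier M \<Longrightarrow> f x \<in> carrier N"
  and linear_map_add: "linear_map K M N f \<Longrightarrow> x \<in> carrier M \<Longrightarrow> y \<in> carrier M \<Longrightarrow>
    f (x \<oplus>\<^bsub>M\<^esub> y) = f x \<oplus>\<^bsub>N\<^esub> f y"
  and linear_map_smult: "linear_map K M N f \<Longrightarrow> c \<in> carrier K \<Longrightarrow> x \<in> carrier M \<Longrightarrow>
    f (c \<odot>\<^bsub>M\<^esub> x) = c \<odot>\<^bsub>N\<^esub> f x"
  by (auto simp: linear_map_def)

lemma linear_map_hom:
  assumes "module K M" "module K N" "linear_map K M N f"
  shows "abelian_group_hom M N f"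
proof -
  interpret M: module K M by fact
  interpret N: module K N by fact
  show ?thesis
    by unfold_locales (use assms(3) in \<open>auto simp: linear_map_def hom_def\<close>)
qed

lemma linear_map_zero:
  assumes "module K M" "module K N" "linear_map K M N f"
  shows "f \<zero>\<^bsub>M\<^esub> = \<zero>\<^bsub>N\<^esub>"
  by (rule abelian_group_hom.hom_zero[OF linear_map_hom[OF assms]])

lemma linear_map_inv:
  assumes "module K M" "module K N" "linear_map K M N f" "x \<in> carrier M"
  shows "f (\<ominus>\<^bsub>M\<^esub> x) = \<ominus>\<^bsub>N\<^esub> f x"
  by (rule abelian_group_hom.hom_a_inv[OF linear_map_hom[OF assms(1-3)] assms(4)])

lemma linear_map_diff:
  assumes "module K M" "module K N" "linear_map K M N f" "x \<in> carrier M" "y \<in> carrier M"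
  shows "f (x \<ominus>\<^bsub>M\<^esub> y) = f x \<ominus>\<^bsub>N\<^esub> f y"
proof -
  interpret M: module K M by fact
  show ?thesis
    using assms by (simp add: a_minus_def linear_map_add[OF assms(3)] linear_map_inv)
qed

lemma linear_map_id: "linear_map K M M (\<lambda>x. x)"
  by (simp add: linear_map_def)

lemma linear_map_comp:
  "\<lbrakk>linear_map K M N f; linear_map K L M g\<rbrakk> \<Longrightarrow> linear_map K L N (\<lambda>x. f (g x))"
  by (simp add: linear_map_def)

lemma linear_map_sum:
  assumes "module K N" "linear_map K M N f" "linear_map K M N g"
  shows "linear_map K M N (\<lambda>x. f x \<oplus>\<^bsub>N\<^esub> g x)"
proof -
  interpret N: module K N by fact
  show ?thesis using assms(2,3)
    by (auto simp: linear_map_def N.a_ac N.smult_r_distr)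
qed

lemma linear_map_difference:
  assumes "module K N" "linear_map K M N f" "linear_map K M N g"
  shows "linear_map K M N (\<lambda>x. f x \<ominus>\<^bsub>N\<^esub> g x)"
proof -
  interpret N: module K N by fact
  show ?thesis using assms(2,3)
    by (auto simp: linear_map_def a_minus_def N.a_ac N.smult_r_distr N.minus_add N.smult_r_minus)
qed

lemma linear_map_cong:
  assumes "linear_map K M N f" "\<And>x. x \<in> carrier M \<Longrightarrow> g x = f x" "module K M"
  shows "linear_map K M N g"
proof -
  interpret M: module K M by fact
  show ?thesis using assms(1,2) by (simp add: linear_map_def)
qed

lemma linear_map_finsum:
  assumes "module K M" "module K N" "linear_map K M N f" "finite S" "\<And>i. i \<in> S \<Longrightarrow> g i \<in> carrier M"
  shows "f (\<Oplus>\<^bsub>M\<^esub>i\<in>S. g i) = (\<Oplus>\<^bsub>N\<^esub>i\<in>S. f (g i))"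
proof -
  interpret M: module K M by fact
  interpret N: module K N by fact
  show ?thesis
    using assms(4,5)
  proof (induction S rule: finite_induct)
    case empty
    then show ?case using linear_map_zero[OF assms(1-3)] by simp
  next
    case (insert s S)
    then have g: "g \<in> S \<rightarrow> carrier M" "g s \<in> carrier M" by auto
    then have fg: "(\<lambda>i. f (g i)) \<in> S \<rightarrow> carrier N" "f (g s) \<in> carrier N"
      using linear_map_closed[OF assms(3)] by auto
    show ?case
      unfolding M.finsum_insert[OF insert(1,2) g] N.finsum_insert[OF insert(1,2) fg]
      using linear_map_add[OF assms(3) g(2) M.finsum_closed[OF g(1)]] insert by simp
  qed
qed

lemma linear_map_restrict:
  assumes "linear_map K M N f" "Z \<subseteq> carrier M" "\<And>x. x \<in> Z \<Longrightarrow> f x \<in> Y"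
  shows "linear_map K (M\<lparr>carrier := Z\<rparr>) (N\<lparr>carrier := Y\<rparr>) f"
  using assms by (auto simp: linear_map_def subset_iff)

lemma submodule_preimage:
  assumes "module K M" "module K N" "linear_map K M N f" "submodule H K N"
  shows "submodule {x \<in> carrier M. f x \<in> H} K M"
proof -
  interpret M: module K M by fact
  interpret N: module K N by fact
  interpret H: submodule H K N by fact
  have "\<zero>\<^bsub>N\<^esub> \<in> H" using H.one_closed by simp
  then show ?thesis
    using N.submoduleE[OF assms(4)] linear_map_zero[OF assms(1-3)] linear_map_inv[OF assms(1-3)]
    by (intro M.submoduleI)
      (auto simp: linear_map_add[OF assms(3)] linear_map_smult[OF assms(3)])
qed

lemma submodule_zero:
  assumes "module K M" shows "submodule {\<zero>\<^bsub>M\<^esub>} K M"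
proof -
  interpret M: module K M by fact
  show ?thesis by (rule M.submoduleI) auto
qed

lemma submodule_image:
  assumes "module K M" "module K P" "linear_map K P M f"
  shows "submodule (f ` carrier P) K M"
proof -
  interpret M: module K M by fact
  interpret P: module K P by fact
  note cl = linear_map_closed[OF assms(3)]
  show ?thesis
  proof (rule M.submoduleI)
    show "\<zero>\<^bsub>M\<^esub> \<in> f ` carrier P"
      by (rule image_eqI[of _ _ "\<zero>\<^bsub>P\<^esub>"]) (simp_all add: linear_map_zero[OF assms(2,1,3)])
    show "\<And>a. a \<in> f ` carrier P \<Longrightarrow> \<ominus>\<^bsub>M\<^esub> a \<in> f ` carrier P"
      by (auto simp: linear_map_inv[OF assms(2,1,3), symmetric])
    show "\<And>a b. \<lbrakk>a \<in> f ` carrier P; b \<in> f ` carrier P\<rbrakk> \<Longrightarrow> a \<oplus>\<^bsub>M\<^esub> b \<in> f ` carrier P"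
      by (auto simp: linear_map_add[OF assms(3), symmetric])
    show "\<And>c a. \<lbrakk>c \<in> carrier K; a \<in> f ` carrier P\<rbrakk> \<Longrightarrow> c \<odot>\<^bsub>M\<^esub> a \<in> f ` carrier P"
      by (auto simp: linear_map_smult[OF assms(3), symmetric])
  qed (use cl in auto)
qed

lemma submodule_restrict:
  assumes "module K M" "submodule H K M" "submodule Z K M" "H \<subseteq> Z"
  shows "submodule H K (M\<lparr>carrier := Z\<rparr>)"
proof -
  interpret M: module K M by fact
  interpret Z: module K "M\<lparr>carrier := Z\<rparr>"
    by (rule submodule.submodule_is_module[OF assms(3,1)])
  note H = M.submoduleE[OF assms(2)]
  note Z = M.submoduleE[OF assms(3)]
  have z: "\<zero>\<^bsub>M\<^esub> \<in> H" using subgroup.one_closed[OF submodule.axioms(1)[OF assms(2)]] by simp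
  have "\<ominus>\<^bsub>M\<lparr>carrier := Z\<rparr>\<^esub> a = \<ominus>\<^bsub>M\<^esub> a" if "a \<in> H" for a
  proof -
    have a: "a \<in> Z" "\<ominus>\<^bsub>M\<^esub> a \<in> Z" "a \<in> carrier M" using that assms(4) Z H by auto
    show ?thesis
      by (rule Z.minus_equality) (use a in \<open>auto simp: M.l_neg\<close>)
  qed
  then show ?thesis
    by (intro Z.submoduleI) (use H z assms(4) in auto)
qed

text \<open>A module with a submodule, packaged so that the facts on the quotient are available under one
  prefix for each of the quotients below.\<close>

locale module_quotient = module K M for K :: "('k, 'r) ring_scheme" and M :: "('k, 'b) module" +
  fixes N :: "'b set"
  assumes sub: "submodule N K M"
begin

sublocale N: abelian_subgroup N M
  by (rule abelian_subgroupI3)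
    (use submodule.axioms(1)[OF sub] in \<open>auto intro: additive_subgroup.intro abelian_group_axioms\<close>)

lemma coset_mem_iff:
  assumes "x \<in> carrier M" "y \<in> carrier M"
  shows "y \<in> N +>\<^bsub>M\<^esub> x \<longleftrightarrow> y \<ominus>\<^bsub>M\<^esub> x \<in> N"
  using N.a_rcos_module[OF assms] by (simp add: a_minus_def)

lemma coset_eq_iff:
  assumes "x \<in> carrier M" "y \<in> carrier M"
  shows "N +>\<^bsub>M\<^esub> x = N +>\<^bsub>M\<^esub> y \<longleftrightarrow> x \<ominus>\<^bsub>M\<^esub> y \<in> N"
  using coset_mem_iff[OF assms(2,1)] N.a_repr_independence'[of x y] N.a_rcos_self assms
  by metis

lemma coset_subset: "x \<in> carrier M \<Longrightarrow> N +>\<^bsub>M\<^esub> x \<subseteq> carrier M"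
  using submoduleE(1)[OF sub] by (intro a_r_coset_subset_G)

lemma coset_zero: "N +>\<^bsub>M\<^esub> \<zero>\<^bsub>M\<^esub> = N"
  using submoduleE(1)[OF sub] by (rule a_coset_add_zero)

text \<open>The union that defines \<^term>\<open>quot_map Q L f\<close> runs over a single coset, because representatives of the same
  class differ by an element of \<open>N\<close>, which \<open>f\<close> sends into \<open>L\<close>.\<close>

lemma quot_map_coset:
  assumes Q: "module K Q" "submodule L K Q" and f: "linear_map K M Q f"
    and NL: "\<And>x. x \<in> N \<Longrightarrow> f x \<in> L" and x: "x \<in> carrier M"
  shows "quot_map Q L f (N +>\<^bsub>M\<^esub> x) = L +>\<^bsub>Q\<^esub> f x"
proof -
  interpret Q: module_quotient K Q L
    using Q by (simp add: module_quotient_def module_quotient_axioms_def)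
  have "L +>\<^bsub>Q\<^esub> f y = L +>\<^bsub>Q\<^esub> f x" if y: "y \<in> N +>\<^bsub>M\<^esub> x" for y
  proof -
    have yM: "y \<in> carrier M" using coset_subset[OF x] y by auto
    then have "y \<ominus>\<^bsub>M\<^esub> x \<in> N" using coset_mem_iff[OF x] y by blast
    then have "f y \<ominus>\<^bsub>Q\<^esub> f x \<in> L"
      using NL[of "y \<ominus>\<^bsub>M\<^esub> x"] linear_map_diff[OF module_axioms Q(1) f yM x] by simp
    then show ?thesis
      using Q.coset_eq_iff linear_map_closed[OF f] x yM by simp
  qed
  then show ?thesis
    unfolding quot_map_def using N.a_rcos_self[OF x] by blast
qed

lemma quot_carrier: "carrier (quot_module M N) = {N +>\<^bsub>M\<^esub> x | x. x \<in> carrier M}"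
  by (auto simp: quot_module_def A_RCOSETS_def')

lemma quot_closed: "x \<in> carrier M \<Longrightarrow> N +>\<^bsub>M\<^esub> x \<in> carrier (quot_module M N)"
  by (auto simp: quot_carrier)

lemma quot_add:
  assumes "x \<in> carrier M" "y \<in> carrier M"
  shows "(N +>\<^bsub>M\<^esub> x) \<oplus>\<^bsub>quot_module M N\<^esub> (N +>\<^bsub>M\<^esub> y) = N +>\<^bsub>M\<^esub> (x \<oplus>\<^bsub>M\<^esub> y)"
  using N.a_rcos_sum[OF assms] by (simp add: quot_module_def)

lemma quot_smult:
  assumes c: "c \<in> carrier K" and x: "x \<in> carrier M"
  shows "c \<odot>\<^bsub>quot_module M N\<^esub> (N +>\<^bsub>M\<^esub> x) = N +>\<^bsub>M\<^esub> (c \<odot>\<^bsub>M\<^esub> x)"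
proof -
  have "linear_map K M M (\<lambda>x. c \<odot>\<^bsub>M\<^esub> x)"
    using c by (intro linear_mapI) (auto simp: smult_r_distr smult_assoc1[symmetric] R.m_comm)
  then show ?thesis
    using quot_map_coset[OF module_axioms sub _ _ x] submoduleE(4)[OF sub c]
    by (simp add: quot_module_def)
qed

lemma quot_zero: "\<zero>\<^bsub>quot_module M N\<^esub> = N +>\<^bsub>M\<^esub> \<zero>\<^bsub>M\<^esub>"
  by (simp add: quot_module_def coset_zero)

lemma quot_is_module: "module K (quot_module M N)"
proof -
  have rep: thesis if "X \<in> carrier (quot_module M N)" "\<And>x. \<lbrakk>x \<in> carrier M; X = N +>\<^bsub>M\<^esub> x\<rbrakk> \<Longrightarrow> thesis"
    for X thesis
    using that by (auto simp: quot_carrier)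
  note simps = quot_add quot_smult quot_zero quot_closed
  show ?thesis
  proof (rule moduleI)
    show "cring K" by (rule R.is_cring)
    show "abelian_group (quot_module M N)"
    proof (rule abelian_groupI, goal_cases)
      case (6 X)
      then obtain x where x: "X = N +>\<^bsub>M\<^esub> x" "x \<in> carrier M" by (blast elim: rep)
      then show ?case
        by (intro bexI[of _ "N +>\<^bsub>M\<^esub> (\<ominus>\<^bsub>M\<^esub> x)"]) (auto simp: simps l_neg)
    qed (((elim rep)?, simp add: simps a_ac)+)
  qed (((elim rep)?, simp add: simps smult_l_distr smult_r_distr smult_assoc1)+)
qed

lemma quot_proj_linear: "linear_map K M (quot_module M N) (\<lambda>x. N +>\<^bsub>M\<^esub> x)"
  by (intro linear_mapI) (auto simp: quot_add quot_smult intro: quot_closed)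

lemma quot_diff:
  assumes "x \<in> carrier M" "y \<in> carrier M"
  shows "(N +>\<^bsub>M\<^esub> x) \<ominus>\<^bsub>quot_module M N\<^esub> (N +>\<^bsub>M\<^esub> y) = N +>\<^bsub>M\<^esub> (x \<ominus>\<^bsub>M\<^esub> y)"
  using linear_map_diff[OF module_axioms quot_is_module quot_proj_linear] assms by simp

end

lemma module_quotientI: "module K M \<Longrightarrow> submodule N K M \<Longrightarrow> module_quotient K M N"
  by (simp add: module_quotient_def module_quotient_axioms_def)

text \<open>The kernel and the surjectivity are required modulo the submodules only, which is what a homotopy
  inverse provides.\<close>

lemma quot_map_iso:
  assumes P: "module K P" "submodule L K P" and Q: "module K Q" "submodule N K Q"
    and f: "linear_map K P Q f" and ker: "\<And>x. x \<in> carrier P \<Longrightarrow> f x \<in> N \<longleftrightarrow> x \<in> L"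
    and surj: "\<And>y. y \<in> carrier Q \<Longrightarrow> \<exists>x\<in>carrier P. y \<ominus>\<^bsub>Q\<^esub> f x \<in> N"
  shows "quot_map Q N f \<in> module_iso K (quot_module P L) (quot_module Q N)"
proof -
  interpret P: module_quotient K P L by (rule module_quotientI[OF P])
  interpret Q: module_quotient K Q N by (rule module_quotientI[OF Q])
  have LP: "L \<subseteq> carrier P" using P.submoduleE(1)[OF P(2)] .
  have val: "quot_map Q N f (L +>\<^bsub>P\<^esub> x) = N +>\<^bsub>Q\<^esub> f x" if "x \<in> carrier P" for x
    using P.quot_map_coset[OF Q f _ that] ker LP by auto
  note cl = linear_map_closed[OF f]
  have inj: "inj_on (quot_map Q N f) (carrier (quot_module P L))"
  proof (rule inj_onI)
    fix X Y assume XY: "X \<in> carrier (quot_module P L)" "Y \<in> carrier (quot_module P L)"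
      "quot_map Q N f X = quot_map Q N f Y"
    then obtain x y where x: "X = L +>\<^bsub>P\<^esub> x" "x \<in> carrier P" "Y = L +>\<^bsub>P\<^esub> y" "y \<in> carrier P"
      by (auto simp: P.quot_carrier)
    then have "N +>\<^bsub>Q\<^esub> f x = N +>\<^bsub>Q\<^esub> f y" using XY by (simp add: val)
    then have "f (x \<ominus>\<^bsub>P\<^esub> y) \<in> N"
      using x cl by (simp add: Q.coset_eq_iff linear_map_diff[OF P(1) Q(1) f])
    then show "X = Y" using x ker by (simp add: P.coset_eq_iff)
  qed
  have "\<exists>X\<in>carrier (quot_module P L). Y = quot_map Q N f X" if Y: "Y \<in> carrier (quot_module Q N)" for Y
  proof -
    obtain y where y: "Y = N +>\<^bsub>Q\<^esub> y" "y \<in> carrier Q" using Y by (auto simp: Q.quot_carrier)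
    obtain x where x: "x \<in> carrier P" "y \<ominus>\<^bsub>Q\<^esub> f x \<in> N" using surj y by auto
    then have "Y = quot_map Q N f (L +>\<^bsub>P\<^esub> x)"
      using y cl by (simp add: val Q.coset_eq_iff)
    then show ?thesis using x P.quot_closed by blast
  qed
  then have "quot_map Q N f ` carrier (quot_module P L) = carrier (quot_module Q N)"
    using cl by (force simp: P.quot_carrier val intro: Q.quot_closed)
  then show ?thesis
    unfolding module_iso_def iso_def hom_def bij_betw_def using inj cl
    by (auto simp: P.quot_carrier val P.quot_add Q.quot_add
        P.quot_smult Q.quot_smult linear_map_add[OF f] linear_map_smult[OF f]
        intro: Q.quot_closed)
qed

lemma prod_module_iso:
  assumes "f \<in> module_iso K M N" "g \<in> module_iso K M' N'"
  shows "map_prod f g \<in> module_iso K (prod_module M M') (prod_module N N')"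
  using assms
  by (auto simp: module_iso_def iso_def hom_def prod_module_def bij_betw_map_prod)

section \<open>Free modules\<close>

lemma free_module_is_module:
  assumes "cring K" shows "module K (free_module K S)"
proof -
  interpret K: cring K by fact
  have supp: "finite {i. f i \<noteq> \<zero>\<^bsub>K\<^esub>} \<Longrightarrow> finite {i. g i \<noteq> \<zero>\<^bsub>K\<^esub>} \<Longrightarrow>
      finite {i. f i \<oplus>\<^bsub>K\<^esub> g i \<noteq> \<zero>\<^bsub>K\<^esub>}" for f g
    by (rule finite_subset[of _ "{i. f i \<noteq> \<zero>\<^bsub>K\<^esub>} \<union> {i. g i \<noteq> \<zero>\<^bsub>K\<^esub>}"]) auto
  have rng: "range f \<subseteq> carrier K \<longleftrightarrow> (\<forall>i. f i \<in> carrier K)" for f :: "'x \<Rightarrow> _" by auto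
  have supp': "finite {i. f i \<noteq> \<zero>\<^bsub>K\<^esub>} \<Longrightarrow> c \<in> carrier K \<Longrightarrow> finite {i. c \<otimes>\<^bsub>K\<^esub> f i \<noteq> \<zero>\<^bsub>K\<^esub>}" for f c
    by (rule finite_subset[of _ "{i. f i \<noteq> \<zero>\<^bsub>K\<^esub>}"]) auto
  show ?thesis
  proof (rule moduleI)
    show "abelian_group (free_module K S)"
    proof (rule abelian_groupI, goal_cases)
      case (6 x)
      have "(\<lambda>i. \<ominus>\<^bsub>K\<^esub> x i) \<in> carrier (free_module K S)"
        using 6 by (auto simp: free_module_def rng K.add.inv_eq_1_iff)
      then show ?case
        using 6 by (intro bexI[of _ "\<lambda>i. \<ominus>\<^bsub>K\<^esub> x i"]) (auto simp: free_module_def rng K.l_neg)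
    next
      case (1 x y)
      then show ?case by (auto simp: free_module_def rng subset_iff intro: supp) (metis K.l_zero K.zero_closed)
    qed (auto simp: free_module_def rng K.a_ac)
  next
    fix c x assume "c \<in> carrier K" "x \<in> carrier (free_module K S)"
    then show "c \<odot>\<^bsub>free_module K S\<^esub> x \<in> carrier (free_module K S)"
      by (auto simp: free_module_def rng subset_iff intro: supp') (metis K.r_null)
  qed (auto simp: free_module_def rng K.l_distr K.r_distr K.m_assoc assms)
qed

lemma free_gen_closed:
  assumes "cring K" "s \<in> S" shows "free_gen K s \<in> carrier (free_module K S)"
proof -
  interpret K: cring K by fact
  show ?thesis using assms(2)
    by (auto simp: free_module_def free_gen_def intro: finite_subset[of _ "{s}"])
qed

text \<open>The support of a sum is not determined by those of the summands; summing over a common finite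
  superset makes additivity of the linear extension a statement about one index set.\<close>

lemma lin_ext_superset:
  assumes "module K N" "f \<in> carrier (free_module K S)" "\<And>s. s \<in> S \<Longrightarrow> g s \<in> carrier N"
    "finite F" "{i. f i \<noteq> \<zero>\<^bsub>K\<^esub>} \<subseteq> F" "F \<subseteq> S"
  shows "lin_ext K N g f = (\<Oplus>\<^bsub>N\<^esub>i\<in>F. f i \<odot>\<^bsub>N\<^esub> g i)"
proof -
  interpret N: module K N by fact
  have f: "f i \<in> carrier K" for i using assms(2) by (auto simp: free_module_def)
  show ?thesis unfolding lin_ext_def
  proof (rule N.add.finprod_mono_neutral_cong_left)
    show "f i \<odot>\<^bsub>N\<^esub> g i = \<zero>\<^bsub>N\<^esub>" if "i \<in> F - {i. f i \<noteq> \<zero>\<^bsub>K\<^esub>}" for i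
      using that assms(3,6) by auto
    show "(\<lambda>i. f i \<odot>\<^bsub>N\<^esub> g i) \<in> F \<rightarrow> carrier N" using assms(3,6) f by auto
  qed (use assms in auto)
qed

lemma lin_ext_linear:
  assumes "module K N" "\<And>s. s \<in> S \<Longrightarrow> g s \<in> carrier N"
  shows "linear_map K (free_module K S) N (lin_ext K N g)"
proof -
  interpret N: module K N by fact
  interpret F: module K "free_module K S" by (rule free_module_is_module[OF N.R.is_cring])
  let ?s = "\<lambda>f. {i. f i \<noteq> \<zero>\<^bsub>K\<^esub>}"
  have C: "f i \<in> carrier K" "finite (?s f)" "?s f \<subseteq> S" if "f \<in> carrier (free_module K S)" for f i
    using that by (auto simp: free_module_def)
  show ?thesis
  proof (rule linear_mapI)
    fix f assume f: "f \<in> carrier (free_module K S)"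
    note Cf = C[OF f]
    show "lin_ext K N g f \<in> carrier N"
      unfolding lin_ext_def by (rule N.finsum_closed) (use Cf assms(2) in auto)
    fix c assume c: "c \<in> carrier K"
    have cf: "(c \<odot>\<^bsub>free_module K S\<^esub> f) i = c \<otimes>\<^bsub>K\<^esub> f i" for i by (simp add: free_module_def)
    have "lin_ext K N g (c \<odot>\<^bsub>free_module K S\<^esub> f) = (\<Oplus>\<^bsub>N\<^esub>i\<in>?s f. (c \<odot>\<^bsub>free_module K S\<^esub> f) i \<odot>\<^bsub>N\<^esub> g i)"
      using c Cf by (intro lin_ext_superset[OF assms(1) F.smult_closed[OF c f] assms(2)]) (auto simp: cf)
    also have "\<dots> = (\<Oplus>\<^bsub>N\<^esub>i\<in>?s f. c \<odot>\<^bsub>N\<^esub> (f i \<odot>\<^bsub>N\<^esub> g i))"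
      by (rule N.finsum_cong') (use Cf c assms(2) in \<open>auto simp: cf N.smult_assoc1 subset_iff\<close>)
    also have "\<dots> = c \<odot>\<^bsub>N\<^esub> lin_ext K N g f"
      unfolding lin_ext_def
      by (rule N.finsum_smult_ldistr[symmetric]) (use Cf c assms(2) in \<open>auto simp: subset_iff\<close>)
    finally show "lin_ext K N g (c \<odot>\<^bsub>free_module K S\<^esub> f) = c \<odot>\<^bsub>N\<^esub> lin_ext K N g f" .
  next
    fix f h assume f: "f \<in> carrier (free_module K S)" and h: "h \<in> carrier (free_module K S)"
    note Cf = C[OF f] and Ch = C[OF h]
    have fh: "(f \<oplus>\<^bsub>free_module K S\<^esub> h) i = f i \<oplus>\<^bsub>K\<^esub> h i" for i by (simp add: free_module_def)
    let ?F = "?s f \<union> ?s h"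
    have cl: "\<And>i. i \<in> ?F \<Longrightarrow> g i \<in> carrier N" using Cf Ch assms(2) by auto
    have "lin_ext K N g (f \<oplus>\<^bsub>free_module K S\<^esub> h) = (\<Oplus>\<^bsub>N\<^esub>i\<in>?F. (f \<oplus>\<^bsub>free_module K S\<^esub> h) i \<odot>\<^bsub>N\<^esub> g i)"
      using Cf Ch by (intro lin_ext_superset[OF assms(1) F.a_closed[OF f h] assms(2)]) (auto simp: fh)
    also have "\<dots> = (\<Oplus>\<^bsub>N\<^esub>i\<in>?F. f i \<odot>\<^bsub>N\<^esub> g i \<oplus>\<^bsub>N\<^esub> h i \<odot>\<^bsub>N\<^esub> g i)"
      by (rule N.finsum_cong') (use Cf(1) Ch(1) cl in \<open>auto simp: fh N.smult_l_distr\<close>)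
    also have "\<dots> = (\<Oplus>\<^bsub>N\<^esub>i\<in>?F. f i \<odot>\<^bsub>N\<^esub> g i) \<oplus>\<^bsub>N\<^esub> (\<Oplus>\<^bsub>N\<^esub>i\<in>?F. h i \<odot>\<^bsub>N\<^esub> g i)"
      by (rule N.finsum_addf) (use Cf(1) Ch(1) cl in auto)
    also have "(\<Oplus>\<^bsub>N\<^esub>i\<in>?F. f i \<odot>\<^bsub>N\<^esub> g i) = lin_ext K N g f"
      using Cf Ch by (intro lin_ext_superset[OF assms(1) f assms(2), symmetric]) auto
    also have "(\<Oplus>\<^bsub>N\<^esub>i\<in>?F. h i \<odot>\<^bsub>N\<^esub> g i) = lin_ext K N g h"
      using Cf Ch by (intro lin_ext_superset[OF assms(1) h assms(2), symmetric]) auto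
    finally show "lin_ext K N g (f \<oplus>\<^bsub>free_module K S\<^esub> h) = lin_ext K N g f \<oplus>\<^bsub>N\<^esub> lin_ext K N g h" .
  qed
qed

lemma lin_ext_gen:
  assumes "module K N" "\<And>s. s \<in> S \<Longrightarrow> g s \<in> carrier N" "s \<in> S"
  shows "lin_ext K N g (free_gen K s) = g s"
proof -
  interpret N: module K N by fact
  have "lin_ext K N g (free_gen K s) = (\<Oplus>\<^bsub>N\<^esub>i\<in>{s}. free_gen K s i \<odot>\<^bsub>N\<^esub> g i)"
    by (rule lin_ext_superset[OF assms(1) free_gen_closed[OF N.R.is_cring assms(3)] assms(2)])
      (use assms(3) in \<open>auto simp: free_gen_def split: if_splits\<close>)
  then show ?thesis using assms(2)[OF assms(3)] by (simp add: free_gen_def)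
qed

text \<open>By induction on the support, removing one generator at a time.\<close>

lemma free_module_in_submodule:
  assumes "cring K" "submodule H K (free_module K S)" "\<And>s. s \<in> S \<Longrightarrow> free_gen K s \<in> H"
    "f \<in> carrier (free_module K S)"
  shows "f \<in> H"
proof -
  interpret K: cring K by fact
  interpret F: module K "free_module K S" by (rule free_module_is_module[OF assms(1)])
  note H = F.submoduleE[OF assms(2)]
  have z: "\<zero>\<^bsub>free_module K S\<^esub> \<in> H"
    using subgroup.one_closed[OF submodule.axioms(1)[OF assms(2)]] by simp
  have "\<forall>f\<in>carrier (free_module K S). {i. f i \<noteq> \<zero>\<^bsub>K\<^esub>} \<subseteq> T \<longrightarrow> f \<in> H" if "finite T" for T
    using that
  proof induction
    case empty
    have "f = \<zero>\<^bsub>free_module K S\<^esub>" if "{i. f i \<noteq> \<zero>\<^bsub>K\<^esub>} \<subseteq> {}" for f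
      using that by (auto simp: free_module_def)
    then show ?case using z by blast
  next
    case (insert s T)
    show ?case
    proof (intro ballI impI)
      fix f assume f: "f \<in> carrier (free_module K S)" "{i. f i \<noteq> \<zero>\<^bsub>K\<^esub>} \<subseteq> insert s T"
      have fK: "f i \<in> carrier K" for i using f by (auto simp: free_module_def)
      show "f \<in> H"
      proof (cases "f s = \<zero>\<^bsub>K\<^esub>")
        case True
        then show ?thesis using insert.IH f by auto
      next
        case False
        then have s: "s \<in> S" using f by (auto simp: free_module_def)
        have c: "f(s := \<zero>\<^bsub>K\<^esub>) \<in> carrier (free_module K S)"
          using f by (auto simp: free_module_def intro: finite_subset)
        moreover have "{i. (f(s := \<zero>\<^bsub>K\<^esub>)) i \<noteq> \<zero>\<^bsub>K\<^esub>} \<subseteq> T"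
          using f(2) by auto
        ultimately have "f(s := \<zero>\<^bsub>K\<^esub>) \<in> H"
          using insert.IH by blast
        moreover have "f = f(s := \<zero>\<^bsub>K\<^esub>) \<oplus>\<^bsub>free_module K S\<^esub> (f s \<odot>\<^bsub>free_module K S\<^esub> free_gen K s)"
          using fK by (auto simp: free_module_def free_gen_def)
        ultimately show ?thesis using H(4,5) assms(3)[OF s] fK by metis
      qed
    qed
  qed
  moreover have "finite {i. f i \<noteq> \<zero>\<^bsub>K\<^esub>}" using assms(4) by (auto simp: free_module_def)
  ultimately show ?thesis using assms(4) by blast
qed

lemma submodule_generated_least:
  "submodule H K M \<Longrightarrow> G \<subseteq> H \<Longrightarrow> submodule_generated K M G \<subseteq> H"
  by (auto simp: submodule_generated_def)

lemma submodule_generated_contains: "G \<subseteq> submodule_generated K M G"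
  by (auto simp: submodule_generated_def)

lemma submodule_generated_is_submodule:
  assumes "module K M" "G \<subseteq> carrier M"
  shows "submodule (submodule_generated K M G) K M"
proof -
  interpret M: module K M by fact
  have z: "submodule H K M \<Longrightarrow> \<zero>\<^bsub>M\<^esub> \<in> H" for H
    using subgroup.one_closed[OF submodule.axioms(1)] by fastforce
  show ?thesis
  proof (rule M.submoduleI)
    show "submodule_generated K M G \<subseteq> carrier M"
      using M.carrier_is_submodule assms(2) by (rule submodule_generated_least)
  qed (auto simp: submodule_generated_def z M.submoduleE(3-5))
qed

section \<open>Tensors and their universal property\<close>

abbreviation tuples :: "('k, 'a) module \<Rightarrow> nat \<Rightarrow> 'a list set" where
  "tuples A n \<equiv> {as. set as \<subseteq> carrier A \<and> length as = Suc n}"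

definition multilinear ::
  "('k, 'r) ring_scheme \<Rightarrow> ('k, 'a) module \<Rightarrow> nat \<Rightarrow> ('k, 'b) module \<Rightarrow> ('a list \<Rightarrow> 'b) \<Rightarrow> bool" where
  "multilinear K A n N g \<longleftrightarrow>
     (\<forall>as\<in>tuples A n. g as \<in> carrier N) \<and>
     (\<forall>us vs. set us \<subseteq> carrier A \<and> set vs \<subseteq> carrier A \<and> length us + length vs = n \<longrightarrow>
        (\<forall>x\<in>carrier A. \<forall>y\<in>carrier A.
           g (us @ [x \<oplus>\<^bsub>A\<^esub> y] @ vs) = g (us @ [x] @ vs) \<oplus>\<^bsub>N\<^esub> g (us @ [y] @ vs)) \<and>
        (\<forall>c\<in>carrier K. \<forall>x\<in>carrier A. g (us @ [c \<odot>\<^bsub>A\<^esub> x] @ vs) = c \<odot>\<^bsub>N\<^esub> g (us @ [x] @ vs)))"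

definition tensor ::
  "('k, 'r) ring_scheme \<Rightarrow> ('k, 'a) module \<Rightarrow> nat \<Rightarrow> 'a list \<Rightarrow> ('a list \<Rightarrow> 'k) set" where
  "tensor K A n as = tensor_rels K A n +>\<^bsub>free_chains K A n\<^esub> free_gen K as"

text \<open>The linear map out of the chains that is induced by a multilinear \<open>g\<close>. Which representative is chosen
  does not matter, because the linear extension of \<open>g\<close> vanishes on the tensor relations.\<close>

definition tensor_lift ::
  "('k, 'r) ring_scheme \<Rightarrow> ('k, 'b) module \<Rightarrow> ('a list \<Rightarrow> 'b) \<Rightarrow> ('a list \<Rightarrow> 'k) set \<Rightarrow> 'b" where
  "tensor_lift K N g X = lin_ext K N g (SOME x. x \<in> X)"

text \<open>This fixes the record type of the algebra to be the one on which chains are defined.\<close>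

locale hochschild = assoc_algebra K A for K :: "('k, 'r) ring_scheme" and A :: "('k, 'a) module"
begin

lemma free_chains_module: "module K (free_chains K A n)"
  unfolding free_chains_def by (rule free_module_is_module[OF R.is_cring])

lemma gen_closed: "as \<in> tuples A n \<Longrightarrow> free_gen K as \<in> carrier (free_chains K A n)"
  unfolding free_chains_def by (rule free_gen_closed[OF R.is_cring])

lemma multilinear_rels_subset: "multilinear_rels K A n \<subseteq> carrier (free_chains K A n)"
proof -
  interpret F: module K "free_chains K A n" by (rule free_chains_module)
  show ?thesis
  proof
    have g: "free_gen K (us @ [z] @ vs) \<in> carrier (free_chains K A n)"
      if "set us \<subseteq> carrier A" "set vs \<subseteq> carrier A" "length us + length vs = n" "z \<in> carrier A" for us vs z
      using that by (intro gen_closed) auto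
    fix z assume "z \<in> multilinear_rels K A n"
    then show "z \<in> carrier (free_chains K A n)"
      unfolding multilinear_rels_def
    proof (elim UnE CollectE exE conjE, goal_cases)
      case (1 us vs x y)
      show ?case unfolding 1(1) using 1(2-) by (intro F.minus_closed F.a_closed g M.a_closed)
    next
      case (2 us vs c x)
      show ?case unfolding 2(1) using 2(2-) by (intro F.minus_closed F.smult_closed g smult_closed)
    qed
  qed
qed

lemma tensor_rels_submodule: "submodule (tensor_rels K A n) K (free_chains K A n)"
  unfolding tensor_rels_def
  by (rule submodule_generated_is_submodule[OF free_chains_module multilinear_rels_subset])

lemma chains_quotient: "module_quotient K (free_chains K A n) (tensor_rels K A n)"
  by (rule module_quotientI[OF free_chains_module tensor_rels_submodule])

lemma chains_module: "module K (hoch_chains K A n)"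
  unfolding hoch_chains_def by (rule module_quotient.quot_is_module[OF chains_quotient])

lemma tensor_closed: "as \<in> tuples A n \<Longrightarrow> tensor K A n as \<in> carrier (hoch_chains K A n)"
  unfolding tensor_def hoch_chains_def
  by (rule module_quotient.quot_closed[OF chains_quotient gen_closed])

lemma tensor_multilinear: "multilinear K A n (hoch_chains K A n) (tensor K A n)"
proof -
  interpret F: module_quotient K "free_chains K A n" "tensor_rels K A n" by (rule chains_quotient)
  have rel: "x \<in> multilinear_rels K A n \<Longrightarrow> x \<in> tensor_rels K A n" for x
    unfolding tensor_rels_def using submodule_generated_contains by (rule subsetD)
  show ?thesis unfolding multilinear_def
  proof (intro conjI ballI allI impI, goal_cases)
    case (1 as)
    then show ?case by (rule tensor_closed)
  next
    case (2 us vs x y)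
    then have H: "set us \<subseteq> carrier A" "set vs \<subseteq> carrier A" "length us + length vs = n" by auto
    have g: "free_gen K (us @ [z] @ vs) \<in> carrier (free_chains K A n)" if "z \<in> carrier A" for z
      using H that by (intro gen_closed) auto
    have "free_gen K (us @ [x \<oplus>\<^bsub>A\<^esub> y] @ vs) \<ominus>\<^bsub>free_chains K A n\<^esub>
        (free_gen K (us @ [x] @ vs) \<oplus>\<^bsub>free_chains K A n\<^esub> free_gen K (us @ [y] @ vs)) \<in> tensor_rels K A n"
      by (rule rel, unfold multilinear_rels_def, rule UnI1, rule CollectI,
          intro exI conjI, rule refl, (rule H 2(2,3))+)
    moreover note gs = g[OF M.a_closed[OF 2(2,3)]] g[OF 2(2)] g[OF 2(3)]
    ultimately show ?case
      unfolding tensor_def hoch_chains_def F.quot_add[OF gs(2,3)]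
      by (subst F.coset_eq_iff[OF gs(1) F.a_closed[OF gs(2,3)]])
  next
    case (3 us vs c x)
    then have H: "set us \<subseteq> carrier A" "set vs \<subseteq> carrier A" "length us + length vs = n" by auto
    have g: "free_gen K (us @ [z] @ vs) \<in> carrier (free_chains K A n)" if "z \<in> carrier A" for z
      using H that by (intro gen_closed) auto
    have "free_gen K (us @ [c \<odot>\<^bsub>A\<^esub> x] @ vs) \<ominus>\<^bsub>free_chains K A n\<^esub>
        (c \<odot>\<^bsub>free_chains K A n\<^esub> free_gen K (us @ [x] @ vs)) \<in> tensor_rels K A n"
      by (rule rel, unfold multilinear_rels_def, rule UnI2, rule CollectI,
          intro exI conjI, rule refl, (rule H 3(2,3))+)
    moreover note gs = g[OF smult_closed[OF 3(2,3)]] g[OF 3(3)]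
    ultimately show ?case
      unfolding tensor_def hoch_chains_def F.quot_smult[OF 3(2) gs(2)]
      by (subst F.coset_eq_iff[OF gs(1) F.smult_closed[OF 3(2) gs(2)]])
  qed
qed

text \<open>The kernel of the linear extension is a submodule, and it contains the generators of the tensor
  relations by multilinearity.\<close>

lemma lin_ext_rels:
  assumes N: "module K N" and g: "multilinear K A n N g" and x: "x \<in> tensor_rels K A n"
  shows "lin_ext K N g x = \<zero>\<^bsub>N\<^esub>"
proof -
  interpret N: module K N by fact
  interpret F: module K "free_chains K A n" by (rule free_chains_module)
  have gc: "\<And>as. as \<in> tuples A n \<Longrightarrow> g as \<in> carrier N" using g by (auto simp: multilinear_def)
  have lin: "linear_map K (free_chains K A n) N (lin_ext K N g)"
    unfolding free_chains_def using N gc by (rule lin_ext_linear)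
  have gen: "lin_ext K N g (free_gen K as) = g as" if "as \<in> tuples A n" for as
    using lin_ext_gen[OF N gc that] .
  note lin_simps = linear_map_diff[OF free_chains_module N lin] linear_map_add[OF lin]
    linear_map_smult[OF lin] gen gc gen_closed N.diff_self
  have "submodule {x \<in> carrier (free_chains K A n). lin_ext K N g x \<in> {\<zero>\<^bsub>N\<^esub>}} K (free_chains K A n)"
    by (rule submodule_preimage[OF free_chains_module N lin submodule_zero[OF N]])
  moreover have "multilinear_rels K A n \<subseteq> {x \<in> carrier (free_chains K A n). lin_ext K N g x \<in> {\<zero>\<^bsub>N\<^esub>}}"
  proof
    fix z assume z: "z \<in> multilinear_rels K A n"
    have "lin_ext K N g z = \<zero>\<^bsub>N\<^esub>"
      using z unfolding multilinear_rels_def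
    proof (elim UnE CollectE exE conjE, goal_cases)
      case (1 us vs x y)
      then show ?case
        using g unfolding multilinear_def by (simp add: lin_simps del: append_Cons)
    next
      case (2 us vs c x)
      then show ?case
        using g unfolding multilinear_def by (simp add: lin_simps del: append_Cons)
    qed
    then show "z \<in> {x \<in> carrier (free_chains K A n). lin_ext K N g x \<in> {\<zero>\<^bsub>N\<^esub>}}"
      using z multilinear_rels_subset by auto
  qed
  ultimately show ?thesis
    using x submodule_generated_least unfolding tensor_rels_def by blast
qed

lemma chain_repr:
  assumes "z \<in> carrier (hoch_chains K A n)"
  obtains x where "x \<in> carrier (free_chains K A n)" "z = tensor_rels K A n +>\<^bsub>free_chains K A n\<^esub> x"
  using assms module_quotient.quot_carrier[OF chains_quotient] by (auto simp: hoch_chains_def)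

lemma chain_proj_linear:
  "linear_map K (free_chains K A n) (hoch_chains K A n)
     (\<lambda>x. tensor_rels K A n +>\<^bsub>free_chains K A n\<^esub> x)"
  unfolding hoch_chains_def by (rule module_quotient.quot_proj_linear[OF chains_quotient])

lemma tensor_lift_coset:
  assumes N: "module K N" and g: "multilinear K A n N g" and x: "x \<in> carrier (free_chains K A n)"
  shows "tensor_lift K N g (tensor_rels K A n +>\<^bsub>free_chains K A n\<^esub> x) = lin_ext K N g x"
proof -
  interpret N: module K N by fact
  interpret F: module_quotient K "free_chains K A n" "tensor_rels K A n" by (rule chains_quotient)
  have gc: "\<And>as. as \<in> tuples A n \<Longrightarrow> g as \<in> carrier N" using g by (auto simp: multilinear_def)
  have lin: "linear_map K (free_chains K A n) N (lin_ext K N g)"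
    unfolding free_chains_def using N gc by (rule lin_ext_linear)
  define y where "y = (SOME y. y \<in> tensor_rels K A n +>\<^bsub>free_chains K A n\<^esub> x)"
  have y: "y \<in> tensor_rels K A n +>\<^bsub>free_chains K A n\<^esub> x"
    unfolding y_def some_in_eq using F.N.a_rcos_self[OF x] by blast
  then have yc: "y \<in> carrier (free_chains K A n)" using F.coset_subset[OF x] by auto
  then have "lin_ext K N g (y \<ominus>\<^bsub>free_chains K A n\<^esub> x) = \<zero>\<^bsub>N\<^esub>"
    using y F.coset_mem_iff[OF x yc] lin_ext_rels[OF N g] by simp
  then have "lin_ext K N g y \<ominus>\<^bsub>N\<^esub> lin_ext K N g x = \<zero>\<^bsub>N\<^esub>"
    using linear_map_diff[OF free_chains_module N lin yc x] by simp
  then have "lin_ext K N g y = lin_ext K N g x"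
    using linear_map_closed[OF lin] x yc by (simp add: N.diff_eq_iff)
  then show ?thesis by (simp add: tensor_lift_def y_def)
qed

text \<open>The universal property of the tensor product.\<close>

lemma tensor_lift:
  assumes N: "module K N" and g: "multilinear K A n N g"
  shows tensor_lift_linear: "linear_map K (hoch_chains K A n) N (tensor_lift K N g)"
    and tensor_lift_tensor: "\<And>as. as \<in> tuples A n \<Longrightarrow> tensor_lift K N g (tensor K A n as) = g as"
proof -
  have gc: "\<And>as. as \<in> tuples A n \<Longrightarrow> g as \<in> carrier N" using g by (auto simp: multilinear_def)
  have lin: "linear_map K (free_chains K A n) N (lin_ext K N g)"
    unfolding free_chains_def using N gc by (rule lin_ext_linear)
  interpret F: module K "free_chains K A n" by (rule free_chains_module)
  note val = tensor_lift_coset[OF N g]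
  show "linear_map K (hoch_chains K A n) N (tensor_lift K N g)"
  proof (rule linear_mapI, goal_cases)
    case (1 z) then show ?case by (elim chain_repr) (simp add: val linear_map_closed[OF lin])
  next
    case (2 z w) then show ?case
      by (elim chain_repr) (simp add: val linear_map_add[OF lin] linear_map_closed[OF lin]
          linear_map_add[OF chain_proj_linear, symmetric])
  next
    case (3 c z) then show ?case
      by (elim chain_repr) (simp add: val linear_map_smult[OF lin] linear_map_closed[OF lin]
          linear_map_smult[OF chain_proj_linear, symmetric])
  qed
  show "\<And>as. as \<in> tuples A n \<Longrightarrow> tensor_lift K N g (tensor K A n as) = g as"
    unfolding tensor_def using lin_ext_gen[OF N gc, where S = "tuples A n"]
    by (simp add: val[OF gen_closed])
qed

text \<open>Elementary tensors generate the chains, so a linear map that sends them into a submodule sends all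
  chains there. With a difference of two maps for \<open>f\<close> this compares maps up to boundaries, which
  is how homotopies are verified below.\<close>

lemma chain_in_submodule:
  assumes N: "module K N" "submodule H K N" and f: "linear_map K (hoch_chains K A n) N f"
    and t: "\<And>as. as \<in> tuples A n \<Longrightarrow> f (tensor K A n as) \<in> H" and z: "z \<in> carrier (hoch_chains K A n)"
  shows "f z \<in> H"
proof -
  obtain x where x: "x \<in> carrier (free_chains K A n)" "z = tensor_rels K A n +>\<^bsub>free_chains K A n\<^esub> x"
    using z by (rule chain_repr)
  let ?p = "\<lambda>x. tensor_rels K A n +>\<^bsub>free_chains K A n\<^esub> x"
  have lin: "linear_map K (free_chains K A n) N (\<lambda>x. f (?p x))"
    by (rule linear_map_comp[OF f chain_proj_linear])
  have "x \<in> {x \<in> carrier (free_chains K A n). f (?p x) \<in> H}"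
  proof (rule free_module_in_submodule[OF R.is_cring, where S = "tuples A n", folded free_chains_def])
    show "submodule {x \<in> carrier (free_chains K A n). f (?p x) \<in> H} K (free_chains K A n)"
      by (rule submodule_preimage[OF free_chains_module N(1) lin N(2)])
    show "free_gen K as \<in> {x \<in> carrier (free_chains K A n). f (?p x) \<in> H}" if "as \<in> tuples A n" for as
      using t[OF that] gen_closed[OF that] by (simp add: tensor_def)
  qed (rule x(1))
  then show ?thesis using x(2) by simp
qed

lemma chain_map_eqI:
  assumes N: "module K N" and f: "linear_map K (hoch_chains K A n) N f"
    and g: "linear_map K (hoch_chains K A n) N g"
    and t: "\<And>as. as \<in> tuples A n \<Longrightarrow> f (tensor K A n as) = g (tensor K A n as)"
    and z: "z \<in> carrier (hoch_chains K A n)"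
  shows "f z = g z"
proof -
  interpret N: module K N by fact
  note cl = linear_map_closed[OF f] linear_map_closed[OF g]
  have "f z \<ominus>\<^bsub>N\<^esub> g z \<in> {\<zero>\<^bsub>N\<^esub>}"
  proof (rule chain_in_submodule[OF N submodule_zero[OF N] linear_map_difference[OF N f g] _ z])
    fix as assume as: "as \<in> tuples A n"
    show "f (tensor K A n as) \<ominus>\<^bsub>N\<^esub> g (tensor K A n as) \<in> {\<zero>\<^bsub>N\<^esub>}"
      using t[OF as] cl(2)[OF tensor_closed[OF as]] by (simp add: N.diff_self)
  qed
  then show ?thesis using cl z by (simp add: N.diff_eq_iff)
qed

text \<open>Both sides are induced by linear maps on the free module that agree on generators. The values of
  \<open>g\<close> lie in a free module, where they are multilinear only modulo the tensor relations, hence the form of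
  the second hypothesis.\<close>

lemma tensor_map_eq_lift:
  assumes g: "\<And>as. as \<in> tuples A n \<Longrightarrow> g as \<in> carrier (free_chains K A m)"
    and ml: "multilinear K A n (hoch_chains K A m) (\<lambda>as. tensor_rels K A m +>\<^bsub>free_chains K A m\<^esub> g as)"
    and z: "z \<in> carrier (hoch_chains K A n)"
  shows "tensor_map K A m g z =
    tensor_lift K (hoch_chains K A m) (\<lambda>as. tensor_rels K A m +>\<^bsub>free_chains K A m\<^esub> g as) z"
proof -
  let ?p = "\<lambda>x. tensor_rels K A m +>\<^bsub>free_chains K A m\<^esub> x"
  interpret Fm: module_quotient K "free_chains K A m" "tensor_rels K A m" by (rule chains_quotient)
  interpret F: module_quotient K "free_chains K A n" "tensor_rels K A n" by (rule chains_quotient)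
  have lin: "linear_map K (free_chains K A n) (free_chains K A m) (lin_ext K (free_chains K A m) g)"
    unfolding free_chains_def[of K A n] using free_chains_module g by (rule lin_ext_linear)
  have gc: "\<And>as. as \<in> tuples A n \<Longrightarrow> ?p (g as) \<in> carrier (hoch_chains K A m)"
    using ml by (auto simp: multilinear_def)
  have lin': "linear_map K (free_chains K A n) (hoch_chains K A m)
      (lin_ext K (hoch_chains K A m) (\<lambda>as. ?p (g as)))"
    unfolding free_chains_def[of K A n] using chains_module gc by (rule lin_ext_linear)
  have eq: "?p (lin_ext K (free_chains K A m) g x) = lin_ext K (hoch_chains K A m) (\<lambda>as. ?p (g as)) x"
    if "x \<in> carrier (free_chains K A n)" for x
  proof -
    interpret C: module K "hoch_chains K A m" by (rule chains_module)
    have pl: "linear_map K (free_chains K A n) (hoch_chains K A m) (\<lambda>x. ?p (lin_ext K (free_chains K A m) g x))"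
      by (rule linear_map_comp[OF chain_proj_linear lin])
    let ?d = "\<lambda>x. ?p (lin_ext K (free_chains K A m) g x) \<ominus>\<^bsub>hoch_chains K A m\<^esub>
        lin_ext K (hoch_chains K A m) (\<lambda>as. ?p (g as)) x"
    have "x \<in> {x \<in> carrier (free_chains K A n). ?d x \<in> {\<zero>\<^bsub>hoch_chains K A m\<^esub>}}"
    proof (rule free_module_in_submodule[OF R.is_cring, where S = "tuples A n", folded free_chains_def])
      show "submodule {x \<in> carrier (free_chains K A n). ?d x \<in> {\<zero>\<^bsub>hoch_chains K A m\<^esub>}} K (free_chains K A n)"
        by (rule submodule_preimage[OF free_chains_module chains_module
            linear_map_difference[OF chains_module pl lin'] submodule_zero[OF chains_module]])
      fix as assume as: "as \<in> tuples A n"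
      have "?d (free_gen K as) = \<zero>\<^bsub>hoch_chains K A m\<^esub>"
        using lin_ext_gen[OF free_chains_module g as] lin_ext_gen[OF chains_module gc as] gc[OF as]
        by (simp add: C.diff_self)
      then show "free_gen K as \<in> {x \<in> carrier (free_chains K A n). ?d x \<in> {\<zero>\<^bsub>hoch_chains K A m\<^esub>}}"
        using gen_closed[OF as] by simp
    qed (rule that)
    then show ?thesis
      using linear_map_closed[OF pl that] linear_map_closed[OF lin' that] by (simp add: C.diff_eq_iff)
  qed
  have rels: "lin_ext K (free_chains K A m) g x \<in> tensor_rels K A m" if "x \<in> tensor_rels K A n" for x
  proof -
    have x: "x \<in> carrier (free_chains K A n)" using that F.submoduleE(1)[OF F.sub] by auto
    have "?p (lin_ext K (free_chains K A m) g x) = ?p \<zero>\<^bsub>free_chains K A m\<^esub>"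
      using eq[OF x] lin_ext_rels[OF chains_module ml that]
      by (simp add: hoch_chains_def Fm.quot_zero)
    then show ?thesis
      using linear_map_closed[OF lin x] by (simp add: Fm.coset_eq_iff Fm.diff_zero)
  qed
  obtain x where x: "x \<in> carrier (free_chains K A n)" "z = tensor_rels K A n +>\<^bsub>free_chains K A n\<^esub> x"
    using z by (rule chain_repr)
  have "tensor_map K A m g z = ?p (lin_ext K (free_chains K A m) g x)"
    unfolding tensor_map_def x(2)
    by (rule F.quot_map_coset[OF free_chains_module tensor_rels_submodule lin rels x(1)])
  also have "\<dots> = tensor_lift K (hoch_chains K A m) (\<lambda>as. ?p (g as)) z"
    unfolding x(2) tensor_lift_coset[OF chains_module ml x(1)] by (rule eq[OF x(1)])
  finally show ?thesis .
qed

end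

section \<open>Elementary tensors and the boundary in low degrees\<close>

context hochschild
begin

abbreviation C :: "nat \<Rightarrow> ('k, ('a list \<Rightarrow> 'k) set) module" where "C n \<equiv> hoch_chains K A n"

sublocale C: module K "C n" for n
  by (rule chains_module)

abbreviation T0 :: "'a \<Rightarrow> ('a list \<Rightarrow> 'k) set" where "T0 a \<equiv> tensor K A 0 [a]"
abbreviation T1 :: "'a \<Rightarrow> 'a \<Rightarrow> ('a list \<Rightarrow> 'k) set" where "T1 a b \<equiv> tensor K A (Suc 0) [a, b]"
abbreviation T2 :: "'a \<Rightarrow> 'a \<Rightarrow> 'a \<Rightarrow> ('a list \<Rightarrow> 'k) set" where
  "T2 a b c \<equiv> tensor K A (Suc (Suc 0)) [a, b, c]"

lemma T_closed [simp, intro]: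
  "a \<in> carrier A \<Longrightarrow> T0 a \<in> carrier (C 0)"
  "\<lbrakk>a \<in> carrier A; b \<in> carrier A\<rbrakk> \<Longrightarrow> T1 a b \<in> carrier (C (Suc 0))"
  "\<lbrakk>a \<in> carrier A; b \<in> carrier A; c \<in> carrier A\<rbrakk> \<Longrightarrow> T2 a b c \<in> carrier (C (Suc (Suc 0)))"
  by (auto intro!: tensor_closed)

lemma tensor_add:
  assumes "set us \<subseteq> carrier A" "set vs \<subseteq> carrier A" "length us + length vs = n" "x \<in> carrier A" "y \<in> carrier A"
  shows "tensor K A n (us @ [x \<oplus>\<^bsub>A\<^esub> y] @ vs) =
    tensor K A n (us @ [x] @ vs) \<oplus>\<^bsub>C n\<^esub> tensor K A n (us @ [y] @ vs)"
  using tensor_multilinear assms unfolding multilinear_def by blast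

lemma tensor_smult:
  assumes "set us \<subseteq> carrier A" "set vs \<subseteq> carrier A" "length us + length vs = n" "c \<in> carrier K" "x \<in> carrier A"
  shows "tensor K A n (us @ [c \<odot>\<^bsub>A\<^esub> x] @ vs) = c \<odot>\<^bsub>C n\<^esub> tensor K A n (us @ [x] @ vs)"
  using tensor_multilinear assms unfolding multilinear_def by blast

lemma T0_linear:
  "\<lbrakk>x \<in> carrier A; y \<in> carrier A\<rbrakk> \<Longrightarrow> T0 (x \<oplus>\<^bsub>A\<^esub> y) = T0 x \<oplus>\<^bsub>C 0\<^esub> T0 y"
  "\<lbrakk>k \<in> carrier K; x \<in> carrier A\<rbrakk> \<Longrightarrow> T0 (k \<odot>\<^bsub>A\<^esub> x) = k \<odot>\<^bsub>C 0\<^esub> T0 x"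
  using tensor_add[of "[]" "[]" 0] tensor_smult[of "[]" "[]" 0] by simp_all

lemma T1_linear:
  "\<lbrakk>x \<in> carrier A; y \<in> carrier A; b \<in> carrier A\<rbrakk> \<Longrightarrow>
    T1 (x \<oplus>\<^bsub>A\<^esub> y) b = T1 x b \<oplus>\<^bsub>C (Suc 0)\<^esub> T1 y b"
  "\<lbrakk>x \<in> carrier A; y \<in> carrier A; b \<in> carrier A\<rbrakk> \<Longrightarrow>
    T1 b (x \<oplus>\<^bsub>A\<^esub> y) = T1 b x \<oplus>\<^bsub>C (Suc 0)\<^esub> T1 b y"
  "\<lbrakk>k \<in> carrier K; x \<in> carrier A; b \<in> carrier A\<rbrakk> \<Longrightarrow>
    T1 (k \<odot>\<^bsub>A\<^esub> x) b = k \<odot>\<^bsub>C (Suc 0)\<^esub> T1 x b"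
  "\<lbrakk>k \<in> carrier K; x \<in> carrier A; b \<in> carrier A\<rbrakk> \<Longrightarrow>
    T1 b (k \<odot>\<^bsub>A\<^esub> x) = k \<odot>\<^bsub>C (Suc 0)\<^esub> T1 b x"
  using tensor_add[of "[]" "[b]" "Suc 0"] tensor_smult[of "[]" "[b]" "Suc 0"]
    tensor_add[of "[b]" "[]" "Suc 0"] tensor_smult[of "[b]" "[]" "Suc 0"] by simp_all

lemma T0_map_linear: "linear_map K A (C 0) T0"
  by (rule linear_mapI) (auto simp: T0_linear)

lemma T0_diff:
  "\<lbrakk>x \<in> carrier A; y \<in> carrier A\<rbrakk> \<Longrightarrow> T0 (x \<ominus>\<^bsub>A\<^esub> y) = T0 x \<ominus>\<^bsub>C 0\<^esub> T0 y"
  by (rule linear_map_diff[OF module_axioms chains_module T0_map_linear])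

lemma T1_map_linear:
  "b \<in> carrier A \<Longrightarrow> linear_map K A (C (Suc 0)) (\<lambda>x. T1 x b)"
  "b \<in> carrier A \<Longrightarrow> linear_map K A (C (Suc 0)) (T1 b)"
  by (rule linear_mapI; simp add: T1_linear)+

lemma T1_diff:
  "\<lbrakk>x \<in> carrier A; y \<in> carrier A; b \<in> carrier A\<rbrakk> \<Longrightarrow>
    T1 (x \<ominus>\<^bsub>A\<^esub> y) b = T1 x b \<ominus>\<^bsub>C (Suc 0)\<^esub> T1 y b"
  "\<lbrakk>x \<in> carrier A; y \<in> carrier A; b \<in> carrier A\<rbrakk> \<Longrightarrow>
    T1 b (x \<ominus>\<^bsub>A\<^esub> y) = T1 b x \<ominus>\<^bsub>C (Suc 0)\<^esub> T1 b y"
  using linear_map_diff[OF module_axioms chains_module T1_map_linear(1)]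
    linear_map_diff[OF module_axioms chains_module T1_map_linear(2)] by auto

lemma T_zero:
  "T0 \<zero>\<^bsub>A\<^esub> = \<zero>\<^bsub>C 0\<^esub>"
  "b \<in> carrier A \<Longrightarrow> T1 \<zero>\<^bsub>A\<^esub> b = \<zero>\<^bsub>C (Suc 0)\<^esub>"
  "b \<in> carrier A \<Longrightarrow> T1 b \<zero>\<^bsub>A\<^esub> = \<zero>\<^bsub>C (Suc 0)\<^esub>"
  using linear_map_zero[OF module_axioms chains_module T0_map_linear]
    linear_map_zero[OF module_axioms chains_module T1_map_linear(1)]
    linear_map_zero[OF module_axioms chains_module T1_map_linear(2)] by auto

lemma T2_linear:
  "\<lbrakk>x \<in> carrier A; y \<in> carrier A; b \<in> carrier A; c \<in> carrier A\<rbrakk> \<Longrightarrow>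
    T2 (x \<oplus>\<^bsub>A\<^esub> y) b c = T2 x b c \<oplus>\<^bsub>C (Suc (Suc 0))\<^esub> T2 y b c"
  "\<lbrakk>x \<in> carrier A; y \<in> carrier A; b \<in> carrier A; c \<in> carrier A\<rbrakk> \<Longrightarrow>
    T2 b (x \<oplus>\<^bsub>A\<^esub> y) c = T2 b x c \<oplus>\<^bsub>C (Suc (Suc 0))\<^esub> T2 b y c"
  "\<lbrakk>x \<in> carrier A; y \<in> carrier A; b \<in> carrier A; c \<in> carrier A\<rbrakk> \<Longrightarrow>
    T2 b c (x \<oplus>\<^bsub>A\<^esub> y) = T2 b c x \<oplus>\<^bsub>C (Suc (Suc 0))\<^esub> T2 b c y"
  using tensor_add[of "[]" "[b, c]" "Suc (Suc 0)"] tensor_add[of "[b]" "[c]" "Suc (Suc 0)"]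
    tensor_add[of "[b, c]" "[]" "Suc (Suc 0)"] by simp_all

lemma tuples_cases:
  "as \<in> tuples A 0 \<longleftrightarrow> (\<exists>a\<in>carrier A. as = [a])"
  "as \<in> tuples A (Suc 0) \<longleftrightarrow> (\<exists>a\<in>carrier A. \<exists>b\<in>carrier A. as = [a, b])"
  "as \<in> tuples A (Suc (Suc 0)) \<longleftrightarrow> (\<exists>a\<in>carrier A. \<exists>b\<in>carrier A. \<exists>c\<in>carrier A. as = [a, b, c])"
  by (auto simp: length_Suc_conv)

lemma multilinear0I:
  assumes "\<And>a. a \<in> carrier A \<Longrightarrow> g [a] \<in> carrier N"
    and "\<And>x y. \<lbrakk>x \<in> carrier A; y \<in> carrier A\<rbrakk> \<Longrightarrow> g [x \<oplus>\<^bsub>A\<^esub> y] = g [x] \<oplus>\<^bsub>N\<^esub> g [y]"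
    and "\<And>k x. \<lbrakk>k \<in> carrier K; x \<in> carrier A\<rbrakk> \<Longrightarrow> g [k \<odot>\<^bsub>A\<^esub> x] = k \<odot>\<^bsub>N\<^esub> g [x]"
  shows "multilinear K A 0 N g"
  unfolding multilinear_def using assms by (auto simp: length_Suc_conv)

lemma multilinear1I:
  assumes "\<And>a b. \<lbrakk>a \<in> carrier A; b \<in> carrier A\<rbrakk> \<Longrightarrow> g [a, b] \<in> carrier N"
    and "\<And>x y b. \<lbrakk>x \<in> carrier A; y \<in> carrier A; b \<in> carrier A\<rbrakk> \<Longrightarrow> g [x \<oplus>\<^bsub>A\<^esub> y, b] = g [x, b] \<oplus>\<^bsub>N\<^esub> g [y, b]"
    and "\<And>x y b. \<lbrakk>x \<in> carrier A; y \<in> carrier A; b \<in> carrier A\<rbrakk> \<Longrightarrow> g [b, x \<oplus>\<^bsub>A\<^esub> y] = g [b, x] \<oplus>\<^bsub>N\<^esub> g [b, y]"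
    and "\<And>k x b. \<lbrakk>k \<in> carrier K; x \<in> carrier A; b \<in> carrier A\<rbrakk> \<Longrightarrow> g [k \<odot>\<^bsub>A\<^esub> x, b] = k \<odot>\<^bsub>N\<^esub> g [x, b]"
    and "\<And>k x b. \<lbrakk>k \<in> carrier K; x \<in> carrier A; b \<in> carrier A\<rbrakk> \<Longrightarrow> g [b, k \<odot>\<^bsub>A\<^esub> x] = k \<odot>\<^bsub>N\<^esub> g [b, x]"
  shows "multilinear K A (Suc 0) N g"
proof -
  have split: "(us = [] \<and> (\<exists>b. vs = [b])) \<or> (\<exists>b. us = [b] \<and> vs = [])"
    if "length us + length vs = Suc 0" for us vs :: "'a list"
    using that by (cases us; cases vs) auto
  show ?thesis
    unfolding multilinear_def using assms
    by (auto simp: length_Suc_conv dest!: split)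
qed

lemma multilinear2I:
  assumes "\<And>a b c. \<lbrakk>a \<in> carrier A; b \<in> carrier A; c \<in> carrier A\<rbrakk> \<Longrightarrow> g [a, b, c] \<in> carrier N"
    and "\<And>x y b c. \<lbrakk>x \<in> carrier A; y \<in> carrier A; b \<in> carrier A; c \<in> carrier A\<rbrakk> \<Longrightarrow>
      g [x \<oplus>\<^bsub>A\<^esub> y, b, c] = g [x, b, c] \<oplus>\<^bsub>N\<^esub> g [y, b, c]"
    and "\<And>x y b c. \<lbrakk>x \<in> carrier A; y \<in> carrier A; b \<in> carrier A; c \<in> carrier A\<rbrakk> \<Longrightarrow>
      g [b, x \<oplus>\<^bsub>A\<^esub> y, c] = g [b, x, c] \<oplus>\<^bsub>N\<^esub> g [b, y, c]"
    and "\<And>x y b c. \<lbrakk>x \<in> carrier A; y \<in> carrier A; b \<in> carrier A; c \<in> carrier A\<rbrakk> \<Longrightarrow>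
      g [b, c, x \<oplus>\<^bsub>A\<^esub> y] = g [b, c, x] \<oplus>\<^bsub>N\<^esub> g [b, c, y]"
    and "\<And>k x b c. \<lbrakk>k \<in> carrier K; x \<in> carrier A; b \<in> carrier A; c \<in> carrier A\<rbrakk> \<Longrightarrow>
      g [k \<odot>\<^bsub>A\<^esub> x, b, c] = k \<odot>\<^bsub>N\<^esub> g [x, b, c]"
    and "\<And>k x b c. \<lbrakk>k \<in> carrier K; x \<in> carrier A; b \<in> carrier A; c \<in> carrier A\<rbrakk> \<Longrightarrow>
      g [b, k \<odot>\<^bsub>A\<^esub> x, c] = k \<odot>\<^bsub>N\<^esub> g [b, x, c]"
    and "\<And>k x b c. \<lbrakk>k \<in> carrier K; x \<in> carrier A; b \<in> carrier A; c \<in> carrier A\<rbrakk> \<Longrightarrow>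
      g [b, c, k \<odot>\<^bsub>A\<^esub> x] = k \<odot>\<^bsub>N\<^esub> g [b, c, x]"
  shows "multilinear K A (Suc (Suc 0)) N g"
proof -
  have split: "(us = [] \<and> (\<exists>b c. vs = [b, c])) \<or> (\<exists>b c. us = [b] \<and> vs = [c]) \<or> (\<exists>b c. us = [b, c] \<and> vs = [])"
    if "length us + length vs = Suc (Suc 0)" for us vs :: "'a list"
    using that by (cases us; cases "tl us"; cases vs; cases "tl vs") auto
  show ?thesis
    unfolding multilinear_def using assms
    by (auto simp: length_Suc_conv dest!: split)
qed

text \<open>The only properties of \<^const>\<open>tensor_map\<close> that are used from here on.\<close>

lemma tensor_map_tensor:
  assumes "\<And>as. as \<in> tuples A n \<Longrightarrow> g as \<in> carrier (free_chains K A m)"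
    and "multilinear K A n (C m) (\<lambda>as. tensor_rels K A m +>\<^bsub>free_chains K A m\<^esub> g as)"
  shows "linear_map K (C n) (C m) (tensor_map K A m g)"
    and "as \<in> tuples A n \<Longrightarrow> tensor_map K A m g (tensor K A n as) = tensor_rels K A m +>\<^bsub>free_chains K A m\<^esub> g as"
proof -
  show "linear_map K (C n) (C m) (tensor_map K A m g)"
    by (rule linear_map_cong[OF tensor_lift_linear[OF chains_module assms(2)]
          tensor_map_eq_lift[OF assms] chains_module])
  show "as \<in> tuples A n \<Longrightarrow> tensor_map K A m g (tensor K A n as) = tensor_rels K A m +>\<^bsub>free_chains K A m\<^esub> g as"
    using tensor_map_eq_lift[OF assms tensor_closed[of as n]] tensor_lift_tensor[OF chains_module assms(2)]
    by simp
qed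

lemma proj_gen: "tensor_rels K A n +>\<^bsub>free_chains K A n\<^esub> free_gen K as = tensor K A n as"
  by (simp add: tensor_def)

lemmas proj_simps = proj_gen linear_map_add[OF chain_proj_linear] linear_map_smult[OF chain_proj_linear]

lemma gen_closed':
  "a \<in> carrier A \<Longrightarrow> free_gen K [a] \<in> carrier (free_chains K A 0)"
  "\<lbrakk>a \<in> carrier A; b \<in> carrier A\<rbrakk> \<Longrightarrow> free_gen K [a, b] \<in> carrier (free_chains K A (Suc 0))"
  by (auto intro!: gen_closed)

definition d1 :: "('a list \<Rightarrow> 'k) set \<Rightarrow> ('a list \<Rightarrow> 'k) set" where
  "d1 = hoch_boundary K A (Suc 0)"
definition d2 :: "('a list \<Rightarrow> 'k) set \<Rightarrow> ('a list \<Rightarrow> 'k) set" where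
  "d2 = hoch_boundary K A (Suc (Suc 0))"

text \<open>The definition of the boundary is a signed sum over faces; it is unfolded here and in the next lemma
  only.\<close>

lemma d1:
  shows d1_linear: "linear_map K (C (Suc 0)) (C 0) d1"
    and d1_T1: "\<lbrakk>a \<in> carrier A; b \<in> carrier A\<rbrakk> \<Longrightarrow>
      d1 (T1 a b) = T0 (a \<otimes>\<^bsub>A\<^esub> b) \<ominus>\<^bsub>C 0\<^esub> T0 (b \<otimes>\<^bsub>A\<^esub> a)"
proof -
  interpret F: module K "free_chains K A 0" by (rule free_chains_module)
  let ?g = "\<lambda>as. \<Oplus>\<^bsub>free_chains K A 0\<^esub>i\<in>{..Suc 0}.
        ((\<ominus>\<^bsub>K\<^esub> \<one>\<^bsub>K\<^esub>) [^]\<^bsub>K\<^esub> i) \<odot>\<^bsub>free_chains K A 0\<^esub> free_gen K (hoch_face A (Suc 0) i as)"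
  have dd: "d1 = tensor_map K A 0 ?g" by (simp add: d1_def hoch_boundary_def)
  have g: "?g [a, b] = \<ominus>\<^bsub>K\<^esub> \<one>\<^bsub>K\<^esub> \<odot>\<^bsub>free_chains K A 0\<^esub> free_gen K [b \<otimes>\<^bsub>A\<^esub> a] \<oplus>\<^bsub>free_chains K A 0\<^esub> free_gen K [a \<otimes>\<^bsub>A\<^esub> b]"
    if "a \<in> carrier A" "b \<in> carrier A" for a b
    using that by (simp add: hoch_face_def gen_closed' Pi_def atMost_Suc)
  have gc: "?g as \<in> carrier (free_chains K A 0)" if "as \<in> tuples A (Suc 0)" for as
    using that unfolding tuples_cases by (auto simp: g gen_closed' simp del: F.finsum_Suc)
  have pg: "tensor_rels K A 0 +>\<^bsub>free_chains K A 0\<^esub> ?g [a, b] = T0 (a \<otimes>\<^bsub>A\<^esub> b) \<ominus>\<^bsub>C 0\<^esub> T0 (b \<otimes>\<^bsub>A\<^esub> a)"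
    if "a \<in> carrier A" "b \<in> carrier A" for a b
    unfolding g[OF that] using that
    by (simp add: proj_simps gen_closed' C.smult_l_minus C.a_comm a_minus_def)
  have ml: "multilinear K A (Suc 0) (C 0) (\<lambda>as. tensor_rels K A 0 +>\<^bsub>free_chains K A 0\<^esub> ?g as)"
    by (rule multilinear1I)
      (simp_all only: pg M.a_closed smult_closed,
       auto simp: A.l_distr A.r_distr smult_mult_left[symmetric] smult_mult_right[symmetric] T0_linear C.diff_simps C.a_ac
         C.smult_r_distr C.smult_diff)
  show "linear_map K (C (Suc 0)) (C 0) d1"
    unfolding dd by (rule tensor_map_tensor[OF gc ml])
  show "\<lbrakk>a \<in> carrier A; b \<in> carrier A\<rbrakk> \<Longrightarrow>
      d1 (T1 a b) = T0 (a \<otimes>\<^bsub>A\<^esub> b) \<ominus>\<^bsub>C 0\<^esub> T0 (b \<otimes>\<^bsub>A\<^esub> a)"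
    unfolding dd using tensor_map_tensor(2)[OF gc ml] by (simp add: pg)
qed

lemma d2:
  shows d2_linear: "linear_map K (C (Suc (Suc 0))) (C (Suc 0)) d2"
    and d2_T2: "\<lbrakk>a \<in> carrier A; b \<in> carrier A; c \<in> carrier A\<rbrakk> \<Longrightarrow>
      d2 (T2 a b c) = (T1 (a \<otimes>\<^bsub>A\<^esub> b) c \<ominus>\<^bsub>C (Suc 0)\<^esub> T1 a (b \<otimes>\<^bsub>A\<^esub> c))
        \<oplus>\<^bsub>C (Suc 0)\<^esub> T1 (c \<otimes>\<^bsub>A\<^esub> a) b"
proof -
  let ?F = "free_chains K A (Suc 0)" and ?C = "C (Suc 0)"
  interpret F: module K ?F by (rule free_chains_module)
  let ?g = "\<lambda>as. \<Oplus>\<^bsub>?F\<^esub>i\<in>{..Suc (Suc 0)}.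
        ((\<ominus>\<^bsub>K\<^esub> \<one>\<^bsub>K\<^esub>) [^]\<^bsub>K\<^esub> i) \<odot>\<^bsub>?F\<^esub> free_gen K (hoch_face A (Suc (Suc 0)) i as)"
  have dd: "d2 = tensor_map K A (Suc 0) ?g" by (simp add: d2_def hoch_boundary_def)
  have sq: "\<ominus>\<^bsub>K\<^esub> \<one>\<^bsub>K\<^esub> \<otimes>\<^bsub>K\<^esub> \<ominus>\<^bsub>K\<^esub> \<one>\<^bsub>K\<^esub> = \<one>\<^bsub>K\<^esub>"
    by (simp add: R.l_minus)
  have g: "?g [a, b, c] = free_gen K [c \<otimes>\<^bsub>A\<^esub> a, b] \<oplus>\<^bsub>?F\<^esub>
      (\<ominus>\<^bsub>K\<^esub> \<one>\<^bsub>K\<^esub> \<odot>\<^bsub>?F\<^esub> free_gen K [a, b \<otimes>\<^bsub>A\<^esub> c] \<oplus>\<^bsub>?F\<^esub> free_gen K [a \<otimes>\<^bsub>A\<^esub> b, c])"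
    if "a \<in> carrier A" "b \<in> carrier A" "c \<in> carrier A" for a b c
    using that by (simp add: hoch_face_def gen_closed' Pi_def atMost_Suc sq)
  have gc: "?g as \<in> carrier ?F" if "as \<in> tuples A (Suc (Suc 0))" for as
    using that unfolding tuples_cases by (auto simp: g gen_closed' simp del: F.finsum_Suc)
  have pg: "tensor_rels K A (Suc 0) +>\<^bsub>?F\<^esub> ?g [a, b, c] =
      (T1 (a \<otimes>\<^bsub>A\<^esub> b) c \<ominus>\<^bsub>?C\<^esub> T1 a (b \<otimes>\<^bsub>A\<^esub> c)) \<oplus>\<^bsub>?C\<^esub> T1 (c \<otimes>\<^bsub>A\<^esub> a) b"
    if "a \<in> carrier A" "b \<in> carrier A" "c \<in> carrier A" for a b c
    unfolding g[OF that] using that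
    by (simp add: proj_simps gen_closed' C.smult_l_minus C.a_ac a_minus_def)
  have ml: "multilinear K A (Suc (Suc 0)) ?C (\<lambda>as. tensor_rels K A (Suc 0) +>\<^bsub>?F\<^esub> ?g as)"
    by (rule multilinear2I)
      (simp_all only: pg M.a_closed smult_closed,
       auto simp: A.l_distr A.r_distr smult_mult_left[symmetric] smult_mult_right[symmetric] T1_linear
         C.diff_simps C.a_ac C.smult_r_distr C.smult_diff)
  show "linear_map K (C (Suc (Suc 0))) ?C d2"
    unfolding dd by (rule tensor_map_tensor[OF gc ml])
  show "\<lbrakk>a \<in> carrier A; b \<in> carrier A; c \<in> carrier A\<rbrakk> \<Longrightarrow> d2 (T2 a b c) =
      (T1 (a \<otimes>\<^bsub>A\<^esub> b) c \<ominus>\<^bsub>?C\<^esub> T1 a (b \<otimes>\<^bsub>A\<^esub> c)) \<oplus>\<^bsub>?C\<^esub> T1 (c \<otimes>\<^bsub>A\<^esub> a) b"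
    unfolding dd using tensor_map_tensor(2)[OF gc ml] by (simp add: pg)
qed

lemma d_closed [simp, intro]:
  "z \<in> carrier (C (Suc 0)) \<Longrightarrow> d1 z \<in> carrier (C 0)"
  "z \<in> carrier (C (Suc (Suc 0))) \<Longrightarrow> d2 z \<in> carrier (C (Suc 0))"
  using linear_map_closed[OF d1_linear] linear_map_closed[OF d2_linear] by auto

lemma d1_simps:
  assumes "x \<in> carrier (C (Suc 0))" "y \<in> carrier (C (Suc 0))"
  shows "d1 (x \<oplus>\<^bsub>C (Suc 0)\<^esub> y) = d1 x \<oplus>\<^bsub>C 0\<^esub> d1 y"
    and "d1 (x \<ominus>\<^bsub>C (Suc 0)\<^esub> y) = d1 x \<ominus>\<^bsub>C 0\<^esub> d1 y"
  using linear_map_add[OF d1_linear assms] linear_map_diff[OF chains_module chains_module d1_linear assms]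
  by auto

lemma d2_simps:
  assumes "x \<in> carrier (C (Suc (Suc 0)))" "y \<in> carrier (C (Suc (Suc 0)))"
  shows "d2 (x \<oplus>\<^bsub>C (Suc (Suc 0))\<^esub> y) = d2 x \<oplus>\<^bsub>C (Suc 0)\<^esub> d2 y"
    and "d2 (x \<ominus>\<^bsub>C (Suc (Suc 0))\<^esub> y) = d2 x \<ominus>\<^bsub>C (Suc 0)\<^esub> d2 y"
  using linear_map_add[OF d2_linear assms] linear_map_diff[OF chains_module chains_module d2_linear assms]
  by auto

lemma chain0_in_submodule:
  assumes "module K N" "submodule H K N" "linear_map K (C 0) N f"
    and "\<And>a. a \<in> carrier A \<Longrightarrow> f (T0 a) \<in> H" and "z \<in> carrier (C 0)"
  shows "f z \<in> H"
  by (rule chain_in_submodule[OF assms(1-3) _ assms(5)]) (use assms(4) in \<open>auto simp only: tuples_cases\<close>)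

lemma chain1_in_submodule:
  assumes "module K N" "submodule H K N" "linear_map K (C (Suc 0)) N f"
    and "\<And>a b. \<lbrakk>a \<in> carrier A; b \<in> carrier A\<rbrakk> \<Longrightarrow> f (T1 a b) \<in> H"
    and "z \<in> carrier (C (Suc 0))"
  shows "f z \<in> H"
  by (rule chain_in_submodule[OF assms(1-3) _ assms(5)]) (use assms(4) in \<open>auto simp only: tuples_cases\<close>)

lemma chain2_in_submodule:
  assumes "module K N" "submodule H K N" "linear_map K (C (Suc (Suc 0))) N f"
    and "\<And>a b c. \<lbrakk>a \<in> carrier A; b \<in> carrier A; c \<in> carrier A\<rbrakk> \<Longrightarrow> f (T2 a b c) \<in> H"
    and "z \<in> carrier (C (Suc (Suc 0)))"
  shows "f z \<in> H"
  by (rule chain_in_submodule[OF assms(1-3) _ assms(5)]) (use assms(4) in \<open>auto simp only: tuples_cases\<close>)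

lemma chain0_map_eqI:
  assumes "module K N" "linear_map K (C 0) N f" "linear_map K (C 0) N g"
    and "\<And>a. a \<in> carrier A \<Longrightarrow> f (T0 a) = g (T0 a)" and "z \<in> carrier (C 0)"
  shows "f z = g z"
  by (rule chain_map_eqI[OF assms(1-3) _ assms(5)]) (use assms(4) in \<open>auto simp only: tuples_cases\<close>)

lemma chain1_map_eqI:
  assumes "module K N" "linear_map K (C (Suc 0)) N f"
    "linear_map K (C (Suc 0)) N g"
    and "\<And>a b. \<lbrakk>a \<in> carrier A; b \<in> carrier A\<rbrakk> \<Longrightarrow> f (T1 a b) = g (T1 a b)"
    and "z \<in> carrier (C (Suc 0))"
  shows "f z = g z"
  by (rule chain_map_eqI[OF assms(1-3) _ assms(5)]) (use assms(4) in \<open>auto simp only: tuples_cases\<close>)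

lemma d1_d2:
  assumes "w \<in> carrier (C (Suc (Suc 0)))"
  shows "d1 (d2 w) = \<zero>\<^bsub>C 0\<^esub>"
proof -
  have "d1 (d2 w) \<in> {\<zero>\<^bsub>C 0\<^esub>}"
    by (rule chain2_in_submodule[OF chains_module submodule_zero[OF chains_module]
          linear_map_comp[OF d1_linear d2_linear] _ assms])
      (simp add: d2_T2 d1_simps d1_T1 A.m_assoc C.diff_simps C.a_ac)
  then show ?thesis by simp
qed

end

section \<open>Homology in degrees zero and one\<close>

context hochschild
begin

definition B0 :: "('a list \<Rightarrow> 'k) set set" where "B0 = d1 ` carrier (C (Suc 0))"
definition B1 :: "('a list \<Rightarrow> 'k) set set" where "B1 = d2 ` carrier (C (Suc (Suc 0)))"
definition Z1 :: "('a list \<Rightarrow> 'k) set set" where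
  "Z1 = {z \<in> carrier (C (Suc 0)). d1 z = \<zero>\<^bsub>C 0\<^esub>}"

lemma B0_submodule: "submodule B0 K (C 0)"
  unfolding B0_def by (rule submodule_image[OF chains_module chains_module d1_linear])

lemma B1_submodule: "submodule B1 K (C (Suc 0))"
  unfolding B1_def by (rule submodule_image[OF chains_module chains_module d2_linear])

lemma Z1_submodule: "submodule Z1 K (C (Suc 0))"
  using submodule_preimage[OF chains_module chains_module d1_linear submodule_zero[OF chains_module]]
  by (simp add: Z1_def)

lemma B1_subset_Z1: "B1 \<subseteq> Z1"
  by (auto simp: B1_def Z1_def d1_d2)

lemma Z1_subset: "Z1 \<subseteq> carrier (C (Suc 0))"
  by (auto simp: Z1_def)

abbreviation Z1_module where "Z1_module \<equiv> (C (Suc 0))\<lparr>carrier := Z1\<rparr>"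

lemma Z1_module: "module K Z1_module"
  by (rule submodule.submodule_is_module[OF Z1_submodule chains_module])

lemma B1_submodule_Z1: "submodule B1 K Z1_module"
  by (rule submodule_restrict[OF chains_module B1_submodule Z1_submodule B1_subset_Z1])

lemma H0_eq: "hoch_homology K A 0 = quot_module (C 0) B0"
proof -
  have "hoch_cycles K A 0 = carrier (C 0)" by (simp add: hoch_cycles_def)
  moreover have "hoch_boundaries K A 0 = B0" by (simp add: hoch_boundaries_def B0_def d1_def)
  ultimately show ?thesis by (simp add: hoch_homology_def)
qed

lemma boundaries_eq: "hoch_boundaries K A 0 = B0" "hoch_boundaries K A (Suc 0) = B1"
  by (simp_all add: hoch_boundaries_def B0_def B1_def d1_def d2_def)

lemma H1_eq: "hoch_homology K A (Suc 0) = quot_module Z1_module B1"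
proof -
  have "hoch_cycles K A (Suc 0) = Z1" by (simp add: hoch_cycles_def Z1_def d1_def)
  then show ?thesis by (simp add: hoch_homology_def boundaries_eq)
qed

text \<open>Classes in \<open>H\<^sub>0\<close> and \<open>H\<^sub>1\<close>. A coset of \<open>B1\<close> is the same set whether it is formed in the module of
  chains or in that of cycles, so the interpretations \<open>H1\<close> and \<open>HZ\<close> below speak about the same
  classes: the former for maps defined on all chains, the latter for the module structure of \<open>H\<^sub>1\<close>.\<close>

abbreviation cl0 where "cl0 z \<equiv> B0 +>\<^bsub>C 0\<^esub> z"
abbreviation cl1 where "cl1 z \<equiv> B1 +>\<^bsub>C (Suc 0)\<^esub> z"

sublocale H0: module_quotient K "C 0" B0
  by (rule module_quotientI[OF chains_module B0_submodule])
sublocale H1: module_quotient K "C (Suc 0)" B1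
  by (rule module_quotientI[OF chains_module B1_submodule])
sublocale HZ: module_quotient K Z1_module B1
  by (rule module_quotientI[OF Z1_module B1_submodule_Z1])

lemma cl1_restrict: "B1 +>\<^bsub>Z1_module\<^esub> z = cl1 z"
  by (simp add: a_r_coset_def')

lemma d1_in_B0: "z \<in> carrier (C (Suc 0)) \<Longrightarrow> d1 z \<in> B0"
  by (auto simp: B0_def)
lemma d2_in_B1: "z \<in> carrier (C (Suc (Suc 0))) \<Longrightarrow> d2 z \<in> B1"
  by (auto simp: B1_def)

end

section \<open>Outer derivations\<close>

context hochschild
begin

abbreviation inner :: "'a \<Rightarrow> 'a \<Rightarrow> 'a" where
  "inner a \<equiv> \<lambda>x\<in>carrier A. a \<otimes>\<^bsub>A\<^esub> x \<ominus>\<^bsub>A\<^esub> x \<otimes>\<^bsub>A\<^esub> a"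

abbreviation Der :: "('k, 'a \<Rightarrow> 'a) module" where "Der \<equiv> der_module K A"

lemma inner_derivations_eq: "inner_derivations A = inner ` carrier A"
  by (auto simp: inner_derivations_def)

lemma derivation:
  assumes "D \<in> derivations K A"
  shows derivation_closed: "\<And>x. x \<in> carrier A \<Longrightarrow> D x \<in> carrier A"
    and derivation_add: "\<And>x y. \<lbrakk>x \<in> carrier A; y \<in> carrier A\<rbrakk> \<Longrightarrow> D (x \<oplus>\<^bsub>A\<^esub> y) = D x \<oplus>\<^bsub>A\<^esub> D y"
    and derivation_smult: "\<And>c x. \<lbrakk>c \<in> carrier K; x \<in> carrier A\<rbrakk> \<Longrightarrow> D (c \<odot>\<^bsub>A\<^esub> x) = c \<odot>\<^bsub>A\<^esub> D x"
    and derivation_mult: "\<And>x y. \<lbrakk>x \<in> carrier A; y \<in> carrier A\<rbrakk> \<Longrightarrow>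
      D (x \<otimes>\<^bsub>A\<^esub> y) = D x \<otimes>\<^bsub>A\<^esub> y \<oplus>\<^bsub>A\<^esub> x \<otimes>\<^bsub>A\<^esub> D y"
    and derivation_ext: "D \<in> extensional (carrier A)"
  using assms unfolding derivations_def by (auto simp: PiE_def)

lemma derivationI:
  assumes "D \<in> extensional (carrier A)" "\<And>x. x \<in> carrier A \<Longrightarrow> D x \<in> carrier A"
    and "\<And>x y. \<lbrakk>x \<in> carrier A; y \<in> carrier A\<rbrakk> \<Longrightarrow> D (x \<oplus>\<^bsub>A\<^esub> y) = D x \<oplus>\<^bsub>A\<^esub> D y"
    and "\<And>c x. \<lbrakk>c \<in> carrier K; x \<in> carrier A\<rbrakk> \<Longrightarrow> D (c \<odot>\<^bsub>A\<^esub> x) = c \<odot>\<^bsub>A\<^esub> D x"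
    and "\<And>x y. \<lbrakk>x \<in> carrier A; y \<in> carrier A\<rbrakk> \<Longrightarrow> D (x \<otimes>\<^bsub>A\<^esub> y) = D x \<otimes>\<^bsub>A\<^esub> y \<oplus>\<^bsub>A\<^esub> x \<otimes>\<^bsub>A\<^esub> D y"
  shows "D \<in> derivations K A"
  using assms unfolding derivations_def by (auto simp: PiE_def)

lemma derivation_linear: "D \<in> derivations K A \<Longrightarrow> linear_map K A A D"
  by (rule linear_mapI) (auto simp: derivation)

lemma derivation_diff:
  assumes "D \<in> derivations K A" "x \<in> carrier A" "y \<in> carrier A"
  shows "D (x \<ominus>\<^bsub>A\<^esub> y) = D x \<ominus>\<^bsub>A\<^esub> D y"
  by (rule linear_map_diff[OF module_axioms module_axioms derivation_linear[OF assms(1)] assms(2,3)])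

lemma Der_simps:
  "carrier Der = derivations K A"
  "D \<oplus>\<^bsub>Der\<^esub> D' = (\<lambda>x\<in>carrier A. D x \<oplus>\<^bsub>A\<^esub> D' x)"
  "k \<odot>\<^bsub>Der\<^esub> D = (\<lambda>x\<in>carrier A. k \<odot>\<^bsub>A\<^esub> D x)"
  "\<zero>\<^bsub>Der\<^esub> = (\<lambda>_\<in>carrier A. \<zero>\<^bsub>A\<^esub>)"
  by (simp_all add: der_module_def)

lemma Der_module: "module K Der"
proof (rule moduleI)
  show "abelian_group Der"
  proof (rule abelian_groupI, goal_cases)
    case (1 D D')
    then show ?case
      by (auto simp: Der_simps derivation A.l_distr A.r_distr M.a_ac smult_r_distr intro!: derivationI)
  next
    case 2
    then show ?case by (auto simp: Der_simps intro!: derivationI)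
  next
    case (3 D D' D'')
    then show ?case by (auto simp: Der_simps derivation M.a_ac)
  next
    case (4 D D')
    then show ?case by (auto simp: Der_simps derivation M.a_ac)
  next
    case (5 D)
    then show ?case by (auto simp: Der_simps derivation intro!: restrict_eqI[symmetric])
  next
    case (6 D)
    have "(\<lambda>x\<in>carrier A. \<ominus>\<^bsub>A\<^esub> D x) \<in> derivations K A"
      using 6 by (auto simp: Der_simps derivation M.minus_add A.l_minus A.r_minus smult_r_minus intro!: derivationI)
    then show ?case
      using 6 by (intro bexI[of _ "\<lambda>x\<in>carrier A. \<ominus>\<^bsub>A\<^esub> D x"]) (auto simp: Der_simps derivation M.l_neg)
  qed
next
  fix c D assume "c \<in> carrier K" "D \<in> carrier Der"
  then show "c \<odot>\<^bsub>Der\<^esub> D \<in> carrier Der"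
    by (auto simp: Der_simps derivation smult_r_distr smult_mult_left[symmetric] smult_mult_right[symmetric]
        smult_assoc1[symmetric] R.m_comm intro!: derivationI)
qed (auto simp: Der_simps derivation smult_l_distr smult_r_distr smult_assoc1 R.is_cring
      intro!: restrict_eqI[symmetric])

sublocale Der: module K Der
  by (rule Der_module)

lemma inner_derivation: "a \<in> carrier A \<Longrightarrow> inner a \<in> derivations K A"
  by (rule derivationI)
    (auto simp: A.l_distr A.r_distr A.diff_l_distr A.diff_r_distr A.m_assoc M.diff_simps M.a_ac smult_diff
      smult_mult_left[symmetric] smult_mult_right[symmetric])

lemma inner_linear: "linear_map K A Der inner"
proof (rule linear_mapI)
  show "\<And>x. x \<in> carrier A \<Longrightarrow> inner x \<in> carrier Der" by (simp add: Der_simps inner_derivation)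
qed (auto simp: Der_simps A.l_distr A.r_distr M.diff_simps M.a_ac smult_diff
      smult_mult_left[symmetric] smult_mult_right[symmetric] intro!: restrict_ext)

lemma inner_submodule: "submodule (inner_derivations A) K Der"
  unfolding inner_derivations_eq by (rule submodule_image[OF Der_module module_axioms inner_linear])

sublocale Out: module_quotient K Der "inner_derivations A"
  by (rule module_quotientI[OF Der_module inner_submodule])

lemma der_coset_mem:
  assumes D: "D \<in> derivations K A" and D': "D' \<in> inner_derivations A +>\<^bsub>Der\<^esub> D"
  obtains x where "x \<in> carrier A" "D' = inner x \<oplus>\<^bsub>Der\<^esub> D" "D' \<in> derivations K A"
    "\<And>y. y \<in> carrier A \<Longrightarrow> D' y = (x \<otimes>\<^bsub>A\<^esub> y \<ominus>\<^bsub>A\<^esub> y \<otimes>\<^bsub>A\<^esub> x) \<oplus>\<^bsub>A\<^esub> D y"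
proof -
  obtain x where x: "x \<in> carrier A" "D' = inner x \<oplus>\<^bsub>Der\<^esub> D"
    using D' by (auto simp: a_r_coset_def' inner_derivations_eq)
  have "D' \<in> carrier Der"
    using Out.coset_subset[of D] D D' by (auto simp: Der_simps)
  with x show thesis by (intro that) (auto simp: Der_simps)
qed

lemma commutator_derivation:
  assumes "D \<in> derivations K A" "D' \<in> derivations K A"
  shows "der_commutator A D D' \<in> derivations K A"
  unfolding der_commutator_def
  by (rule derivationI)
    (use assms in \<open>auto simp: derivation smult_diff A.diff_l_distr A.diff_r_distr M.diff_simps M.a_ac\<close>)

text \<open>Inner derivations form an ideal: \<open>[ad x + D, ad x' + D']\<close> differs from \<open>[D, D']\<close> by \<open>ad u\<close> with
  \<open>u = [x, x'] + D x' - D' x\<close>.\<close>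

lemma outer_bracket_coset:
  assumes D: "D \<in> derivations K A" and D': "D' \<in> derivations K A"
  shows "outer_bracket K A (inner_derivations A +>\<^bsub>Der\<^esub> D) (inner_derivations A +>\<^bsub>Der\<^esub> D') =
    inner_derivations A +>\<^bsub>Der\<^esub> der_commutator A D D'"
proof -
  have "inner_derivations A +>\<^bsub>Der\<^esub> der_commutator A E E' = inner_derivations A +>\<^bsub>Der\<^esub> der_commutator A D D'"
    if E: "E \<in> inner_derivations A +>\<^bsub>Der\<^esub> D" and E': "E' \<in> inner_derivations A +>\<^bsub>Der\<^esub> D'" for E E'
  proof -
    obtain x where x: "x \<in> carrier A" "E \<in> derivations K A"
      "\<And>y. y \<in> carrier A \<Longrightarrow> E y = (x \<otimes>\<^bsub>A\<^esub> y \<ominus>\<^bsub>A\<^esub> y \<otimes>\<^bsub>A\<^esub> x) \<oplus>\<^bsub>A\<^esub> D y"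
      using der_coset_mem[OF D E] by metis
    obtain x' where x': "x' \<in> carrier A" "E' \<in> derivations K A"
      "\<And>y. y \<in> carrier A \<Longrightarrow> E' y = (x' \<otimes>\<^bsub>A\<^esub> y \<ominus>\<^bsub>A\<^esub> y \<otimes>\<^bsub>A\<^esub> x') \<oplus>\<^bsub>A\<^esub> D' y"
      using der_coset_mem[OF D' E'] by metis
    define u where "u = ((x \<otimes>\<^bsub>A\<^esub> x' \<ominus>\<^bsub>A\<^esub> x' \<otimes>\<^bsub>A\<^esub> x) \<oplus>\<^bsub>A\<^esub> D x') \<ominus>\<^bsub>A\<^esub> D' x"
    have u: "u \<in> carrier A" using x x' D D' by (simp add: u_def derivation)
    have "der_commutator A E E' = inner u \<oplus>\<^bsub>Der\<^esub> der_commutator A D D'"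
      unfolding der_commutator_def Der_simps
    proof (rule restrict_ext)
      fix y assume y: "y \<in> carrier A"
      note c = x(1) x'(1) y derivation_closed[OF D] derivation_closed[OF D']
      show "E (E' y) \<ominus>\<^bsub>A\<^esub> E' (E y) = inner u y \<oplus>\<^bsub>A\<^esub> (\<lambda>z\<in>carrier A. D (D' z) \<ominus>\<^bsub>A\<^esub> D' (D z)) y"
        using c by (simp add: x(3) x'(3) u_def derivation_add[OF D] derivation_add[OF D']
          derivation_diff[OF D] derivation_diff[OF D'] derivation_mult[OF D] derivation_mult[OF D']
          A.l_distr A.r_distr A.diff_l_distr A.diff_r_distr A.m_assoc M.diff_simps M.a_ac)
    qed
    then have "der_commutator A E E' \<in> inner_derivations A +>\<^bsub>Der\<^esub> der_commutator A D D'"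
      using u by (auto simp: a_r_coset_def' inner_derivations_eq)
    then show ?thesis
      using Out.N.a_repr_independence' commutator_derivation[OF D D'] by (simp add: Der_simps)
  qed
  moreover have "D \<in> inner_derivations A +>\<^bsub>Der\<^esub> D" "D' \<in> inner_derivations A +>\<^bsub>Der\<^esub> D'"
    using Out.N.a_rcos_self D D' by (auto simp: Der_simps)
  ultimately show ?thesis unfolding outer_bracket_def by blast
qed

end

section \<open>Lie derivative, interior product and Connes map on chains\<close>

context hochschild
begin

definition lie_chain :: "('a \<Rightarrow> 'a) \<Rightarrow> ('a list \<Rightarrow> 'k) set \<Rightarrow> ('a list \<Rightarrow> 'k) set" where
  "lie_chain D = tensor_map K A (Suc 0)
      (\<lambda>as. free_gen K [D (as ! 0), as ! Suc 0] \<oplus>\<^bsub>free_chains K A (Suc 0)\<^esub> free_gen K [as ! 0, D (as ! Suc 0)])"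

definition interior_chain :: "('a \<Rightarrow> 'a) \<Rightarrow> ('a list \<Rightarrow> 'k) set \<Rightarrow> ('a list \<Rightarrow> 'k) set" where
  "interior_chain D = tensor_map K A 0 (\<lambda>as. free_gen K [D (as ! Suc 0) \<otimes>\<^bsub>A\<^esub> as ! 0])"

definition connes_chain :: "('a list \<Rightarrow> 'k) set \<Rightarrow> ('a list \<Rightarrow> 'k) set" where
  "connes_chain = tensor_map K A (Suc 0)
      (\<lambda>as. free_gen K [\<one>\<^bsub>A\<^esub>, as ! 0] \<oplus>\<^bsub>free_chains K A (Suc 0)\<^esub> free_gen K [as ! 0, \<one>\<^bsub>A\<^esub>])"

lemma lie_chain:
  assumes D: "D \<in> derivations K A"
  shows lie_chain_linear: "linear_map K (C (Suc 0)) (C (Suc 0)) (lie_chain D)"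
    and lie_chain_T1: "\<lbrakk>a \<in> carrier A; b \<in> carrier A\<rbrakk> \<Longrightarrow>
      lie_chain D (T1 a b) = T1 (D a) b \<oplus>\<^bsub>C (Suc 0)\<^esub> T1 a (D b)"
proof -
  interpret F: module K "free_chains K A (Suc 0)" by (rule free_chains_module)
  let ?g = "\<lambda>as. free_gen K [D (as ! 0), as ! Suc 0] \<oplus>\<^bsub>free_chains K A (Suc 0)\<^esub> free_gen K [as ! 0, D (as ! Suc 0)]"
  have gc: "?g as \<in> carrier (free_chains K A (Suc 0))" if "as \<in> tuples A (Suc 0)" for as
    using that unfolding tuples_cases by (auto simp: gen_closed' derivation[OF D])
  have ml: "multilinear K A (Suc 0) (C (Suc 0))
      (\<lambda>as. tensor_rels K A (Suc 0) +>\<^bsub>free_chains K A (Suc 0)\<^esub> ?g as)"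
    by (rule multilinear1I)
      (auto simp: proj_simps gen_closed' derivation[OF D] T1_linear C.a_ac C.smult_r_distr)
  show "linear_map K (C (Suc 0)) (C (Suc 0)) (lie_chain D)"
    unfolding lie_chain_def by (rule tensor_map_tensor[OF gc ml])
  show "\<lbrakk>a \<in> carrier A; b \<in> carrier A\<rbrakk> \<Longrightarrow>
      lie_chain D (T1 a b) = T1 (D a) b \<oplus>\<^bsub>C (Suc 0)\<^esub> T1 a (D b)"
    unfolding lie_chain_def using tensor_map_tensor(2)[OF gc ml, of "[a, b]"]
    by (simp add: proj_simps gen_closed' derivation[OF D])
qed

lemma interior_chain:
  assumes D: "D \<in> derivations K A"
  shows interior_chain_linear: "linear_map K (C (Suc 0)) (C 0) (interior_chain D)"
    and interior_chain_T1: "\<lbrakk>a \<in> carrier A; b \<in> carrier A\<rbrakk> \<Longrightarrow> interior_chain D (T1 a b) = T0 (D b \<otimes>\<^bsub>A\<^esub> a)"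
proof -
  let ?g = "\<lambda>as. free_gen K [D (as ! Suc 0) \<otimes>\<^bsub>A\<^esub> as ! 0]"
  have gc: "?g as \<in> carrier (free_chains K A 0)" if "as \<in> tuples A (Suc 0)" for as
    using that unfolding tuples_cases by (auto simp: gen_closed' derivation[OF D])
  have ml: "multilinear K A (Suc 0) (C 0)
      (\<lambda>as. tensor_rels K A 0 +>\<^bsub>free_chains K A 0\<^esub> ?g as)"
    by (rule multilinear1I)
      (auto simp: proj_simps derivation[OF D] T0_linear A.l_distr A.r_distr
        smult_mult_left[symmetric] smult_mult_right[symmetric])
  show "linear_map K (C (Suc 0)) (C 0) (interior_chain D)"
    unfolding interior_chain_def by (rule tensor_map_tensor[OF gc ml])
  show "\<lbrakk>a \<in> carrier A; b \<in> carrier A\<rbrakk> \<Longrightarrow> interior_chain D (T1 a b) = T0 (D b \<otimes>\<^bsub>A\<^esub> a)"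
    unfolding interior_chain_def using tensor_map_tensor(2)[OF gc ml, of "[a, b]"] by (simp add: proj_simps)
qed

lemma connes_chain:
  shows connes_chain_linear: "linear_map K (C 0) (C (Suc 0)) connes_chain"
    and connes_chain_T0: "a \<in> carrier A \<Longrightarrow>
      connes_chain (T0 a) = T1 \<one>\<^bsub>A\<^esub> a \<oplus>\<^bsub>C (Suc 0)\<^esub> T1 a \<one>\<^bsub>A\<^esub>"
proof -
  interpret F: module K "free_chains K A (Suc 0)" by (rule free_chains_module)
  let ?g = "\<lambda>as. free_gen K [\<one>\<^bsub>A\<^esub>, as ! 0] \<oplus>\<^bsub>free_chains K A (Suc 0)\<^esub> free_gen K [as ! 0, \<one>\<^bsub>A\<^esub>]"
  have gc: "?g as \<in> carrier (free_chains K A (Suc 0))" if "as \<in> tuples A 0" for as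
    using that unfolding tuples_cases by (auto simp: gen_closed')
  have ml: "multilinear K A 0 (C (Suc 0))
      (\<lambda>as. tensor_rels K A (Suc 0) +>\<^bsub>free_chains K A (Suc 0)\<^esub> ?g as)"
    by (rule multilinear0I)
      (auto simp: proj_simps gen_closed' T1_linear C.a_ac C.smult_r_distr)
  show "linear_map K (C 0) (C (Suc 0)) connes_chain"
    unfolding connes_chain_def by (rule tensor_map_tensor[OF gc ml])
  show "a \<in> carrier A \<Longrightarrow>
      connes_chain (T0 a) = T1 \<one>\<^bsub>A\<^esub> a \<oplus>\<^bsub>C (Suc 0)\<^esub> T1 a \<one>\<^bsub>A\<^esub>"
    unfolding connes_chain_def using tensor_map_tensor(2)[OF gc ml, of "[a]"]
    by (simp add: proj_simps gen_closed')
qed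

text \<open>Extended to tensors of degree two by the Leibniz rule, the Lie derivative commutes with the boundary.\<close>

lemma lie_chain_B1:
  assumes D: "D \<in> derivations K A" and w: "w \<in> B1"
  shows "lie_chain D w \<in> B1"
proof -
  have "lie_chain D (d2 (T2 a b c)) \<in> B1"
    if abc: "a \<in> carrier A" "b \<in> carrier A" "c \<in> carrier A" for a b c
  proof -
    note dc = derivation_closed[OF D]
    have "lie_chain D (d2 (T2 a b c)) = d2 ((T2 (D a) b c \<oplus>\<^bsub>C (Suc (Suc 0))\<^esub> T2 a (D b) c)
        \<oplus>\<^bsub>C (Suc (Suc 0))\<^esub> T2 a b (D c))"
      using abc dc
      by (simp add: d2_T2 d2_simps linear_map_add[OF lie_chain_linear[OF D]]
        linear_map_diff[OF chains_module chains_module lie_chain_linear[OF D]] lie_chain_T1[OF D]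
        derivation_mult[OF D] T1_linear C.diff_simps C.a_ac)
    then show ?thesis using abc dc by (auto intro: d2_in_B1)
  qed
  then show ?thesis
    using w chain2_in_submodule[OF chains_module B1_submodule linear_map_comp[OF lie_chain_linear[OF D] d2_linear]]
    by (auto simp: B1_def)
qed

text \<open>The Lie derivative on chains of degree zero, here the lift \<open>?L\<close>, is \<open>D\<close> itself, and it makes the
  Lie derivative a chain map.\<close>

lemma lie_chain_Z1:
  assumes D: "D \<in> derivations K A" and z: "z \<in> Z1"
  shows "lie_chain D z \<in> Z1"
proof -
  have zc: "z \<in> carrier (C (Suc 0))" "d1 z = \<zero>\<^bsub>C 0\<^esub>"
    using z by (auto simp: Z1_def)
  let ?L = "tensor_lift K (C 0) (\<lambda>as. T0 (D (as ! 0)))"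
  have ml: "multilinear K A 0 (C 0) (\<lambda>as. T0 (D (as ! 0)))"
    by (rule multilinear0I) (auto simp: derivation[OF D] T0_linear)
  have L: "linear_map K (C 0) (C 0) ?L"
    "\<And>a. a \<in> carrier A \<Longrightarrow> ?L (T0 a) = T0 (D a)"
    using tensor_lift[OF chains_module ml] by auto
  note dc = derivation_closed[OF D]
  have "d1 (lie_chain D z) = ?L (d1 z)"
    by (rule chain1_map_eqI[OF chains_module linear_map_comp[OF d1_linear lie_chain_linear[OF D]]
          linear_map_comp[OF L(1) d1_linear] _ zc(1)])
      (simp add: lie_chain_T1[OF D] d1_T1 d1_simps dc L(2) linear_map_diff[OF chains_module chains_module L(1)]
        derivation_mult[OF D] T0_linear C.diff_simps C.a_ac)
  then show ?thesis
    using zc linear_map_zero[OF chains_module chains_module L(1)] linear_map_closed[OF lie_chain_linear[OF D] zc(1)]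
    by (simp add: Z1_def)
qed

text \<open>The boundary of \<open>a \<otimes> b \<otimes> c\<close> is sent to the commutator of \<open>D c \<cdot> a\<close> with \<open>b\<close>.\<close>

lemma interior_chain_B1:
  assumes D: "D \<in> derivations K A" and w: "w \<in> B1"
  shows "interior_chain D w \<in> B0"
proof -
  have "interior_chain D (d2 (T2 a b c)) \<in> B0"
    if abc: "a \<in> carrier A" "b \<in> carrier A" "c \<in> carrier A" for a b c
  proof -
    note dc = derivation_closed[OF D]
    have "interior_chain D (d2 (T2 a b c)) = d1 (T1 (D c \<otimes>\<^bsub>A\<^esub> a) b)"
      using abc dc
      by (simp add: d2_T2 d1_T1 linear_map_add[OF interior_chain_linear[OF D]]
        linear_map_diff[OF chains_module chains_module interior_chain_linear[OF D]] interior_chain_T1[OF D]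
        derivation_mult[OF D] T0_linear A.l_distr A.m_assoc C.diff_simps C.a_ac)
    then show ?thesis using abc dc by (auto intro: d1_in_B0)
  qed
  then show ?thesis
    using w chain2_in_submodule[OF chains_module B0_submodule linear_map_comp[OF interior_chain_linear[OF D] d2_linear]]
    by (auto simp: B1_def)
qed

lemma degenerate_in_B1: "a \<in> carrier A \<Longrightarrow> T1 a \<one>\<^bsub>A\<^esub> \<in> B1"
  using d2_in_B1[of "T2 a \<one>\<^bsub>A\<^esub> \<one>\<^bsub>A\<^esub>"] by (simp add: d2_T2 C.diff_self)

text \<open>Both \<open>1 \<otimes> ab\<close> and \<open>1 \<otimes> ba\<close> are homologous to \<open>a \<otimes> b + b \<otimes> a\<close>, and tensors with second factor
  \<open>1\<close> are boundaries.\<close>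

lemma connes_chain_B0:
  assumes w: "w \<in> B0"
  shows "connes_chain w \<in> B1"
proof -
  note B1E = C.submoduleE[OF B1_submodule]
  have "connes_chain (d1 (T1 a b)) \<in> B1" if ab: "a \<in> carrier A" "b \<in> carrier A" for a b
  proof -
    have "connes_chain (d1 (T1 a b)) =
        (d2 (T2 \<one>\<^bsub>A\<^esub> b a) \<oplus>\<^bsub>C (Suc 0)\<^esub> T1 (a \<otimes>\<^bsub>A\<^esub> b) \<one>\<^bsub>A\<^esub>)
        \<oplus>\<^bsub>C (Suc 0)\<^esub> \<ominus>\<^bsub>C (Suc 0)\<^esub> (d2 (T2 \<one>\<^bsub>A\<^esub> a b)
          \<oplus>\<^bsub>C (Suc 0)\<^esub> T1 (b \<otimes>\<^bsub>A\<^esub> a) \<one>\<^bsub>A\<^esub>)"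
      unfolding C.minus_eq[symmetric] using ab
      by (simp add: d2_T2 d1_T1 linear_map_diff[OF chains_module chains_module connes_chain_linear] connes_chain_T0
        C.diff_simps C.a_ac)
    moreover have "d2 (T2 \<one>\<^bsub>A\<^esub> b a) \<in> B1" "d2 (T2 \<one>\<^bsub>A\<^esub> a b) \<in> B1" using ab by (auto intro: d2_in_B1)
    ultimately show ?thesis using degenerate_in_B1 ab B1E(3,5) by auto
  qed
  then show ?thesis
    using w chain1_in_submodule[OF chains_module B1_submodule linear_map_comp[OF connes_chain_linear d1_linear]]
    by (auto simp: B0_def)
qed

lemma connes_chain_Z1: "z \<in> carrier (C 0) \<Longrightarrow> connes_chain z \<in> Z1"
proof -
  assume z: "z \<in> carrier (C 0)"
  have "d1 (connes_chain z) \<in> {\<zero>\<^bsub>C 0\<^esub>}"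
    by (rule chain0_in_submodule[OF chains_module submodule_zero[OF chains_module]
          linear_map_comp[OF d1_linear connes_chain_linear] _ z])
      (simp add: connes_chain_T0 d1_simps d1_T1 C.diff_self)
  then show ?thesis using linear_map_closed[OF connes_chain_linear z] by (simp add: Z1_def)
qed

text \<open>Inserting \<open>x\<close> in the two possible places is a homotopy between zero and the Lie derivative along
  \<open>ad x\<close>: on \<open>a \<otimes> b\<close>, the boundary of \<open>a \<otimes> b \<otimes> x - a \<otimes> x \<otimes> b\<close> is the Lie derivative plus
  \<open>d1 (a \<otimes> b) \<otimes> x\<close>, and the latter vanishes on cycles.\<close>

lemma lie_chain_inner:
  assumes x: "x \<in> carrier A" and z: "z \<in> Z1"
  shows "lie_chain (inner x) z \<in> B1"
proof -
  have zc: "z \<in> carrier (C (Suc 0))" "d1 z = \<zero>\<^bsub>C 0\<^esub>"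
    using z by (auto simp: Z1_def)
  let ?R = "tensor_lift K (C (Suc 0)) (\<lambda>as. T1 (as ! 0) x)"
  have ml: "multilinear K A 0 (C (Suc 0)) (\<lambda>as. T1 (as ! 0) x)"
    by (rule multilinear0I) (auto simp: x T1_linear)
  have R: "linear_map K (C 0) (C (Suc 0)) ?R"
    "\<And>a. a \<in> carrier A \<Longrightarrow> ?R (T0 a) = T1 a x"
    using tensor_lift[OF chains_module ml] by auto
  have L: "linear_map K (C (Suc 0)) (C (Suc 0))
      (\<lambda>z. lie_chain (inner x) z \<oplus>\<^bsub>C (Suc 0)\<^esub> ?R (d1 z))"
    by (rule linear_map_sum[OF chains_module lie_chain_linear[OF inner_derivation[OF x]]
          linear_map_comp[OF R(1) d1_linear]])
  have "lie_chain (inner x) z \<oplus>\<^bsub>C (Suc 0)\<^esub> ?R (d1 z) \<in> B1"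
  proof (rule chain1_in_submodule[OF chains_module B1_submodule L _ zc(1)])
    fix a b assume ab: "a \<in> carrier A" "b \<in> carrier A"
    have "lie_chain (inner x) (T1 a b) \<oplus>\<^bsub>C (Suc 0)\<^esub> ?R (d1 (T1 a b)) =
        d2 (T2 a b x \<ominus>\<^bsub>C (Suc (Suc 0))\<^esub> T2 a x b)"
      using ab x
      by (simp add: lie_chain_T1[OF inner_derivation[OF x]] d1_T1 d2_T2 d2_simps R(2)
        linear_map_diff[OF chains_module chains_module R(1)] T1_diff C.diff_simps C.a_ac)
    then show "lie_chain (inner x) (T1 a b) \<oplus>\<^bsub>C (Suc 0)\<^esub> ?R (d1 (T1 a b)) \<in> B1"
      using ab x by (auto intro: d2_in_B1)
  qed
  then show ?thesis
    using zc linear_map_zero[OF chains_module chains_module R(1)]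
      linear_map_closed[OF lie_chain_linear[OF inner_derivation[OF x]] zc(1)] by simp
qed

text \<open>On \<open>a \<otimes> b\<close>, the interior product with \<open>ad x\<close> plus \<open>x \<cdot> d1 (a \<otimes> b)\<close> is the commutator of \<open>xa\<close>
  with \<open>b\<close>.\<close>

lemma interior_chain_inner:
  assumes x: "x \<in> carrier A" and z: "z \<in> Z1"
  shows "interior_chain (inner x) z \<in> B0"
proof -
  have zc: "z \<in> carrier (C (Suc 0))" "d1 z = \<zero>\<^bsub>C 0\<^esub>"
    using z by (auto simp: Z1_def)
  let ?R = "tensor_lift K (C 0) (\<lambda>as. T0 (x \<otimes>\<^bsub>A\<^esub> as ! 0))"
  have ml: "multilinear K A 0 (C 0) (\<lambda>as. T0 (x \<otimes>\<^bsub>A\<^esub> as ! 0))"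
    by (rule multilinear0I) (auto simp: x T0_linear A.r_distr smult_mult_right[symmetric])
  have R: "linear_map K (C 0) (C 0) ?R"
    "\<And>a. a \<in> carrier A \<Longrightarrow> ?R (T0 a) = T0 (x \<otimes>\<^bsub>A\<^esub> a)"
    using tensor_lift[OF chains_module ml] by auto
  have L: "linear_map K (C (Suc 0)) (C 0)
      (\<lambda>z. interior_chain (inner x) z \<oplus>\<^bsub>C 0\<^esub> ?R (d1 z))"
    by (rule linear_map_sum[OF chains_module interior_chain_linear[OF inner_derivation[OF x]]
          linear_map_comp[OF R(1) d1_linear]])
  have "interior_chain (inner x) z \<oplus>\<^bsub>C 0\<^esub> ?R (d1 z) \<in> B0"
  proof (rule chain1_in_submodule[OF chains_module B0_submodule L _ zc(1)])
    fix a b assume ab: "a \<in> carrier A" "b \<in> carrier A"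
    have "interior_chain (inner x) (T1 a b) \<oplus>\<^bsub>C 0\<^esub> ?R (d1 (T1 a b)) = d1 (T1 (x \<otimes>\<^bsub>A\<^esub> a) b)"
      using ab x
      by (simp add: interior_chain_T1[OF inner_derivation[OF x]] d1_T1 R(2)
        linear_map_diff[OF chains_module chains_module R(1)] T0_diff A.diff_l_distr A.m_assoc C.diff_simps C.a_ac)
    then show "interior_chain (inner x) (T1 a b) \<oplus>\<^bsub>C 0\<^esub> ?R (d1 (T1 a b)) \<in> B0"
      using ab x by (auto intro: d1_in_B0)
  qed
  then show ?thesis
    using zc linear_map_zero[OF chains_module chains_module R(1)]
      linear_map_closed[OF interior_chain_linear[OF inner_derivation[OF x]] zc(1)] by simp
qed

end

section \<open>Operations on homology classes\<close>

context hochschild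
begin

lemma lie_chain_add:
  assumes "D \<in> derivations K A" "D' \<in> derivations K A" "z \<in> carrier (C (Suc 0))"
  shows "lie_chain (D \<oplus>\<^bsub>Der\<^esub> D') z = lie_chain D z \<oplus>\<^bsub>C (Suc 0)\<^esub> lie_chain D' z"
proof -
  have DD: "D \<oplus>\<^bsub>Der\<^esub> D' \<in> derivations K A" using assms Der.a_closed[of D D'] by (simp add: Der_simps)
  show ?thesis
    by (rule chain1_map_eqI[OF chains_module lie_chain_linear[OF DD]
          linear_map_sum[OF chains_module lie_chain_linear[OF assms(1)] lie_chain_linear[OF assms(2)]] _ assms(3)])
      (simp add: lie_chain_T1 DD assms, simp add: Der_simps derivation[OF assms(1)] derivation[OF assms(2)]
        T1_linear C.a_ac)
qed

lemma interior_chain_add: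
  assumes "D \<in> derivations K A" "D' \<in> derivations K A" "z \<in> carrier (C (Suc 0))"
  shows "interior_chain (D \<oplus>\<^bsub>Der\<^esub> D') z = interior_chain D z \<oplus>\<^bsub>C 0\<^esub> interior_chain D' z"
proof -
  have DD: "D \<oplus>\<^bsub>Der\<^esub> D' \<in> derivations K A" using assms Der.a_closed[of D D'] by (simp add: Der_simps)
  show ?thesis
    by (rule chain1_map_eqI[OF chains_module interior_chain_linear[OF DD]
          linear_map_sum[OF chains_module interior_chain_linear[OF assms(1)] interior_chain_linear[OF assms(2)]] _ assms(3)])
      (simp add: interior_chain_T1 DD assms, simp add: Der_simps derivation[OF assms(1)] derivation[OF assms(2)]
        T0_linear A.l_distr)
qed

text \<open>The union over all derivations in the class is a single value, because two of them differ by an inner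
  derivation, which acts on cycles by boundaries.\<close>

lemma lie_derivative_class:
  assumes D: "D \<in> derivations K A" and z: "z \<in> Z1"
  shows "lie_derivative K A (inner_derivations A +>\<^bsub>Der\<^esub> D) (cl1 z) = cl1 (lie_chain D z)"
proof -
  have zc: "z \<in> carrier (C (Suc 0))" using z Z1_subset by auto
  have hm: "homology_map K A (Suc 0) (\<lambda>as. free_gen K [E (as ! 0), as ! Suc 0]
      \<oplus>\<^bsub>free_chains K A (Suc 0)\<^esub> free_gen K [as ! 0, E (as ! Suc 0)]) (cl1 z) = cl1 (lie_chain E z)"
    if "E \<in> derivations K A" for E
    unfolding homology_map_def boundaries_eq lie_chain_def[symmetric]
    by (rule H1.quot_map_coset[OF chains_module B1_submodule lie_chain_linear[OF that] lie_chain_B1[OF that] zc])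
  have "cl1 (lie_chain E z) = cl1 (lie_chain D z) \<and> E \<in> derivations K A"
    if E: "E \<in> inner_derivations A +>\<^bsub>Der\<^esub> D" for E
  proof -
    obtain x where x: "x \<in> carrier A" "E = inner x \<oplus>\<^bsub>Der\<^esub> D" "E \<in> derivations K A"
      by (rule der_coset_mem[OF D E])
    note i = inner_derivation[OF x(1)]
    note c = linear_map_closed[OF lie_chain_linear[OF i] zc] linear_map_closed[OF lie_chain_linear[OF D] zc]
    have "lie_chain E z \<ominus>\<^bsub>C (Suc 0)\<^esub> lie_chain D z = lie_chain (inner x) z"
      unfolding x(2) lie_chain_add[OF i D zc] using c by (simp add: C.diff_simps)
    then show ?thesis
      using lie_chain_inner[OF x(1) z] c x(3) linear_map_closed[OF lie_chain_linear[OF x(3)] zc]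
      by (simp add: H1.coset_eq_iff)
  qed
  then have "homology_map K A (Suc 0) (\<lambda>as. free_gen K [E (as ! 0), as ! Suc 0]
      \<oplus>\<^bsub>free_chains K A (Suc 0)\<^esub> free_gen K [as ! 0, E (as ! Suc 0)]) (cl1 z) = cl1 (lie_chain D z)"
    if "E \<in> inner_derivations A +>\<^bsub>Der\<^esub> D" for E
    using hm[of E] that by simp
  moreover have "inner_derivations A +>\<^bsub>Der\<^esub> D \<noteq> {}"
    using Out.N.a_rcos_self D by (auto simp: Der_simps)
  ultimately show ?thesis
    unfolding lie_derivative_def One_nat_def by (intro SUP_eq_const)
qed

lemma interior_product_class:
  assumes D: "D \<in> derivations K A" and z: "z \<in> Z1"
  shows "interior_product K A (inner_derivations A +>\<^bsub>Der\<^esub> D) (cl1 z) = cl0 (interior_chain D z)"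
proof -
  have zc: "z \<in> carrier (C (Suc 0))" using z Z1_subset by auto
  have hm: "homology_map K A 0 (\<lambda>as. free_gen K [E (as ! Suc 0) \<otimes>\<^bsub>A\<^esub> as ! 0]) (cl1 z) = cl0 (interior_chain E z)"
    if "E \<in> derivations K A" for E
    unfolding homology_map_def boundaries_eq interior_chain_def[symmetric]
    by (rule H1.quot_map_coset[OF chains_module B0_submodule interior_chain_linear[OF that] interior_chain_B1[OF that] zc])
  have "cl0 (interior_chain E z) = cl0 (interior_chain D z) \<and> E \<in> derivations K A"
    if E: "E \<in> inner_derivations A +>\<^bsub>Der\<^esub> D" for E
  proof -
    obtain x where x: "x \<in> carrier A" "E = inner x \<oplus>\<^bsub>Der\<^esub> D" "E \<in> derivations K A"
      by (rule der_coset_mem[OF D E])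
    note i = inner_derivation[OF x(1)]
    note c = linear_map_closed[OF interior_chain_linear[OF i] zc] linear_map_closed[OF interior_chain_linear[OF D] zc]
    have "interior_chain E z \<ominus>\<^bsub>C 0\<^esub> interior_chain D z = interior_chain (inner x) z"
      unfolding x(2) interior_chain_add[OF i D zc] using c by (simp add: C.diff_simps)
    then show ?thesis
      using interior_chain_inner[OF x(1) z] c x(3) linear_map_closed[OF interior_chain_linear[OF x(3)] zc]
      by (simp add: H0.coset_eq_iff)
  qed
  then have "homology_map K A 0 (\<lambda>as. free_gen K [E (as ! Suc 0) \<otimes>\<^bsub>A\<^esub> as ! 0]) (cl1 z) = cl0 (interior_chain D z)"
    if "E \<in> inner_derivations A +>\<^bsub>Der\<^esub> D" for E
    using hm[of E] that by simp
  moreover have "inner_derivations A +>\<^bsub>Der\<^esub> D \<noteq> {}"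
    using Out.N.a_rcos_self D by (auto simp: Der_simps)
  ultimately show ?thesis
    unfolding interior_product_def One_nat_def by (intro SUP_eq_const)
qed

lemma connes_B_class:
  assumes z: "z \<in> carrier (C 0)"
  shows "connes_B K A (cl0 z) = cl1 (connes_chain z)"
  unfolding connes_B_def One_nat_def homology_map_def boundaries_eq connes_chain_def[symmetric]
  by (rule H0.quot_map_coset[OF chains_module B1_submodule connes_chain_linear connes_chain_B0 z])

text \<open>All operations on classes reduce to operations on representatives. The difference in the bracket is
  formed in the module of cycles, whose additive inverse agrees on cycles with that of the chains.\<close>

lemma courant_bracket_class:
  assumes D: "D \<in> derivations K A" "D' \<in> derivations K A" and z: "z \<in> Z1" "z' \<in> Z1"
  shows "courant_bracket K A (inner_derivations A +>\<^bsub>Der\<^esub> D, cl1 z) (inner_derivations A +>\<^bsub>Der\<^esub> D', cl1 z') =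
    (inner_derivations A +>\<^bsub>Der\<^esub> der_commutator A D D',
     cl1 ((lie_chain D z' \<ominus>\<^bsub>C (Suc 0)\<^esub> lie_chain D' z) \<oplus>\<^bsub>C (Suc 0)\<^esub> connes_chain (interior_chain D' z)))"
proof -
  have zc: "z \<in> carrier (C (Suc 0))" using z Z1_subset by auto
  have ic: "interior_chain D' z \<in> carrier (C 0)" using linear_map_closed[OF interior_chain_linear[OF D(2)] zc] .
  have m: "lie_chain D z' \<in> Z1" "lie_chain D' z \<in> Z1" "connes_chain (interior_chain D' z) \<in> Z1"
    using lie_chain_Z1 D z connes_chain_Z1[OF ic] by auto
  have md: "lie_chain D z' \<ominus>\<^bsub>Z1_module\<^esub> lie_chain D' z \<in> Z1"
    using HZ.minus_closed[of "lie_chain D z'" "lie_chain D' z"] m by simp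
  have dd: "lie_chain D z' \<ominus>\<^bsub>Z1_module\<^esub> lie_chain D' z = lie_chain D z' \<ominus>\<^bsub>C (Suc 0)\<^esub> lie_chain D' z"
    using linear_map_diff[OF Z1_module chains_module[of "Suc 0"], of "\<lambda>x. x" "lie_chain D z'" "lie_chain D' z"] m Z1_subset
    by (simp add: linear_map_def subset_iff)
  show ?thesis
    using m md HZ.quot_diff[of "lie_chain D z'" "lie_chain D' z"]
      HZ.quot_add[of "lie_chain D z' \<ominus>\<^bsub>Z1_module\<^esub> lie_chain D' z" "connes_chain (interior_chain D' z)"]
    by (simp add: courant_bracket_def outer_bracket_coset D lie_derivative_class z interior_product_class
        connes_B_class ic H1_eq cl1_restrict dd)
qed

lemma courant_form_class:
  assumes D: "D \<in> derivations K A" "D' \<in> derivations K A" and z: "z \<in> Z1" "z' \<in> Z1"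
  shows "courant_form K A (inner_derivations A +>\<^bsub>Der\<^esub> D, cl1 z) (inner_derivations A +>\<^bsub>Der\<^esub> D', cl1 z') =
    cl0 (interior_chain D' z \<oplus>\<^bsub>C 0\<^esub> interior_chain D z')"
proof -
  have zc: "z \<in> carrier (C (Suc 0))" "z' \<in> carrier (C (Suc 0))"
    using z Z1_subset by auto
  show ?thesis
    using linear_map_closed[OF interior_chain_linear[OF D(2)] zc(1)] linear_map_closed[OF interior_chain_linear[OF D(1)] zc(2)]
    by (simp add: courant_form_def interior_product_class D z H0_eq H0.quot_add)
qed

lemma courant_cases:
  assumes "e \<in> carrier (courant_module K A)"
  obtains D z where "e = (inner_derivations A +>\<^bsub>Der\<^esub> D, cl1 z)" "D \<in> derivations K A" "z \<in> Z1"
  using assms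
  by (auto simp: courant_module_def prod_module_def outer_der_def Out.quot_carrier H1_eq HZ.quot_carrier
      cl1_restrict Der_simps)

end

section \<open>The algebra of matrices\<close>

lemmas mat_algebra_simps = mat_algebra_def[unfolded Let_def]

locale matrices = hochschild K A for K :: "('k, 'r) ring_scheme" and A :: "('k, 'a) module" +
  fixes r :: nat
  assumes r_pos: "0 < r"
begin

abbreviation I :: "(nat \<times> nat) set" where "I \<equiv> {..<r} \<times> {..<r}"
abbreviation Mat :: "('k, nat \<times> nat \<Rightarrow> 'a) module" where "Mat \<equiv> mat_algebra A r"

lemma mat_entry_closed: "X \<in> carrier Mat \<Longrightarrow> i < r \<Longrightarrow> j < r \<Longrightarrow> X (i, j) \<in> carrier A"
  by (auto simp: mat_algebra_simps PiE_def Pi_def)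

lemma mat_eqI:
  assumes "X \<in> carrier Mat" "Y \<in> carrier Mat" "\<And>i j. \<lbrakk>i < r; j < r\<rbrakk> \<Longrightarrow> X (i, j) = Y (i, j)"
  shows "X = Y"
  using assms by (intro PiE_ext[of X I "\<lambda>_. carrier A" Y]) (auto simp: mat_algebra_simps)

lemma mat_entries:
  assumes "i < r" "j < r"
  shows mat_add_entry: "(X \<oplus>\<^bsub>Mat\<^esub> Y) (i, j) = X (i, j) \<oplus>\<^bsub>A\<^esub> Y (i, j)"
    and mat_mult_entry: "(X \<otimes>\<^bsub>Mat\<^esub> Y) (i, j) = (\<Oplus>\<^bsub>A\<^esub>l\<in>{..<r}. X (i, l) \<otimes>\<^bsub>A\<^esub> Y (l, j))"
    and mat_smult_entry: "(c \<odot>\<^bsub>Mat\<^esub> X) (i, j) = c \<odot>\<^bsub>A\<^esub> X (i, j)"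
    and mat_zero_entry: "\<zero>\<^bsub>Mat\<^esub> (i, j) = \<zero>\<^bsub>A\<^esub>"
    and mat_one_entry: "\<one>\<^bsub>Mat\<^esub> (i, j) = (if i = j then \<one>\<^bsub>A\<^esub> else \<zero>\<^bsub>A\<^esub>)"
  using assms by (simp_all add: mat_algebra_simps)

lemma mat_ops_extensional:
  "X \<oplus>\<^bsub>Mat\<^esub> Y \<in> extensional I" "X \<otimes>\<^bsub>Mat\<^esub> Y \<in> extensional I" "c \<odot>\<^bsub>Mat\<^esub> X \<in> extensional I"
  "\<zero>\<^bsub>Mat\<^esub> \<in> extensional I" "\<one>\<^bsub>Mat\<^esub> \<in> extensional I"
  by (simp_all add: mat_algebra_simps)

lemma mat_closedI:
  "\<lbrakk>X \<in> extensional I; \<And>i j. \<lbrakk>i < r; j < r\<rbrakk> \<Longrightarrow> X (i, j) \<in> carrier A\<rbrakk> \<Longrightarrow> X \<in> carrier Mat"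
  by (auto simp: mat_algebra_simps PiE_def Pi_def)

lemma mat_ops_closed:
  "\<lbrakk>X \<in> carrier Mat; Y \<in> carrier Mat\<rbrakk> \<Longrightarrow> X \<oplus>\<^bsub>Mat\<^esub> Y \<in> carrier Mat"
  "\<lbrakk>X \<in> carrier Mat; Y \<in> carrier Mat\<rbrakk> \<Longrightarrow> X \<otimes>\<^bsub>Mat\<^esub> Y \<in> carrier Mat"
  "\<lbrakk>c \<in> carrier K; X \<in> carrier Mat\<rbrakk> \<Longrightarrow> c \<odot>\<^bsub>Mat\<^esub> X \<in> carrier Mat"
  "\<zero>\<^bsub>Mat\<^esub> \<in> carrier Mat" "\<one>\<^bsub>Mat\<^esub> \<in> carrier Mat"
proof -
  show "X \<otimes>\<^bsub>Mat\<^esub> Y \<in> carrier Mat" if XY: "X \<in> carrier Mat" "Y \<in> carrier Mat"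
  proof (rule mat_closedI[OF mat_ops_extensional(2)])
    fix i j assume ij: "i < r" "j < r"
    show "(X \<otimes>\<^bsub>Mat\<^esub> Y) (i, j) \<in> carrier A"
      unfolding mat_mult_entry[OF ij] by (rule M.finsum_closed) (use ij XY[THEN mat_entry_closed] in simp)
  qed
qed (rule mat_closedI, rule mat_ops_extensional, simp add: mat_entries mat_entry_closed[of X] mat_entry_closed[of Y])+

lemma mat_mult_assoc:
  assumes X: "X \<in> carrier Mat" and Y: "Y \<in> carrier Mat" and Z: "Z \<in> carrier Mat"
  shows "(X \<otimes>\<^bsub>Mat\<^esub> Y) \<otimes>\<^bsub>Mat\<^esub> Z = X \<otimes>\<^bsub>Mat\<^esub> (Y \<otimes>\<^bsub>Mat\<^esub> Z)"
proof (rule mat_eqI)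
  note [simp] = assms[THEN mat_entry_closed]
  fix i j assume ij: "i < r" "j < r"
  have "((X \<otimes>\<^bsub>Mat\<^esub> Y) \<otimes>\<^bsub>Mat\<^esub> Z) (i, j) =
      (\<Oplus>\<^bsub>A\<^esub>l\<in>{..<r}. \<Oplus>\<^bsub>A\<^esub>m\<in>{..<r}. X (i, m) \<otimes>\<^bsub>A\<^esub> Y (m, l) \<otimes>\<^bsub>A\<^esub> Z (l, j))"
    unfolding mat_mult_entry[OF ij]
    by (rule M.finsum_cong') (use assms ij in \<open>auto simp: mat_mult_entry intro!: A.finsum_ldistr M.finsum_closed\<close>)
  also have "\<dots> = (\<Oplus>\<^bsub>A\<^esub>m\<in>{..<r}. \<Oplus>\<^bsub>A\<^esub>l\<in>{..<r}. X (i, m) \<otimes>\<^bsub>A\<^esub> Y (m, l) \<otimes>\<^bsub>A\<^esub> Z (l, j))"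
    by (rule M.finsum_swap) (use assms ij in auto)
  also have "\<dots> = (\<Oplus>\<^bsub>A\<^esub>m\<in>{..<r}. X (i, m) \<otimes>\<^bsub>A\<^esub> (\<Oplus>\<^bsub>A\<^esub>l\<in>{..<r}. Y (m, l) \<otimes>\<^bsub>A\<^esub> Z (l, j)))"
  proof (rule M.finsum_cong')
    fix m assume m: "m \<in> {..<r}"
    show "(\<Oplus>\<^bsub>A\<^esub>l\<in>{..<r}. X (i, m) \<otimes>\<^bsub>A\<^esub> Y (m, l) \<otimes>\<^bsub>A\<^esub> Z (l, j)) =
        X (i, m) \<otimes>\<^bsub>A\<^esub> (\<Oplus>\<^bsub>A\<^esub>l\<in>{..<r}. Y (m, l) \<otimes>\<^bsub>A\<^esub> Z (l, j))"
      using assms ij m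
      by (subst A.finsum_rdistr) (auto intro!: M.finsum_cong' simp: A.m_assoc)
  qed (use assms ij in \<open>auto intro!: M.finsum_closed\<close>)
  also have "\<dots> = (X \<otimes>\<^bsub>Mat\<^esub> (Y \<otimes>\<^bsub>Mat\<^esub> Z)) (i, j)"
    unfolding mat_mult_entry[OF ij]
    by (rule M.finsum_cong') (use assms ij in \<open>auto simp: mat_mult_entry intro!: M.finsum_closed\<close>)
  finally show "((X \<otimes>\<^bsub>Mat\<^esub> Y) \<otimes>\<^bsub>Mat\<^esub> Z) (i, j) = (X \<otimes>\<^bsub>Mat\<^esub> (Y \<otimes>\<^bsub>Mat\<^esub> Z)) (i, j)" .
qed (use assms in \<open>auto intro: mat_ops_closed\<close>)

lemma mat_mult_one:
  assumes X: "X \<in> carrier Mat"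
  shows "\<one>\<^bsub>Mat\<^esub> \<otimes>\<^bsub>Mat\<^esub> X = X" "X \<otimes>\<^bsub>Mat\<^esub> \<one>\<^bsub>Mat\<^esub> = X"
proof -
  note [simp] = assms[THEN mat_entry_closed]
  show "\<one>\<^bsub>Mat\<^esub> \<otimes>\<^bsub>Mat\<^esub> X = X"
  proof (rule mat_eqI)
    fix i j assume ij: "i < r" "j < r"
    have "(\<Oplus>\<^bsub>A\<^esub>l\<in>{..<r}. \<one>\<^bsub>Mat\<^esub> (i, l) \<otimes>\<^bsub>A\<^esub> X (l, j)) = (\<Oplus>\<^bsub>A\<^esub>l\<in>{..<r}. if l = i then X (i, j) else \<zero>\<^bsub>A\<^esub>)"
      by (rule M.finsum_cong') (use X ij in \<open>auto simp: mat_one_entry\<close>)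
    then show "(\<one>\<^bsub>Mat\<^esub> \<otimes>\<^bsub>Mat\<^esub> X) (i, j) = X (i, j)"
      using X ij by (simp add: mat_mult_entry M.finsum_delta)
  qed (use X in \<open>auto intro: mat_ops_closed\<close>)
  show "X \<otimes>\<^bsub>Mat\<^esub> \<one>\<^bsub>Mat\<^esub> = X"
  proof (rule mat_eqI)
    fix i j assume ij: "i < r" "j < r"
    have "(\<Oplus>\<^bsub>A\<^esub>l\<in>{..<r}. X (i, l) \<otimes>\<^bsub>A\<^esub> \<one>\<^bsub>Mat\<^esub> (l, j)) = (\<Oplus>\<^bsub>A\<^esub>l\<in>{..<r}. if l = j then X (i, j) else \<zero>\<^bsub>A\<^esub>)"
      by (rule M.finsum_cong') (use X ij in \<open>auto simp: mat_one_entry\<close>)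
    then show "(X \<otimes>\<^bsub>Mat\<^esub> \<one>\<^bsub>Mat\<^esub>) (i, j) = X (i, j)"
      using X ij by (simp add: mat_mult_entry M.finsum_delta)
  qed (use X in \<open>auto intro: mat_ops_closed\<close>)
qed

lemma mat_mult_distr:
  assumes "X \<in> carrier Mat" "Y \<in> carrier Mat" "Z \<in> carrier Mat"
  shows "(X \<oplus>\<^bsub>Mat\<^esub> Y) \<otimes>\<^bsub>Mat\<^esub> Z = X \<otimes>\<^bsub>Mat\<^esub> Z \<oplus>\<^bsub>Mat\<^esub> Y \<otimes>\<^bsub>Mat\<^esub> Z"
    and "Z \<otimes>\<^bsub>Mat\<^esub> (X \<oplus>\<^bsub>Mat\<^esub> Y) = Z \<otimes>\<^bsub>Mat\<^esub> X \<oplus>\<^bsub>Mat\<^esub> Z \<otimes>\<^bsub>Mat\<^esub> Y"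
proof -
  note [simp] = assms[THEN mat_entry_closed]
  show "(X \<oplus>\<^bsub>Mat\<^esub> Y) \<otimes>\<^bsub>Mat\<^esub> Z = X \<otimes>\<^bsub>Mat\<^esub> Z \<oplus>\<^bsub>Mat\<^esub> Y \<otimes>\<^bsub>Mat\<^esub> Z"
  proof (rule mat_eqI)
    fix i j assume ij: "i < r" "j < r"
    have "((X \<oplus>\<^bsub>Mat\<^esub> Y) \<otimes>\<^bsub>Mat\<^esub> Z) (i, j) =
        (\<Oplus>\<^bsub>A\<^esub>l\<in>{..<r}. X (i, l) \<otimes>\<^bsub>A\<^esub> Z (l, j) \<oplus>\<^bsub>A\<^esub> Y (i, l) \<otimes>\<^bsub>A\<^esub> Z (l, j))"
      unfolding mat_mult_entry[OF ij]
      by (rule M.finsum_cong') (use assms ij in \<open>auto simp: mat_entries A.l_distr\<close>)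
    also have "\<dots> = (X \<otimes>\<^bsub>Mat\<^esub> Z \<oplus>\<^bsub>Mat\<^esub> Y \<otimes>\<^bsub>Mat\<^esub> Z) (i, j)"
      unfolding mat_mult_entry[OF ij] mat_add_entry[OF ij]
      by (rule M.finsum_addf) (use assms ij in auto)
    finally show "((X \<oplus>\<^bsub>Mat\<^esub> Y) \<otimes>\<^bsub>Mat\<^esub> Z) (i, j) = (X \<otimes>\<^bsub>Mat\<^esub> Z \<oplus>\<^bsub>Mat\<^esub> Y \<otimes>\<^bsub>Mat\<^esub> Z) (i, j)" .
  qed (intro mat_ops_closed assms)+
  show "Z \<otimes>\<^bsub>Mat\<^esub> (X \<oplus>\<^bsub>Mat\<^esub> Y) = Z \<otimes>\<^bsub>Mat\<^esub> X \<oplus>\<^bsub>Mat\<^esub> Z \<otimes>\<^bsub>Mat\<^esub> Y"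
  proof (rule mat_eqI)
    fix i j assume ij: "i < r" "j < r"
    have "(Z \<otimes>\<^bsub>Mat\<^esub> (X \<oplus>\<^bsub>Mat\<^esub> Y)) (i, j) =
        (\<Oplus>\<^bsub>A\<^esub>l\<in>{..<r}. Z (i, l) \<otimes>\<^bsub>A\<^esub> X (l, j) \<oplus>\<^bsub>A\<^esub> Z (i, l) \<otimes>\<^bsub>A\<^esub> Y (l, j))"
      unfolding mat_mult_entry[OF ij]
      by (rule M.finsum_cong') (use assms ij in \<open>auto simp: mat_entries A.r_distr\<close>)
    also have "\<dots> = (Z \<otimes>\<^bsub>Mat\<^esub> X \<oplus>\<^bsub>Mat\<^esub> Z \<otimes>\<^bsub>Mat\<^esub> Y) (i, j)"
      unfolding mat_mult_entry[OF ij] mat_add_entry[OF ij]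
      by (rule M.finsum_addf) (use assms ij in auto)
    finally show "(Z \<otimes>\<^bsub>Mat\<^esub> (X \<oplus>\<^bsub>Mat\<^esub> Y)) (i, j) = (Z \<otimes>\<^bsub>Mat\<^esub> X \<oplus>\<^bsub>Mat\<^esub> Z \<otimes>\<^bsub>Mat\<^esub> Y) (i, j)" .
  qed (intro mat_ops_closed assms)+
qed

lemma mat_mult_smult:
  assumes "c \<in> carrier K" "X \<in> carrier Mat" "Y \<in> carrier Mat"
  shows "c \<odot>\<^bsub>Mat\<^esub> (X \<otimes>\<^bsub>Mat\<^esub> Y) = (c \<odot>\<^bsub>Mat\<^esub> X) \<otimes>\<^bsub>Mat\<^esub> Y"
    and "c \<odot>\<^bsub>Mat\<^esub> (X \<otimes>\<^bsub>Mat\<^esub> Y) = X \<otimes>\<^bsub>Mat\<^esub> (c \<odot>\<^bsub>Mat\<^esub> Y)"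
proof -
  note [simp] = assms(2,3)[THEN mat_entry_closed]
  have s: "(c \<odot>\<^bsub>Mat\<^esub> (X \<otimes>\<^bsub>Mat\<^esub> Y)) (i, j) = (\<Oplus>\<^bsub>A\<^esub>l\<in>{..<r}. c \<odot>\<^bsub>A\<^esub> (X (i, l) \<otimes>\<^bsub>A\<^esub> Y (l, j)))"
    if ij: "i < r" "j < r" for i j
    unfolding mat_mult_entry[OF ij] mat_smult_entry[OF ij]
    by (rule finsum_smult_ldistr) (use assms ij in auto)
  show "c \<odot>\<^bsub>Mat\<^esub> (X \<otimes>\<^bsub>Mat\<^esub> Y) = (c \<odot>\<^bsub>Mat\<^esub> X) \<otimes>\<^bsub>Mat\<^esub> Y"
  proof (rule mat_eqI)
    fix i j assume ij: "i < r" "j < r"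
    show "(c \<odot>\<^bsub>Mat\<^esub> (X \<otimes>\<^bsub>Mat\<^esub> Y)) (i, j) = ((c \<odot>\<^bsub>Mat\<^esub> X) \<otimes>\<^bsub>Mat\<^esub> Y) (i, j)"
      unfolding s[OF ij] mat_mult_entry[OF ij]
      by (rule M.finsum_cong') (use assms ij in \<open>auto simp: mat_entries smult_mult_left\<close>)
  qed (intro mat_ops_closed assms)+
  show "c \<odot>\<^bsub>Mat\<^esub> (X \<otimes>\<^bsub>Mat\<^esub> Y) = X \<otimes>\<^bsub>Mat\<^esub> (c \<odot>\<^bsub>Mat\<^esub> Y)"
  proof (rule mat_eqI)
    fix i j assume ij: "i < r" "j < r"
    show "(c \<odot>\<^bsub>Mat\<^esub> (X \<otimes>\<^bsub>Mat\<^esub> Y)) (i, j) = (X \<otimes>\<^bsub>Mat\<^esub> (c \<odot>\<^bsub>Mat\<^esub> Y)) (i, j)"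
      unfolding s[OF ij] mat_mult_entry[OF ij]
      by (rule M.finsum_cong') (use assms ij in \<open>auto simp: mat_entries smult_mult_right\<close>)
  qed (intro mat_ops_closed assms)+
qed

lemma mat_abelian_group: "abelian_group Mat"
proof (rule abelian_groupI, goal_cases)
  case (6 X)
  let ?Y = "\<lambda>p\<in>I. \<ominus>\<^bsub>A\<^esub> X p"
  have "?Y \<in> carrier Mat" using 6 by (auto simp: mat_algebra_simps PiE_def Pi_def)
  moreover have "?Y \<oplus>\<^bsub>Mat\<^esub> X = \<zero>\<^bsub>Mat\<^esub>"
    by (rule mat_eqI) (use 6 calculation mat_entry_closed[OF 6] in \<open>auto simp: mat_entries M.l_neg intro: mat_ops_closed\<close>)
  ultimately show ?case by blast
qed (auto intro!: mat_ops_closed mat_eqI M.a_assoc M.a_comm simp: mat_entries dest: mat_entry_closed)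

lemma mat_assoc_algebra: "assoc_algebra K Mat"
proof -
  have "ring Mat"
    by (intro ringI mat_abelian_group monoidI)
      (auto intro!: mat_ops_closed mat_mult_assoc mat_mult_one mat_mult_distr)
  moreover have "module K Mat"
    by (intro moduleI mat_abelian_group R.is_cring)
      (auto intro!: mat_ops_closed mat_eqI smult_r_distr simp: mat_entries smult_l_distr smult_assoc1
        dest: mat_entry_closed)
  ultimately show ?thesis
    by (intro assoc_algebra.intro assoc_algebra_axioms.intro mat_mult_smult)
qed

sublocale Mat: hochschild K Mat
  using mat_assoc_algebra by (rule hochschild.intro)

end

section \<open>Matrix units\<close>

context matrices
begin

definition E :: "'a \<Rightarrow> nat \<Rightarrow> nat \<Rightarrow> nat \<times> nat \<Rightarrow> 'a" where
  "E a i j = (\<lambda>p\<in>I. if p = (i, j) then a else \<zero>\<^bsub>A\<^esub>)"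

lemma E_closed [simp, intro]: "a \<in> carrier A \<Longrightarrow> E a i j \<in> carrier Mat"
  by (auto simp: E_def mat_algebra_simps)

lemma E_entry: "k < r \<Longrightarrow> l < r \<Longrightarrow> E a i j (k, l) = (if k = i \<and> l = j then a else \<zero>\<^bsub>A\<^esub>)"
  by (simp add: E_def)

lemma E_linear:
  "\<lbrakk>a \<in> carrier A; b \<in> carrier A\<rbrakk> \<Longrightarrow> E (a \<oplus>\<^bsub>A\<^esub> b) i j = E a i j \<oplus>\<^bsub>Mat\<^esub> E b i j"
  "\<lbrakk>c \<in> carrier K; a \<in> carrier A\<rbrakk> \<Longrightarrow> E (c \<odot>\<^bsub>A\<^esub> a) i j = c \<odot>\<^bsub>Mat\<^esub> E a i j"
  by (rule mat_eqI; auto simp: mat_entries E_entry)+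

lemma E_map_linear: "linear_map K A Mat (\<lambda>a. E a i j)"
  by (rule linear_mapI) (auto simp: E_linear)

lemma E_diff:
  "\<lbrakk>a \<in> carrier A; b \<in> carrier A\<rbrakk> \<Longrightarrow> E (a \<ominus>\<^bsub>A\<^esub> b) i j = E a i j \<ominus>\<^bsub>Mat\<^esub> E b i j"
  by (rule linear_map_diff[OF module_axioms Mat.module_axioms E_map_linear])

text \<open>Products with these matrices involve no sums, which keeps computations on these generators short.\<close>

lemma mult_E_entry:
  assumes "X \<in> carrier Mat" "b \<in> carrier A" "i < r" "j < r" "k < r" "l < r"
  shows mult_E_entry_right: "(X \<otimes>\<^bsub>Mat\<^esub> E b i j) (k, l) = (if l = j then X (k, i) \<otimes>\<^bsub>A\<^esub> b else \<zero>\<^bsub>A\<^esub>)"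
    and mult_E_entry_left: "(E b i j \<otimes>\<^bsub>Mat\<^esub> X) (k, l) = (if k = i then b \<otimes>\<^bsub>A\<^esub> X (j, l) else \<zero>\<^bsub>A\<^esub>)"
proof -
  note [simp] = mat_entry_closed[OF assms(1)]
  have "(\<Oplus>\<^bsub>A\<^esub>m\<in>{..<r}. X (k, m) \<otimes>\<^bsub>A\<^esub> E b i j (m, l)) =
      (\<Oplus>\<^bsub>A\<^esub>m\<in>{..<r}. if m = i then (if l = j then X (k, i) \<otimes>\<^bsub>A\<^esub> b else \<zero>\<^bsub>A\<^esub>) else \<zero>\<^bsub>A\<^esub>)"
    by (rule M.finsum_cong') (use assms in \<open>auto simp: E_entry\<close>)
  then show "(X \<otimes>\<^bsub>Mat\<^esub> E b i j) (k, l) = (if l = j then X (k, i) \<otimes>\<^bsub>A\<^esub> b else \<zero>\<^bsub>A\<^esub>)"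
    unfolding mat_mult_entry[OF assms(5,6)]
    by (simp only:, subst M.finsum_delta) (use assms in auto)
  have "(\<Oplus>\<^bsub>A\<^esub>m\<in>{..<r}. E b i j (k, m) \<otimes>\<^bsub>A\<^esub> X (m, l)) =
      (\<Oplus>\<^bsub>A\<^esub>m\<in>{..<r}. if m = j then (if k = i then b \<otimes>\<^bsub>A\<^esub> X (j, l) else \<zero>\<^bsub>A\<^esub>) else \<zero>\<^bsub>A\<^esub>)"
    by (rule M.finsum_cong') (use assms in \<open>auto simp: E_entry\<close>)
  then show "(E b i j \<otimes>\<^bsub>Mat\<^esub> X) (k, l) = (if k = i then b \<otimes>\<^bsub>A\<^esub> X (j, l) else \<zero>\<^bsub>A\<^esub>)"
    unfolding mat_mult_entry[OF assms(5,6)]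
    by (simp only:, subst M.finsum_delta) (use assms in auto)
qed

lemma E_mult_E:
  assumes "a \<in> carrier A" "b \<in> carrier A" "i < r" "j < r" "k < r" "l < r"
  shows "E a i j \<otimes>\<^bsub>Mat\<^esub> E b k l = (if j = k then E (a \<otimes>\<^bsub>A\<^esub> b) i l else \<zero>\<^bsub>Mat\<^esub>)"
  by (rule mat_eqI) (use assms in \<open>auto simp: mult_E_entry E_entry mat_zero_entry intro: mat_ops_closed\<close>)

text \<open>By induction on a set of positions outside of which the matrix vanishes.\<close>

lemma mat_induct [consumes 1, case_names unit add]:
  assumes X: "X \<in> carrier Mat"
    and unit: "\<And>a i j. \<lbrakk>a \<in> carrier A; i < r; j < r\<rbrakk> \<Longrightarrow> P (E a i j)"
    and add: "\<And>X Y. \<lbrakk>X \<in> carrier Mat; Y \<in> carrier Mat; P X; P Y\<rbrakk> \<Longrightarrow> P (X \<oplus>\<^bsub>Mat\<^esub> Y)"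
  shows "P X"
proof -
  have "\<forall>X\<in>carrier Mat. (\<forall>p\<in>I - F. X p = \<zero>\<^bsub>A\<^esub>) \<longrightarrow> P X" if "finite F" "F \<subseteq> I" for F
    using that
  proof (induction F rule: finite_induct)
    case empty
    have "X = E \<zero>\<^bsub>A\<^esub> 0 0" if "X \<in> carrier Mat" "\<forall>p\<in>I. X p = \<zero>\<^bsub>A\<^esub>" for X
      by (rule mat_eqI) (use that in \<open>auto simp: E_entry\<close>)
    then show ?case using unit[of "\<zero>\<^bsub>A\<^esub>" 0 0] r_pos by auto
  next
    case (insert p F)
    obtain i j where p: "p = (i, j)" "i < r" "j < r" using insert.prems by (cases p) auto
    show ?case
    proof (intro ballI impI)
      fix X assume X: "X \<in> carrier Mat" "\<forall>q\<in>I - insert p F. X q = \<zero>\<^bsub>A\<^esub>"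
      let ?Y = "\<lambda>q\<in>I. if q = p then \<zero>\<^bsub>A\<^esub> else X q"
      note [simp] = mat_entry_closed[OF X(1)]
      have Y: "?Y \<in> carrier Mat" using X(1) by (auto simp: mat_algebra_simps PiE_def Pi_def)
      have "P ?Y" using insert Y X(2) by auto
      moreover have "P (E (X p) i j)" using X p by (intro unit) auto
      moreover have "X = E (X p) i j \<oplus>\<^bsub>Mat\<^esub> ?Y"
        by (rule mat_eqI) (use X Y p in \<open>auto simp: mat_entries E_entry intro!: mat_ops_closed\<close>)
      moreover have "E (X p) i j \<in> carrier Mat" using X p by auto
      ultimately show "P X" using add[of "E (X p) i j" ?Y] Y by simp
    qed
  qed
  from this[of I] show ?thesis using X by auto
qed

end

section \<open>Morita invariance of homology\<close>

context matrices
begin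

abbreviation MC :: "nat \<Rightarrow> ('k, ((nat \<times> nat \<Rightarrow> 'a) list \<Rightarrow> 'k) set) module" where
  "MC n \<equiv> hoch_chains K Mat n"

lemma mat_chain0_in_submodule:
  assumes N: "module K N" "submodule H K N" and f: "linear_map K (MC 0) N f"
    and E: "\<And>a i j. \<lbrakk>a \<in> carrier A; i < r; j < r\<rbrakk> \<Longrightarrow> f (Mat.T0 (E a i j)) \<in> H"
    and z: "z \<in> carrier (MC 0)"
  shows "f z \<in> H"
proof (rule Mat.chain0_in_submodule[OF N f _ z])
  interpret N: module K N by fact
  note H = N.submoduleE(5)[OF N(2)]
  fix X assume "X \<in> carrier Mat"
  then show "f (Mat.T0 X) \<in> H"
    by (induction rule: mat_induct) (simp_all add: E Mat.T0_linear linear_map_add[OF f] H)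
qed

lemma mat_chain1_in_submodule:
  assumes N: "module K N" "submodule H K N" and f: "linear_map K (MC (Suc 0)) N f"
    and E: "\<And>a i j b k l. \<lbrakk>a \<in> carrier A; i < r; j < r; b \<in> carrier A; k < r; l < r\<rbrakk> \<Longrightarrow>
      f (Mat.T1 (E a i j) (E b k l)) \<in> H"
    and z: "z \<in> carrier (MC (Suc 0))"
  shows "f z \<in> H"
proof (rule Mat.chain1_in_submodule[OF N f _ z])
  interpret N: module K N by fact
  note H = N.submoduleE(5)[OF N(2)]
  fix X Y assume X: "X \<in> carrier Mat" and Y: "Y \<in> carrier Mat"
  have "f (Mat.T1 (E a i j) Y) \<in> H" if "a \<in> carrier A" "i < r" "j < r" for a i j
    using Y that by (induction rule: mat_induct) (simp_all add: E Mat.T1_linear linear_map_add[OF f] H)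
  note unit = this
  show "f (Mat.T1 X Y) \<in> H"
    using X Y by (induction rule: mat_induct) (simp_all add: unit Mat.T1_linear linear_map_add[OF f] H)
qed

lemma mat_chain2_in_submodule:
  assumes N: "module K N" "submodule H K N" and f: "linear_map K (MC (Suc (Suc 0))) N f"
    and E: "\<And>a i j b k l c m n. \<lbrakk>a \<in> carrier A; i < r; j < r; b \<in> carrier A; k < r; l < r;
        c \<in> carrier A; m < r; n < r\<rbrakk> \<Longrightarrow> f (Mat.T2 (E a i j) (E b k l) (E c m n)) \<in> H"
    and z: "z \<in> carrier (MC (Suc (Suc 0)))"
  shows "f z \<in> H"
proof (rule Mat.chain2_in_submodule[OF N f _ z])
  interpret N: module K N by fact
  note H = N.submoduleE(5)[OF N(2)]
  fix X Y Z assume X: "X \<in> carrier Mat" and Y: "Y \<in> carrier Mat" and Z: "Z \<in> carrier Mat"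
  have "f (Mat.T2 (E a i j) (E b k l) Z) \<in> H"
    if "a \<in> carrier A" "i < r" "j < r" "b \<in> carrier A" "k < r" "l < r" for a i j b k l
    using Z that by (induction rule: mat_induct) (simp_all add: E Mat.T2_linear linear_map_add[OF f] H)
  note unit2 = this
  have "f (Mat.T2 (E a i j) Y Z) \<in> H" if "a \<in> carrier A" "i < r" "j < r" for a i j
    using Y Z that by (induction rule: mat_induct) (simp_all add: unit2 Mat.T2_linear linear_map_add[OF f] H)
  note unit1 = this
  show "f (Mat.T2 X Y Z) \<in> H"
    using X Y Z by (induction rule: mat_induct) (simp_all add: unit1 Mat.T2_linear linear_map_add[OF f] H)
qed

text \<open>The corner inclusion and the trace on chains, and the part \<open>M \<mapsto> \<Sum>\<^sub>l M e\<^sub>l\<^sub>0 \<otimes> e\<^sub>0\<^sub>l\<close> of the homotopy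
  that is defined in degree zero. In degree one, the values of the homotopy on
  generators suffice, see \<open>inc_tr_homotopy1\<close>.\<close>

definition inc0 where "inc0 = tensor_lift K (MC 0) (\<lambda>as. Mat.T0 (E (as ! 0) 0 0))"
definition inc1 where "inc1 = tensor_lift K (MC (Suc 0)) (\<lambda>as. Mat.T1 (E (as ! 0) 0 0) (E (as ! Suc 0) 0 0))"
definition tr0 where "tr0 = tensor_lift K (C 0) (\<lambda>as. \<Oplus>\<^bsub>C 0\<^esub>i\<in>{..<r}. T0 ((as ! 0) (i, i)))"
definition tr1 where
  "tr1 = tensor_lift K (C (Suc 0)) (\<lambda>as. \<Oplus>\<^bsub>C (Suc 0)\<^esub>p\<in>I. T1 ((as ! 0) p) ((as ! Suc 0) (prod.swap p)))"
definition homotopy0 where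
  "homotopy0 = tensor_lift K (MC (Suc 0)) (\<lambda>as. \<Oplus>\<^bsub>MC (Suc 0)\<^esub>l\<in>{..<r}.
     Mat.T1 (as ! 0 \<otimes>\<^bsub>Mat\<^esub> E \<one>\<^bsub>A\<^esub> l 0) (E \<one>\<^bsub>A\<^esub> 0 l))"

lemma inc0:
  shows inc0_linear: "linear_map K (C 0) (MC 0) inc0"
    and inc0_T0: "a \<in> carrier A \<Longrightarrow> inc0 (T0 a) = Mat.T0 (E a 0 0)"
proof -
  have ml: "multilinear K A 0 (MC 0) (\<lambda>as. Mat.T0 (E (as ! 0) 0 0))"
    by (rule multilinear0I) (auto simp: E_linear Mat.T0_linear)
  show "linear_map K (C 0) (MC 0) inc0" "a \<in> carrier A \<Longrightarrow> inc0 (T0 a) = Mat.T0 (E a 0 0)"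
    using tensor_lift[OF Mat.chains_module ml] by (auto simp: inc0_def)
qed

lemma inc1:
  shows inc1_linear: "linear_map K (C (Suc 0)) (MC (Suc 0)) inc1"
    and inc1_T1: "\<lbrakk>a \<in> carrier A; b \<in> carrier A\<rbrakk> \<Longrightarrow> inc1 (T1 a b) = Mat.T1 (E a 0 0) (E b 0 0)"
proof -
  have ml: "multilinear K A (Suc 0) (MC (Suc 0)) (\<lambda>as. Mat.T1 (E (as ! 0) 0 0) (E (as ! Suc 0) 0 0))"
    by (rule multilinear1I) (auto simp: E_linear Mat.T1_linear)
  show "linear_map K (C (Suc 0)) (MC (Suc 0)) inc1"
    "\<lbrakk>a \<in> carrier A; b \<in> carrier A\<rbrakk> \<Longrightarrow> inc1 (T1 a b) = Mat.T1 (E a 0 0) (E b 0 0)"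
    using tensor_lift[OF Mat.chains_module ml] by (auto simp: inc1_def)
qed

lemma tr0:
  shows tr0_linear: "linear_map K (MC 0) (C 0) tr0"
    and tr0_E: "\<lbrakk>a \<in> carrier A; i < r; j < r\<rbrakk> \<Longrightarrow>
      tr0 (Mat.T0 (E a i j)) = (if i = j then T0 a else \<zero>\<^bsub>C 0\<^esub>)"
proof -
  let ?g = "\<lambda>as. \<Oplus>\<^bsub>C 0\<^esub>i\<in>{..<r}. T0 ((as ! 0) (i, i))"
  have ml: "multilinear K Mat 0 (C 0) ?g"
  proof (rule Mat.multilinear0I, goal_cases)
    case (1 X)
    note [simp] = mat_entry_closed[OF 1]
    show ?case by (auto intro!: C.finsum_closed)
  next
    case (2 X Y)
    note [simp] = mat_entry_closed[OF 2(1)] mat_entry_closed[OF 2(2)]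
    have "?g [X \<oplus>\<^bsub>Mat\<^esub> Y] = (\<Oplus>\<^bsub>C 0\<^esub>i\<in>{..<r}. T0 (X (i, i)) \<oplus>\<^bsub>C 0\<^esub> T0 (Y (i, i)))"
      by (rule C.finsum_cong') (auto simp: mat_add_entry T0_linear)
    also have "\<dots> = ?g [X] \<oplus>\<^bsub>C 0\<^esub> ?g [Y]" by (subst C.finsum_addf) auto
    finally show ?case .
  next
    case (3 k X)
    note [simp] = mat_entry_closed[OF 3(2)]
    have "?g [k \<odot>\<^bsub>Mat\<^esub> X] = (\<Oplus>\<^bsub>C 0\<^esub>i\<in>{..<r}. k \<odot>\<^bsub>C 0\<^esub> T0 (X (i, i)))"
      by (rule C.finsum_cong') (use 3 in \<open>auto simp: mat_smult_entry T0_linear\<close>)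
    also have "\<dots> = k \<odot>\<^bsub>C 0\<^esub> ?g [X]" by (subst C.finsum_smult_ldistr) (use 3 in auto)
    finally show ?case .
  qed
  show "linear_map K (MC 0) (C 0) tr0"
    unfolding tr0_def by (rule Mat.tensor_lift_linear[OF chains_module ml])
  show "tr0 (Mat.T0 (E a i j)) = (if i = j then T0 a else \<zero>\<^bsub>C 0\<^esub>)"
    if "a \<in> carrier A" "i < r" "j < r"
  proof -
    have "tr0 (Mat.T0 (E a i j)) = ?g [E a i j]"
      unfolding tr0_def by (rule Mat.tensor_lift_tensor[OF chains_module ml]) (use that in auto)
    also have "\<dots> = (\<Oplus>\<^bsub>C 0\<^esub>l\<in>{..<r}. if l = i then (if i = j then T0 a else \<zero>\<^bsub>C 0\<^esub>) else \<zero>\<^bsub>C 0\<^esub>)"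
      by (rule C.finsum_cong') (use that in \<open>auto simp: E_entry T_zero del: equalityI subsetI\<close>)
    also have "\<dots> = (if i = j then T0 a else \<zero>\<^bsub>C 0\<^esub>)" by (subst C.finsum_delta) (use that in auto)
    finally show ?thesis .
  qed
qed

lemma tr1:
  shows tr1_linear: "linear_map K (MC (Suc 0)) (C (Suc 0)) tr1"
    and tr1_E: "\<lbrakk>a \<in> carrier A; i < r; j < r; b \<in> carrier A; k < r; l < r\<rbrakk> \<Longrightarrow>
      tr1 (Mat.T1 (E a i j) (E b k l)) = (if j = k \<and> i = l then T1 a b else \<zero>\<^bsub>C (Suc 0)\<^esub>)"
proof -
  let ?C = "C (Suc 0)"
  let ?t = "\<lambda>X Y. \<Oplus>\<^bsub>?C\<^esub>p\<in>I. T1 (X p) (Y (prod.swap p))"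
  let ?g = "\<lambda>as. ?t (as ! 0) (as ! Suc 0)"
  have add: "?t X' Y' = ?t X1 Y1 \<oplus>\<^bsub>?C\<^esub> ?t X2 Y2"
    if "X1 \<in> carrier Mat" "X2 \<in> carrier Mat" "Y1 \<in> carrier Mat" "Y2 \<in> carrier Mat"
      "\<And>i j. \<lbrakk>i < r; j < r\<rbrakk> \<Longrightarrow> T1 (X' (i, j)) (Y' (j, i)) = T1 (X1 (i, j)) (Y1 (j, i)) \<oplus>\<^bsub>?C\<^esub> T1 (X2 (i, j)) (Y2 (j, i))"
    for X' Y' X1 X2 Y1 Y2
  proof -
    note [simp] = that(1-4)[THEN mat_entry_closed]
    have "?t X' Y' = (\<Oplus>\<^bsub>?C\<^esub>p\<in>I. T1 (X1 p) (Y1 (prod.swap p)) \<oplus>\<^bsub>?C\<^esub> T1 (X2 p) (Y2 (prod.swap p)))"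
      by (rule C.finsum_cong') (auto simp: that(5))
    also have "\<dots> = ?t X1 Y1 \<oplus>\<^bsub>?C\<^esub> ?t X2 Y2" by (subst C.finsum_addf) auto
    finally show ?thesis .
  qed
  have smult: "?t X' Y' = c \<odot>\<^bsub>?C\<^esub> ?t X Y"
    if "X \<in> carrier Mat" "Y \<in> carrier Mat" "c \<in> carrier K"
      "\<And>i j. \<lbrakk>i < r; j < r\<rbrakk> \<Longrightarrow> T1 (X' (i, j)) (Y' (j, i)) = c \<odot>\<^bsub>?C\<^esub> T1 (X (i, j)) (Y (j, i))"
    for X' Y' X Y c
  proof -
    note [simp] = that(1,2)[THEN mat_entry_closed]
    have "?t X' Y' = (\<Oplus>\<^bsub>?C\<^esub>p\<in>I. c \<odot>\<^bsub>?C\<^esub> T1 (X p) (Y (prod.swap p)))"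
      by (rule C.finsum_cong') (auto simp: that(3,4))
    also have "\<dots> = c \<odot>\<^bsub>?C\<^esub> ?t X Y" by (subst C.finsum_smult_ldistr) (use that(3) in auto)
    finally show ?thesis .
  qed
  have ml: "multilinear K Mat (Suc 0) ?C ?g"
  proof (rule Mat.multilinear1I, goal_cases)
    case (1 X Y)
    note [simp] = 1[THEN mat_entry_closed]
    show ?case by (auto intro!: C.finsum_closed)
  next
    case (2 X X' Y)
    note [simp] = 2[THEN mat_entry_closed]
    show ?case using 2 add[of X X' Y Y "X \<oplus>\<^bsub>Mat\<^esub> X'" Y] by (simp add: mat_add_entry T1_linear)
  next
    case (3 X X' Y)
    note [simp] = 3[THEN mat_entry_closed]
    show ?case using 3 add[of Y Y X X' Y "X \<oplus>\<^bsub>Mat\<^esub> X'"] by (simp add: mat_add_entry T1_linear)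
  next
    case (4 c X Y)
    note [simp] = 4(2,3)[THEN mat_entry_closed]
    show ?case using 4 smult[of X Y c "c \<odot>\<^bsub>Mat\<^esub> X" Y] by (simp add: mat_smult_entry T1_linear)
  next
    case (5 c X Y)
    note [simp] = 5(2,3)[THEN mat_entry_closed]
    show ?case using 5 smult[of Y X c Y "c \<odot>\<^bsub>Mat\<^esub> X"] by (simp add: mat_smult_entry T1_linear)
  qed
  show "linear_map K (MC (Suc 0)) ?C tr1"
    unfolding tr1_def by (rule Mat.tensor_lift_linear[OF chains_module ml])
  show "tr1 (Mat.T1 (E a i j) (E b k l)) = (if j = k \<and> i = l then T1 a b else \<zero>\<^bsub>?C\<^esub>)"
    if "a \<in> carrier A" "i < r" "j < r" "b \<in> carrier A" "k < r" "l < r"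
  proof -
    have "tr1 (Mat.T1 (E a i j) (E b k l)) = ?g [E a i j, E b k l]"
      unfolding tr1_def by (rule Mat.tensor_lift_tensor[OF chains_module ml]) (use that in auto)
    also have "\<dots> = (\<Oplus>\<^bsub>?C\<^esub>p\<in>I. if p = (i, j) then (if j = k \<and> i = l then T1 a b else \<zero>\<^bsub>?C\<^esub>) else \<zero>\<^bsub>?C\<^esub>)"
    proof (rule C.finsum_cong')
      fix p assume "p \<in> I"
      then obtain m n where p: "p = (m, n)" "m < r" "n < r" by auto
      show "T1 (([E a i j, E b k l] ! 0) p) (([E a i j, E b k l] ! Suc 0) (prod.swap p)) =
          (if p = (i, j) then (if j = k \<and> i = l then T1 a b else \<zero>\<^bsub>?C\<^esub>) else \<zero>\<^bsub>?C\<^esub>)"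
        by (cases "m = i \<and> n = j") (use that p in \<open>auto simp: E_entry T_zero del: equalityI\<close>)
    qed (use that in auto)
    also have "\<dots> = (if j = k \<and> i = l then T1 a b else \<zero>\<^bsub>?C\<^esub>)" by (subst C.finsum_delta) (use that in auto)
    finally show ?thesis .
  qed
qed

lemma homotopy0:
  shows homotopy0_linear: "linear_map K (MC 0) (MC (Suc 0)) homotopy0"
    and homotopy0_E: "\<lbrakk>a \<in> carrier A; i < r; j < r\<rbrakk> \<Longrightarrow>
      homotopy0 (Mat.T0 (E a i j)) = Mat.T1 (E a i 0) (E \<one>\<^bsub>A\<^esub> 0 j)"
proof -
  let ?C = "MC (Suc 0)"
  let ?s = "\<lambda>X l. Mat.T1 (X \<otimes>\<^bsub>Mat\<^esub> E \<one>\<^bsub>A\<^esub> l 0) (E \<one>\<^bsub>A\<^esub> 0 l)"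
  let ?g = "\<lambda>as. \<Oplus>\<^bsub>?C\<^esub>l\<in>{..<r}. ?s (as ! 0) l"
  have ml: "multilinear K Mat 0 ?C ?g"
  proof (rule Mat.multilinear0I, goal_cases)
    case (1 X)
    then show ?case by (auto intro!: Mat.C.finsum_closed)
  next
    case (2 X Y)
    have "?g [X \<oplus>\<^bsub>Mat\<^esub> Y] = (\<Oplus>\<^bsub>?C\<^esub>l\<in>{..<r}. ?s X l \<oplus>\<^bsub>?C\<^esub> ?s Y l)"
      by (rule Mat.C.finsum_cong') (use 2 in \<open>auto simp: Mat.A.l_distr Mat.T1_linear\<close>)
    also have "\<dots> = ?g [X] \<oplus>\<^bsub>?C\<^esub> ?g [Y]" by (subst Mat.C.finsum_addf) (use 2 in auto)
    finally show ?case .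
  next
    case (3 k X)
    have "?g [k \<odot>\<^bsub>Mat\<^esub> X] = (\<Oplus>\<^bsub>?C\<^esub>l\<in>{..<r}. k \<odot>\<^bsub>?C\<^esub> ?s X l)"
      by (rule Mat.C.finsum_cong') (use 3 in \<open>auto simp: Mat.smult_mult_left[symmetric] Mat.T1_linear\<close>)
    also have "\<dots> = k \<odot>\<^bsub>?C\<^esub> ?g [X]" by (subst Mat.C.finsum_smult_ldistr) (use 3 in auto)
    finally show ?case .
  qed
  show "linear_map K (MC 0) ?C homotopy0"
    unfolding homotopy0_def by (rule Mat.tensor_lift_linear[OF Mat.chains_module ml])
  show "homotopy0 (Mat.T0 (E a i j)) = Mat.T1 (E a i 0) (E \<one>\<^bsub>A\<^esub> 0 j)"
    if "a \<in> carrier A" "i < r" "j < r"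
  proof -
    have "homotopy0 (Mat.T0 (E a i j)) = ?g [E a i j]"
      unfolding homotopy0_def by (rule Mat.tensor_lift_tensor[OF Mat.chains_module ml]) (use that in auto)
    also have "\<dots> = (\<Oplus>\<^bsub>?C\<^esub>l\<in>{..<r}. if l = j then Mat.T1 (E a i 0) (E \<one>\<^bsub>A\<^esub> 0 j) else \<zero>\<^bsub>?C\<^esub>)"
      by (rule Mat.C.finsum_cong') (use that r_pos in \<open>auto simp: E_mult_E Mat.T_zero\<close>)
    also have "\<dots> = Mat.T1 (E a i 0) (E \<one>\<^bsub>A\<^esub> 0 j)" by (subst Mat.C.finsum_delta) (use that in auto)
    finally show ?thesis .
  qed
qed

lemma maps_closed [simp]:
  "z \<in> carrier (C 0) \<Longrightarrow> inc0 z \<in> carrier (MC 0)"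
  "z \<in> carrier (C (Suc 0)) \<Longrightarrow> inc1 z \<in> carrier (MC (Suc 0))"
  "x \<in> carrier (MC 0) \<Longrightarrow> tr0 x \<in> carrier (C 0)"
  "x \<in> carrier (MC (Suc 0)) \<Longrightarrow> tr1 x \<in> carrier (C (Suc 0))"
  "x \<in> carrier (MC 0) \<Longrightarrow> homotopy0 x \<in> carrier (MC (Suc 0))"
  by (simp_all add: linear_map_closed[OF inc0_linear] linear_map_closed[OF inc1_linear]
      linear_map_closed[OF tr0_linear] linear_map_closed[OF tr1_linear] linear_map_closed[OF homotopy0_linear])

lemmas maps_zero =
  linear_map_zero[OF chains_module Mat.chains_module inc0_linear]
  linear_map_zero[OF chains_module Mat.chains_module inc1_linear]
  linear_map_zero[OF Mat.chains_module chains_module tr0_linear]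
  linear_map_zero[OF Mat.chains_module chains_module tr1_linear]
  linear_map_zero[OF Mat.chains_module Mat.chains_module homotopy0_linear]

lemmas maps_add = linear_map_add[OF inc0_linear] linear_map_add[OF inc1_linear]
  linear_map_add[OF tr0_linear] linear_map_add[OF tr1_linear] linear_map_add[OF homotopy0_linear]

lemmas maps_diff =
  linear_map_diff[OF chains_module Mat.chains_module inc0_linear]
  linear_map_diff[OF chains_module Mat.chains_module inc1_linear]
  linear_map_diff[OF Mat.chains_module chains_module tr0_linear]
  linear_map_diff[OF Mat.chains_module chains_module tr1_linear]
  linear_map_diff[OF Mat.chains_module Mat.chains_module homotopy0_linear]

lemma tr_inc:
  shows "z \<in> carrier (C 0) \<Longrightarrow> tr0 (inc0 z) = z"
    and "z \<in> carrier (C (Suc 0)) \<Longrightarrow> tr1 (inc1 z) = z"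
proof -
  show "tr0 (inc0 z) = z" if "z \<in> carrier (C 0)"
    by (rule chain0_map_eqI[OF chains_module linear_map_comp[OF tr0_linear inc0_linear] linear_map_id _ that])
      (simp add: inc0_T0 tr0_E r_pos)
  show "tr1 (inc1 z) = z" if "z \<in> carrier (C (Suc 0))"
    by (rule chain1_map_eqI[OF chains_module linear_map_comp[OF tr1_linear inc1_linear] linear_map_id _ that])
      (simp add: inc1_T1 tr1_E r_pos)
qed

lemma d1_inc1: "z \<in> carrier (C (Suc 0)) \<Longrightarrow> Mat.d1 (inc1 z) = inc0 (d1 z)"
  by (rule chain1_map_eqI[OF Mat.chains_module linear_map_comp[OF Mat.d1_linear inc1_linear]
        linear_map_comp[OF inc0_linear d1_linear]])
    (simp_all add: inc1_T1 inc0_T0 d1_T1 Mat.d1_T1 E_mult_E r_pos maps_diff)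

lemma inc1_B1: "w \<in> B1 \<Longrightarrow> inc1 w \<in> Mat.B1"
proof -
  have "inc1 (d2 (T2 a b c)) \<in> Mat.B1" if "a \<in> carrier A" "b \<in> carrier A" "c \<in> carrier A" for a b c
  proof -
    have "inc1 (d2 (T2 a b c)) = Mat.d2 (Mat.T2 (E a 0 0) (E b 0 0) (E c 0 0))"
      using that by (simp add: d2_T2 Mat.d2_T2 inc1_T1 maps_diff maps_add E_mult_E r_pos)
    then show ?thesis using that by (auto intro: Mat.d2_in_B1)
  qed
  then show "w \<in> B1 \<Longrightarrow> inc1 w \<in> Mat.B1"
    using chain2_in_submodule[OF Mat.chains_module Mat.B1_submodule linear_map_comp[OF inc1_linear d2_linear]]
    by (auto simp: B1_def)
qed

lemma d1_tr1:
  assumes "x \<in> carrier (MC (Suc 0))" shows "d1 (tr1 x) = tr0 (Mat.d1 x)"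
proof -
  have "d1 (tr1 x) \<ominus>\<^bsub>C 0\<^esub> tr0 (Mat.d1 x) \<in> {\<zero>\<^bsub>C 0\<^esub>}"
  proof (rule mat_chain1_in_submodule[OF chains_module submodule_zero[OF chains_module]
        linear_map_difference[OF chains_module linear_map_comp[OF d1_linear tr1_linear]
          linear_map_comp[OF tr0_linear Mat.d1_linear]] _ assms], goal_cases)
    case (1 a i j b k l)
    then show ?case
      using linear_map_zero[OF chains_module chains_module d1_linear]
      by (auto simp: tr1_E Mat.d1_T1 d1_T1 maps_diff E_mult_E tr0_E Mat.T_zero maps_zero C.diff_self C.diff_zero)
  qed
  then show ?thesis using assms by (simp add: C.diff_eq_iff)
qed

text \<open>The trace of the boundary of \<open>a e\<^sub>i\<^sub>j \<otimes> b e\<^sub>k\<^sub>l \<otimes> c e\<^sub>m\<^sub>n\<close> is either zero or the boundary of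
  \<open>a \<otimes> b \<otimes> c\<close>: each of the three faces has a nonzero trace only if all pairs of adjacent indices,
  cyclically, agree.\<close>

lemma tr1_B1: "w \<in> Mat.B1 \<Longrightarrow> tr1 w \<in> B1"
proof -
  have z: "\<zero>\<^bsub>C (Suc 0)\<^esub> \<in> B1"
    using subgroup.one_closed[OF submodule.axioms(1)[OF B1_submodule]] by simp
  have "tr1 (Mat.d2 w) \<in> B1" if "w \<in> carrier (MC (Suc (Suc 0)))" for w
  proof (rule mat_chain2_in_submodule[OF chains_module B1_submodule
        linear_map_comp[OF tr1_linear Mat.d2_linear] _ that], goal_cases)
    case (1 a i j b k l c m n)
    have "tr1 (Mat.d2 (Mat.T2 (E a i j) (E b k l) (E c m n))) =
      (if j = k \<and> l = m \<and> n = i then d2 (T2 a b c) else \<zero>\<^bsub>C (Suc 0)\<^esub>)"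
      using 1 by (auto simp: Mat.d2_T2 d2_T2 maps_diff maps_add E_mult_E tr1_E Mat.T_zero maps_zero C.diff_self C.diff_zero)
    then show ?case using 1 z by (auto intro: d2_in_B1)
  qed
  then show "w \<in> Mat.B1 \<Longrightarrow> tr1 w \<in> B1" by (auto simp: Mat.B1_def)
qed

text \<open>The commutator of \<open>a e\<^sub>i\<^sub>0\<close> and \<open>e\<^sub>0\<^sub>j\<close> is \<open>a e\<^sub>i\<^sub>j\<close>, minus \<open>a e\<^sub>0\<^sub>0\<close> if \<open>i = j\<close>.\<close>

lemma inc_tr_homotopy0:
  assumes "x \<in> carrier (MC 0)"
  shows "x \<ominus>\<^bsub>MC 0\<^esub> inc0 (tr0 x) \<in> Mat.B0"
proof (rule mat_chain0_in_submodule[OF Mat.chains_module Mat.B0_submodule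
      linear_map_difference[OF Mat.chains_module linear_map_id linear_map_comp[OF inc0_linear tr0_linear]] _ assms])
  fix a i j assume a: "a \<in> carrier A" "i < r" "j < r"
  have "Mat.T0 (E a i j) \<ominus>\<^bsub>MC 0\<^esub> inc0 (tr0 (Mat.T0 (E a i j))) = Mat.d1 (Mat.T1 (E a i 0) (E \<one>\<^bsub>A\<^esub> 0 j))"
    using a r_pos by (simp add: tr0_E inc0_T0 maps_zero Mat.d1_T1 E_mult_E Mat.T_zero)
  then show "Mat.T0 (E a i j) \<ominus>\<^bsub>MC 0\<^esub> inc0 (tr0 (Mat.T0 (E a i j))) \<in> Mat.B0"
    using a by (auto intro: Mat.d1_in_B0)
qed

text \<open>The identity \<open>id - inc \<circ> tr = d h + h d\<close> in degree one, where \<open>h\<close> sends \<open>M \<otimes> N\<close> to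
  \<open>\<Sum>\<^sub>p M e\<^sub>p\<^sub>0 \<otimes> e\<^sub>0\<^sub>p \<otimes> N - \<Sum>\<^sub>p\<^sub>q M e\<^sub>p\<^sub>0 \<otimes> e\<^sub>0\<^sub>p N e\<^sub>q\<^sub>0 \<otimes> e\<^sub>0\<^sub>q\<close>. The chain \<open>?w\<close> in the proof is the value
  of \<open>h\<close> on a generator.\<close>

lemma inc_tr_homotopy1:
  assumes "x \<in> carrier (MC (Suc 0))"
  shows "(x \<ominus>\<^bsub>MC (Suc 0)\<^esub> inc1 (tr1 x)) \<ominus>\<^bsub>MC (Suc 0)\<^esub> homotopy0 (Mat.d1 x) \<in> Mat.B1"
proof (rule mat_chain1_in_submodule[OF Mat.chains_module Mat.B1_submodule
      linear_map_difference[OF Mat.chains_module linear_map_difference[OF Mat.chains_module linear_map_id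
        linear_map_comp[OF inc1_linear tr1_linear]] linear_map_comp[OF homotopy0_linear Mat.d1_linear]] _ assms])
  fix a i j b k l assume a: "a \<in> carrier A" "i < r" "j < r" "b \<in> carrier A" "k < r" "l < r"
  let ?x = "Mat.T1 (E a i j) (E b k l)"
  let ?w = "if j = k then Mat.T2 (E a i 0) (E \<one>\<^bsub>A\<^esub> 0 j) (E b k l)
      \<ominus>\<^bsub>MC (Suc (Suc 0))\<^esub> Mat.T2 (E a i 0) (E b 0 0) (E \<one>\<^bsub>A\<^esub> 0 l)
    else Mat.T2 (E a i 0) (E \<one>\<^bsub>A\<^esub> 0 j) (E b k l)"
  have "(?x \<ominus>\<^bsub>MC (Suc 0)\<^esub> inc1 (tr1 ?x)) \<ominus>\<^bsub>MC (Suc 0)\<^esub> homotopy0 (Mat.d1 ?x) = Mat.d2 ?w"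
    using a r_pos
    by (auto simp: tr1_E inc1_T1 maps_zero Mat.d1_T1 Mat.d2_T2 Mat.d2_simps E_mult_E Mat.T_zero homotopy0_E
        maps_diff Mat.C.diff_zero Mat.C.diff_self Mat.C.diff_simps Mat.C.a_ac)
  moreover have "?w \<in> carrier (MC (Suc (Suc 0)))" using a by auto
  ultimately show "(?x \<ominus>\<^bsub>MC (Suc 0)\<^esub> inc1 (tr1 ?x)) \<ominus>\<^bsub>MC (Suc 0)\<^esub> homotopy0 (Mat.d1 ?x) \<in> Mat.B1"
    by (simp only: Mat.d2_in_B1)
qed

text \<open>The trace gives injectivity and the homotopy surjectivity.\<close>

lemma H0_iso:
  "quot_map (MC 0) Mat.B0 inc0 \<in> module_iso K (hoch_homology K A 0) (hoch_homology K Mat 0)"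
  unfolding H0_eq Mat.H0_eq
proof (rule quot_map_iso[OF chains_module B0_submodule Mat.chains_module Mat.B0_submodule inc0_linear])
  fix x assume x: "x \<in> carrier (C 0)"
  show "inc0 x \<in> Mat.B0 \<longleftrightarrow> x \<in> B0"
  proof
    assume "inc0 x \<in> Mat.B0"
    then obtain w where w: "w \<in> carrier (MC (Suc 0))" "inc0 x = Mat.d1 w" by (auto simp: Mat.B0_def)
    then have "x = d1 (tr1 w)" using tr_inc(1)[OF x] d1_tr1[OF w(1)] by simp
    then show "x \<in> B0" using w by (simp add: d1_in_B0)
  next
    assume "x \<in> B0"
    then show "inc0 x \<in> Mat.B0" by (auto simp: B0_def d1_inc1[symmetric] intro!: Mat.d1_in_B0)
  qed
next
  fix y assume "y \<in> carrier (MC 0)"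
  then show "\<exists>x\<in>carrier (C 0). y \<ominus>\<^bsub>MC 0\<^esub> inc0 x \<in> Mat.B0"
    using inc_tr_homotopy0 by (intro bexI[of _ "tr0 y"]) auto
qed

lemma inc1_Z1: "z \<in> Z1 \<Longrightarrow> inc1 z \<in> Mat.Z1"
  by (auto simp: Z1_def Mat.Z1_def d1_inc1 maps_zero)

lemma inc1_linear_Z1: "linear_map K Z1_module Mat.Z1_module inc1"
  by (rule linear_map_restrict[OF inc1_linear Z1_subset inc1_Z1])

lemma H1_iso:
  "quot_map Mat.Z1_module Mat.B1 inc1 \<in> module_iso K (hoch_homology K A (Suc 0)) (hoch_homology K Mat (Suc 0))"
  unfolding H1_eq Mat.H1_eq
proof (rule quot_map_iso[OF Z1_module B1_submodule_Z1 Mat.Z1_module Mat.B1_submodule_Z1 inc1_linear_Z1])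
  fix x assume "x \<in> carrier Z1_module"
  then have x: "x \<in> carrier (C (Suc 0))" by (simp add: Z1_def)
  show "inc1 x \<in> Mat.B1 \<longleftrightarrow> x \<in> B1"
    using inc1_B1 tr1_B1[of "inc1 x"] tr_inc(2)[OF x] by auto
next
  fix y assume "y \<in> carrier Mat.Z1_module"
  then have y: "y \<in> carrier (MC (Suc 0))" "Mat.d1 y = \<zero>\<^bsub>MC 0\<^esub>" "y \<in> Mat.Z1" by (auto simp: Mat.Z1_def)
  have t: "tr1 y \<in> Z1" using y by (simp add: Z1_def d1_tr1 maps_zero)
  have "y \<ominus>\<^bsub>MC (Suc 0)\<^esub> inc1 (tr1 y) \<in> Mat.B1"
    using inc_tr_homotopy1[OF y(1)] y by (simp add: maps_zero Mat.C.diff_zero)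
  moreover have "y \<ominus>\<^bsub>Mat.Z1_module\<^esub> inc1 (tr1 y) = y \<ominus>\<^bsub>MC (Suc 0)\<^esub> inc1 (tr1 y)"
    using linear_map_diff[OF Mat.Z1_module Mat.chains_module[of "Suc 0"], of "\<lambda>x. x" y "inc1 (tr1 y)"]
      y t inc1_Z1[OF t] Mat.Z1_subset by (simp add: linear_map_def subset_iff)
  ultimately show "\<exists>x\<in>carrier Z1_module. y \<ominus>\<^bsub>Mat.Z1_module\<^esub> inc1 x \<in> Mat.B1"
    using t by (intro bexI[of _ "tr1 y"]) auto
qed

end

section \<open>Derivations of the algebra of matrices\<close>

context matrices
begin

lemma entry_linear: "i < r \<Longrightarrow> j < r \<Longrightarrow> linear_map K Mat A (\<lambda>X. X (i, j))"
  by (rule linear_mapI) (auto simp: mat_entries mat_entry_closed)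

lemma mat_diff_entry:
  assumes "X \<in> carrier Mat" "Y \<in> carrier Mat" "i < r" "j < r"
  shows "(X \<ominus>\<^bsub>Mat\<^esub> Y) (i, j) = X (i, j) \<ominus>\<^bsub>A\<^esub> Y (i, j)"
  by (rule linear_map_diff[OF Mat.module_axioms module_axioms entry_linear[OF assms(3,4)] assms(1,2)])

definition mat_der :: "('a \<Rightarrow> 'a) \<Rightarrow> (nat \<times> nat \<Rightarrow> 'a) \<Rightarrow> nat \<times> nat \<Rightarrow> 'a" where
  "mat_der D = (\<lambda>X\<in>carrier Mat. \<lambda>p\<in>I. D (X p))"

lemma mat_der_entry: "\<lbrakk>X \<in> carrier Mat; i < r; j < r\<rbrakk> \<Longrightarrow> mat_der D X (i, j) = D (X (i, j))"
  by (simp add: mat_der_def)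

lemma mat_der_closed:
  assumes "D \<in> derivations K A" "X \<in> carrier Mat" shows "mat_der D X \<in> carrier Mat"
  by (rule mat_closedI) (use assms mat_entry_closed[OF assms(2)] in
    \<open>auto simp: mat_der_entry derivation, simp add: mat_der_def\<close>)

lemma mat_der_E:
  assumes D: "D \<in> derivations K A" and a: "a \<in> carrier A"
  shows "mat_der D (E a i j) = E (D a) i j"
proof -
  have "D \<zero>\<^bsub>A\<^esub> = \<zero>\<^bsub>A\<^esub>"
    by (rule linear_map_zero[OF module_axioms module_axioms derivation_linear[OF D]])
  then show ?thesis
    by (intro mat_eqI mat_der_closed[OF D]) (use a in \<open>auto simp: mat_der_entry E_entry derivation[OF D]\<close>)
qed

lemma mat_der_derivation:
  assumes D: "D \<in> derivations K A" shows "mat_der D \<in> derivations K Mat"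
proof (rule Mat.derivationI)
  note cl = mat_der_closed[OF D]
  show "mat_der D \<in> extensional (carrier Mat)" by (simp add: mat_der_def)
  show "\<And>X. X \<in> carrier Mat \<Longrightarrow> mat_der D X \<in> carrier Mat" by (rule cl)
  fix X Y assume X: "X \<in> carrier Mat" and Y: "Y \<in> carrier Mat"
  note [simp] = X[THEN mat_entry_closed] Y[THEN mat_entry_closed]
  show "mat_der D (X \<oplus>\<^bsub>Mat\<^esub> Y) = mat_der D X \<oplus>\<^bsub>Mat\<^esub> mat_der D Y"
    by (rule mat_eqI) (use X Y cl in \<open>auto simp: mat_der_entry mat_entries derivation[OF D]\<close>)
  show "mat_der D (X \<otimes>\<^bsub>Mat\<^esub> Y) = mat_der D X \<otimes>\<^bsub>Mat\<^esub> Y \<oplus>\<^bsub>Mat\<^esub> X \<otimes>\<^bsub>Mat\<^esub> mat_der D Y"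
  proof (rule mat_eqI)
    fix i j assume ij: "i < r" "j < r"
    have "mat_der D (X \<otimes>\<^bsub>Mat\<^esub> Y) (i, j) = D (\<Oplus>\<^bsub>A\<^esub>l\<in>{..<r}. X (i, l) \<otimes>\<^bsub>A\<^esub> Y (l, j))"
      using X Y ij by (simp add: mat_der_entry mat_mult_entry)
    also have "\<dots> = (\<Oplus>\<^bsub>A\<^esub>l\<in>{..<r}. D (X (i, l) \<otimes>\<^bsub>A\<^esub> Y (l, j)))"
      by (rule linear_map_finsum[OF module_axioms module_axioms derivation_linear[OF D]]) (use ij in auto)
    also have "\<dots> = (\<Oplus>\<^bsub>A\<^esub>l\<in>{..<r}. mat_der D X (i, l) \<otimes>\<^bsub>A\<^esub> Y (l, j) \<oplus>\<^bsub>A\<^esub> X (i, l) \<otimes>\<^bsub>A\<^esub> mat_der D Y (l, j))"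
      by (rule M.finsum_cong') (use X Y ij in \<open>auto simp: mat_der_entry derivation[OF D]\<close>)
    also have "\<dots> = (mat_der D X \<otimes>\<^bsub>Mat\<^esub> Y \<oplus>\<^bsub>Mat\<^esub> X \<otimes>\<^bsub>Mat\<^esub> mat_der D Y) (i, j)"
      unfolding mat_mult_entry[OF ij] mat_add_entry[OF ij]
      by (rule M.finsum_addf) (use X Y ij in \<open>auto simp: mat_der_entry derivation[OF D]\<close>)
    finally show "mat_der D (X \<otimes>\<^bsub>Mat\<^esub> Y) (i, j) = (mat_der D X \<otimes>\<^bsub>Mat\<^esub> Y \<oplus>\<^bsub>Mat\<^esub> X \<otimes>\<^bsub>Mat\<^esub> mat_der D Y) (i, j)" .
  qed (use X Y cl in auto)
next
  fix c X assume c: "c \<in> carrier K" and X: "X \<in> carrier Mat"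
  note [simp] = X[THEN mat_entry_closed]
  show "mat_der D (c \<odot>\<^bsub>Mat\<^esub> X) = c \<odot>\<^bsub>Mat\<^esub> mat_der D X"
    by (rule mat_eqI) (use X c mat_der_closed[OF D] in \<open>auto simp: mat_der_entry mat_entries derivation[OF D]\<close>)
qed

text \<open>Derivations are additive, hence determined by their values on the additive generators.\<close>

lemma mat_derivation_eqI:
  assumes D: "D \<in> derivations K Mat" and D': "D' \<in> derivations K Mat"
    and E: "\<And>a i j. \<lbrakk>a \<in> carrier A; i < r; j < r\<rbrakk> \<Longrightarrow> D (E a i j) = D' (E a i j)"
  shows "D = D'"
proof (rule extensionalityI[OF Mat.derivation_ext[OF D] Mat.derivation_ext[OF D']])
  fix X assume "X \<in> carrier Mat"
  then show "D X = D' X"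
    by (induction rule: mat_induct) (simp_all add: E Mat.derivation_add[OF D] Mat.derivation_add[OF D'])
qed

lemma mat_der_linear: "linear_map K Der Mat.Der mat_der"
proof (rule linear_mapI)
  fix D assume "D \<in> carrier Der"
  then have D: "D \<in> derivations K A" by (simp add: Der_simps)
  then show "mat_der D \<in> carrier Mat.Der" by (simp add: Mat.Der_simps mat_der_derivation)
  note [simp] = mat_der_derivation[OF D]
  {
    fix D' assume "D' \<in> carrier Der"
    then have D': "D' \<in> derivations K A" by (simp add: Der_simps)
    note [simp] = mat_der_derivation[OF D']
    have DD: "D \<oplus>\<^bsub>Der\<^esub> D' \<in> derivations K A" using D D' Der.a_closed[of D D'] by (simp add: Der_simps)
    have MDD: "mat_der D \<oplus>\<^bsub>Mat.Der\<^esub> mat_der D' \<in> derivations K Mat"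
      using Mat.Der.a_closed[of "mat_der D" "mat_der D'"] by (simp add: Mat.Der_simps(1))
    show "mat_der (D \<oplus>\<^bsub>Der\<^esub> D') = mat_der D \<oplus>\<^bsub>Mat.Der\<^esub> mat_der D'"
      by (rule mat_derivation_eqI[OF mat_der_derivation[OF DD] MDD])
        (subst mat_der_E[OF DD], assumption, simp add: Mat.Der_simps(2) mat_der_E[OF D] mat_der_E[OF D'] Der_simps(2) E_linear
          derivation_closed[OF D] derivation_closed[OF D'])
  }
  fix c assume c: "c \<in> carrier K"
  have cD: "c \<odot>\<^bsub>Der\<^esub> D \<in> derivations K A" using c D Der.smult_closed[of c D] by (simp add: Der_simps)
  have McD: "c \<odot>\<^bsub>Mat.Der\<^esub> mat_der D \<in> derivations K Mat"
    using c Mat.Der.smult_closed[of c "mat_der D"] by (simp add: Mat.Der_simps(1))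
  show "mat_der (c \<odot>\<^bsub>Der\<^esub> D) = c \<odot>\<^bsub>Mat.Der\<^esub> mat_der D"
    by (rule mat_derivation_eqI[OF mat_der_derivation[OF cD] McD])
      (subst mat_der_E[OF cD], assumption, use c in \<open>simp add: Mat.Der_simps(3) mat_der_E[OF D] Der_simps(3) E_linear
        derivation_closed[OF D]\<close>)
qed

definition scalar :: "'a \<Rightarrow> nat \<times> nat \<Rightarrow> 'a" where
  "scalar a = (\<lambda>(i, j)\<in>I. if i = j then a else \<zero>\<^bsub>A\<^esub>)"

lemma scalar_closed: "a \<in> carrier A \<Longrightarrow> scalar a \<in> carrier Mat"
  by (rule mat_closedI) (auto simp: scalar_def)

lemma scalar_entry: "i < r \<Longrightarrow> j < r \<Longrightarrow> scalar a (i, j) = (if i = j then a else \<zero>\<^bsub>A\<^esub>)"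
  by (simp add: scalar_def)

lemma mat_der_inner:
  assumes a: "a \<in> carrier A" shows "mat_der (inner a) = Mat.inner (scalar a)"
proof (rule mat_derivation_eqI[OF mat_der_derivation[OF inner_derivation[OF a]]
      Mat.inner_derivation[OF scalar_closed[OF a]]])
  fix b i j assume b: "b \<in> carrier A" "i < r" "j < r"
  note s = scalar_closed[OF a]
  have "Mat.inner (scalar a) (E b i j) = E (a \<otimes>\<^bsub>A\<^esub> b \<ominus>\<^bsub>A\<^esub> b \<otimes>\<^bsub>A\<^esub> a) i j"
    by (rule mat_eqI) (use a b s in \<open>auto simp: mat_diff_entry mult_E_entry_left mult_E_entry_right
        scalar_entry E_entry M.diff_zero M.diff_self\<close>)
  then show "mat_der (inner a) (E b i j) = Mat.inner (scalar a) (E b i j)"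
    using a b by (simp add: mat_der_E[OF inner_derivation[OF a]])
qed

text \<open>Compare the entries at \<open>(0, 0)\<close> on matrices concentrated there.\<close>

lemma inner_of_mat_der_inner:
  assumes D: "D \<in> derivations K A" and U: "U \<in> carrier Mat" and eq: "mat_der D = Mat.inner U"
  shows "D = inner (U (0, 0))"
proof (rule restrict_eqI[OF derivation_ext[OF D]])
  fix x assume x: "x \<in> carrier A"
  have "D x = mat_der D (E x 0 0) (0, 0)" using x r_pos by (simp add: mat_der_E[OF D] E_entry)
  also have "\<dots> = U (0, 0) \<otimes>\<^bsub>A\<^esub> x \<ominus>\<^bsub>A\<^esub> x \<otimes>\<^bsub>A\<^esub> U (0, 0)"
    unfolding eq using x r_pos U by (simp add: mat_diff_entry mult_E_entry_left mult_E_entry_right)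
  finally show "D x = U (0, 0) \<otimes>\<^bsub>A\<^esub> x \<ominus>\<^bsub>A\<^esub> x \<otimes>\<^bsub>A\<^esub> U (0, 0)" .
qed

text \<open>The matrix \<open>U\<close> is \<open>\<Sum>\<^sub>i \<Delta>(e\<^sub>i\<^sub>0) e\<^sub>0\<^sub>i\<close>. The Leibniz rule for products of matrix units shows that \<open>ad U\<close>
  agrees with \<open>\<Delta>\<close> on all of them. The difference therefore commutes with multiplication by matrix
  units, so it acts on every entry in the same way as on the entry in the corner, which is \<open>D\<close>.\<close>

lemma mat_derivation_decomposition:
  assumes \<Delta>: "\<Delta> \<in> derivations K Mat"
  obtains D U where "D \<in> derivations K A" "U \<in> carrier Mat" "\<Delta> = Mat.inner U \<oplus>\<^bsub>Mat.Der\<^esub> mat_der D"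
proof -
  note d = Mat.derivation[OF \<Delta>]
  note ent = d(1)[THEN mat_entry_closed]
  define D where "D = (\<lambda>a\<in>carrier A. \<Delta> (E a 0 0) (0, 0))"
  define U where "U = (\<lambda>(k, i)\<in>I. \<Delta> (E \<one>\<^bsub>A\<^esub> i 0) (k, 0))"
  have Ue: "U (k, i) = \<Delta> (E \<one>\<^bsub>A\<^esub> i 0) (k, 0)" if "k < r" "i < r" for k i using that by (simp add: U_def)
  have U: "U \<in> carrier Mat"
    by (rule mat_closedI) (use ent r_pos in \<open>auto simp: Ue, simp add: U_def\<close>)
  have D: "D \<in> derivations K A"
  proof (rule derivationI)
    show "D \<in> extensional (carrier A)" by (simp add: D_def)
    show "\<And>x. x \<in> carrier A \<Longrightarrow> D x \<in> carrier A" using ent r_pos by (simp add: D_def)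
    fix x y assume x: "x \<in> carrier A" and y: "y \<in> carrier A"
    show "D (x \<oplus>\<^bsub>A\<^esub> y) = D x \<oplus>\<^bsub>A\<^esub> D y"
      using x y r_pos by (simp add: D_def E_linear d(2) mat_add_entry)
    have "\<Delta> (E (x \<otimes>\<^bsub>A\<^esub> y) 0 0) = \<Delta> (E x 0 0 \<otimes>\<^bsub>Mat\<^esub> E y 0 0)" using x y r_pos by (simp add: E_mult_E)
    then show "D (x \<otimes>\<^bsub>A\<^esub> y) = D x \<otimes>\<^bsub>A\<^esub> y \<oplus>\<^bsub>A\<^esub> x \<otimes>\<^bsub>A\<^esub> D y"
      using x y r_pos d(1) by (simp add: D_def d(4) mat_add_entry mult_E_entry_left mult_E_entry_right)
  next
    show "\<And>c x. \<lbrakk>c \<in> carrier K; x \<in> carrier A\<rbrakk> \<Longrightarrow> D (c \<odot>\<^bsub>A\<^esub> x) = c \<odot>\<^bsub>A\<^esub> D x"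
      using r_pos by (simp add: D_def E_linear d(3) mat_smult_entry)
  qed
  \<comment> \<open>A derivation sends an idempotent to an element without component in the corner that it cuts out.\<close>
  have e00: "\<Delta> (E \<one>\<^bsub>A\<^esub> 0 0) (0, 0) = \<zero>\<^bsub>A\<^esub>"
  proof -
    let ?e = "E \<one>\<^bsub>A\<^esub> 0 0"
    have "\<Delta> ?e = \<Delta> ?e \<otimes>\<^bsub>Mat\<^esub> ?e \<oplus>\<^bsub>Mat\<^esub> ?e \<otimes>\<^bsub>Mat\<^esub> \<Delta> ?e"
      using d(4)[of ?e ?e] r_pos by (simp add: E_mult_E)
    then have "\<Delta> ?e (0, 0) = (\<Delta> ?e \<otimes>\<^bsub>Mat\<^esub> ?e \<oplus>\<^bsub>Mat\<^esub> ?e \<otimes>\<^bsub>Mat\<^esub> \<Delta> ?e) (0, 0)"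
      by (rule arg_cong)
    also have "\<dots> = \<Delta> ?e (0, 0) \<oplus>\<^bsub>A\<^esub> \<Delta> ?e (0, 0)"
      using r_pos d(1) ent by (simp add: mat_add_entry mult_E_entry_left mult_E_entry_right)
    finally show ?thesis using ent r_pos M.self_eq_double_iff[of "\<Delta> ?e (0, 0)"] by simp
  qed
  \<comment> \<open>The first row of \<open>\<Delta>(e\<^sub>0\<^sub>j)\<close> follows from \<open>e\<^sub>0\<^sub>j e\<^sub>l\<^sub>0\<close> being \<open>e\<^sub>0\<^sub>0\<close> or zero.\<close>
  have row: "\<Delta> (E \<one>\<^bsub>A\<^esub> 0 j) (0, l) = \<ominus>\<^bsub>A\<^esub> U (j, l)" if jl: "j < r" "l < r" for j l
  proof -
    have "\<Delta> (E \<one>\<^bsub>A\<^esub> 0 j \<otimes>\<^bsub>Mat\<^esub> E \<one>\<^bsub>A\<^esub> l 0) (0, 0) = \<zero>\<^bsub>A\<^esub>"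
      using jl r_pos e00 linear_map_zero[OF Mat.module_axioms Mat.module_axioms Mat.derivation_linear[OF \<Delta>]]
      by (simp add: E_mult_E mat_zero_entry)
    then have "\<Delta> (E \<one>\<^bsub>A\<^esub> 0 j) (0, l) \<oplus>\<^bsub>A\<^esub> U (j, l) = \<zero>\<^bsub>A\<^esub>"
      using jl r_pos d(1) ent by (simp add: d(4) mat_add_entry mult_E_entry_left mult_E_entry_right Ue)
    then show ?thesis
      using M.minus_equality[of "\<Delta> (E \<one>\<^bsub>A\<^esub> 0 j) (0, l)" "U (j, l)"] ent[of "E \<one>\<^bsub>A\<^esub> 0 j" 0 l] r_pos jl
        mat_entry_closed[OF U] by simp
  qed
  have MD: "Mat.inner U \<oplus>\<^bsub>Mat.Der\<^esub> mat_der D \<in> derivations K Mat"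
    using Mat.Der.a_closed[of "Mat.inner U" "mat_der D"] Mat.inner_derivation[OF U] mat_der_derivation[OF D]
    by (simp add: Mat.Der_simps(1))
  have "\<Delta> = Mat.inner U \<oplus>\<^bsub>Mat.Der\<^esub> mat_der D"
  proof (rule mat_derivation_eqI[OF \<Delta> MD])
    fix a i j assume a: "a \<in> carrier A" "i < r" "j < r"
    have "\<Delta> (E a i j) = (\<Delta> (E \<one>\<^bsub>A\<^esub> i 0) \<otimes>\<^bsub>Mat\<^esub> E a 0 0 \<oplus>\<^bsub>Mat\<^esub> E \<one>\<^bsub>A\<^esub> i 0 \<otimes>\<^bsub>Mat\<^esub> \<Delta> (E a 0 0)) \<otimes>\<^bsub>Mat\<^esub> E \<one>\<^bsub>A\<^esub> 0 j
        \<oplus>\<^bsub>Mat\<^esub> E a i 0 \<otimes>\<^bsub>Mat\<^esub> \<Delta> (E \<one>\<^bsub>A\<^esub> 0 j)"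
      using a r_pos d(4)[of "E a i 0" "E \<one>\<^bsub>A\<^esub> 0 j"] d(4)[of "E \<one>\<^bsub>A\<^esub> i 0" "E a 0 0"]
      by (simp add: E_mult_E)
    moreover have "(Mat.inner U \<oplus>\<^bsub>Mat.Der\<^esub> mat_der D) (E a i j) =
        (U \<otimes>\<^bsub>Mat\<^esub> E a i j \<ominus>\<^bsub>Mat\<^esub> E a i j \<otimes>\<^bsub>Mat\<^esub> U) \<oplus>\<^bsub>Mat\<^esub> E (D a) i j"
      using a by (simp add: Mat.Der_simps(2) mat_der_E[OF D])
    moreover have "\<dots> = (\<Delta> (E \<one>\<^bsub>A\<^esub> i 0) \<otimes>\<^bsub>Mat\<^esub> E a 0 0 \<oplus>\<^bsub>Mat\<^esub> E \<one>\<^bsub>A\<^esub> i 0 \<otimes>\<^bsub>Mat\<^esub> \<Delta> (E a 0 0)) \<otimes>\<^bsub>Mat\<^esub> E \<one>\<^bsub>A\<^esub> 0 j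
        \<oplus>\<^bsub>Mat\<^esub> E a i 0 \<otimes>\<^bsub>Mat\<^esub> \<Delta> (E \<one>\<^bsub>A\<^esub> 0 j)"
    proof (rule mat_eqI)
      fix k l assume kl: "k < r" "l < r"
      note c = ent mat_entry_closed[OF U] derivation_closed[OF D]
      show "((U \<otimes>\<^bsub>Mat\<^esub> E a i j \<ominus>\<^bsub>Mat\<^esub> E a i j \<otimes>\<^bsub>Mat\<^esub> U) \<oplus>\<^bsub>Mat\<^esub> E (D a) i j) (k, l) =
        ((\<Delta> (E \<one>\<^bsub>A\<^esub> i 0) \<otimes>\<^bsub>Mat\<^esub> E a 0 0 \<oplus>\<^bsub>Mat\<^esub> E \<one>\<^bsub>A\<^esub> i 0 \<otimes>\<^bsub>Mat\<^esub> \<Delta> (E a 0 0)) \<otimes>\<^bsub>Mat\<^esub> E \<one>\<^bsub>A\<^esub> 0 j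
        \<oplus>\<^bsub>Mat\<^esub> E a i 0 \<otimes>\<^bsub>Mat\<^esub> \<Delta> (E \<one>\<^bsub>A\<^esub> 0 j)) (k, l)"
        using a kl r_pos U d(1) c
        by (simp add: mat_add_entry mat_diff_entry mult_E_entry_left mult_E_entry_right E_entry row
            Ue[symmetric] M.minus_eq A.r_minus)
          (auto simp: D_def M.a_ac)
    qed (use a U d(1) derivation_closed[OF D] in auto)
    ultimately show "\<Delta> (E a i j) = (Mat.inner U \<oplus>\<^bsub>Mat.Der\<^esub> mat_der D) (E a i j)" by simp
  qed
  with D U show thesis by (rule that)
qed

lemma outer_der_iso:
  "quot_map Mat.Der (inner_derivations Mat) mat_der \<in> module_iso K (outer_der K A) (outer_der K Mat)"
  unfolding outer_der_def
proof (rule quot_map_iso[OF Der_module inner_submodule Mat.Der_module Mat.inner_submodule mat_der_linear])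
  fix D assume "D \<in> carrier Der"
  then have D: "D \<in> derivations K A" by (simp add: Der_simps)
  show "mat_der D \<in> inner_derivations Mat \<longleftrightarrow> D \<in> inner_derivations A"
  proof
    assume "mat_der D \<in> inner_derivations Mat"
    then obtain U where "U \<in> carrier Mat" "mat_der D = Mat.inner U" by (auto simp: Mat.inner_derivations_eq)
    then show "D \<in> inner_derivations A"
      using inner_of_mat_der_inner[OF D] mat_entry_closed r_pos unfolding inner_derivations_eq by blast
  next
    assume "D \<in> inner_derivations A"
    then show "mat_der D \<in> inner_derivations Mat"
      using mat_der_inner scalar_closed unfolding inner_derivations_eq Mat.inner_derivations_eq by blast
  qed
next
  fix \<Delta> assume "\<Delta> \<in> carrier Mat.Der"
  then have "\<Delta> \<in> derivations K Mat" by (simp add: Mat.Der_simps(1))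
  then obtain D U where D: "D \<in> derivations K A" "U \<in> carrier Mat" "\<Delta> = Mat.inner U \<oplus>\<^bsub>Mat.Der\<^esub> mat_der D"
    by (rule mat_derivation_decomposition)
  have "\<Delta> \<ominus>\<^bsub>Mat.Der\<^esub> mat_der D = Mat.inner U"
  proof -
    have "mat_der D \<in> carrier Mat.Der" "Mat.inner U \<in> carrier Mat.Der"
      using mat_der_derivation[OF D(1)] Mat.inner_derivation[OF D(2)] by (simp_all add: Mat.Der_simps(1))
    then show ?thesis unfolding D(3) by (simp add: Mat.Der.diff_eq_iff)
  qed
  then show "\<exists>D\<in>carrier Der. \<Delta> \<ominus>\<^bsub>Mat.Der\<^esub> mat_der D \<in> inner_derivations Mat"
    using D by (intro bexI[of _ D]) (auto simp: Der_simps Mat.inner_derivations_eq)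
qed

end

section \<open>Compatibility of the calculus with the corner inclusion\<close>

context matrices
begin

lemma mat_der_commutator:
  assumes D: "D \<in> derivations K A" and D': "D' \<in> derivations K A"
  shows "mat_der (der_commutator A D D') = der_commutator Mat (mat_der D) (mat_der D')"
  by (rule mat_derivation_eqI[OF mat_der_derivation[OF commutator_derivation[OF D D']]
        Mat.commutator_derivation[OF mat_der_derivation[OF D] mat_der_derivation[OF D']]])
    (simp add: mat_der_E[OF commutator_derivation[OF D D']],
     simp add: der_commutator_def mat_der_E[OF D] mat_der_E[OF D'] E_diff derivation_closed[OF D] derivation_closed[OF D'])

lemma lie_chain_inc1:
  assumes D: "D \<in> derivations K A" and z: "z \<in> carrier (C (Suc 0))"
  shows "Mat.lie_chain (mat_der D) (inc1 z) = inc1 (lie_chain D z)"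
  by (rule chain1_map_eqI[OF Mat.chains_module linear_map_comp[OF Mat.lie_chain_linear[OF mat_der_derivation[OF D]] inc1_linear]
        linear_map_comp[OF inc1_linear lie_chain_linear[OF D]] _ z])
    (simp add: inc1_T1 lie_chain_T1[OF D] Mat.lie_chain_T1[OF mat_der_derivation[OF D]] mat_der_E[OF D] maps_add derivation_closed[OF D])

lemma interior_chain_inc1:
  assumes D: "D \<in> derivations K A" and z: "z \<in> carrier (C (Suc 0))"
  shows "Mat.interior_chain (mat_der D) (inc1 z) = inc0 (interior_chain D z)"
  by (rule chain1_map_eqI[OF Mat.chains_module linear_map_comp[OF Mat.interior_chain_linear[OF mat_der_derivation[OF D]] inc1_linear]
        linear_map_comp[OF inc0_linear interior_chain_linear[OF D]] _ z])
    (simp add: inc1_T1 inc0_T0 interior_chain_T1[OF D] Mat.interior_chain_T1[OF mat_der_derivation[OF D]] mat_der_E[OF D] E_mult_E r_pos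
      derivation_closed[OF D])

text \<open>The two sides evaluated at \<open>a\<close> differ only in their unit, which is \<open>e\<^sub>0\<^sub>0\<close> for the one and \<open>1\<close> for the
  other. The boundary of \<open>1 \<otimes> e\<^sub>0\<^sub>0 \<otimes> a e\<^sub>0\<^sub>0\<close> exchanges them, up to the degenerate tensor
  \<open>a e\<^sub>0\<^sub>0 \<otimes> 1\<close>.\<close>

lemma connes_chain_inc:
  assumes z: "z \<in> carrier (C 0)"
  shows "inc1 (connes_chain z) \<ominus>\<^bsub>MC (Suc 0)\<^esub> Mat.connes_chain (inc0 z) \<in> Mat.B1"
proof (rule chain0_in_submodule[OF Mat.chains_module Mat.B1_submodule
      linear_map_difference[OF Mat.chains_module linear_map_comp[OF inc1_linear connes_chain_linear]
        linear_map_comp[OF Mat.connes_chain_linear inc0_linear]] _ z])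
  fix a assume a: "a \<in> carrier A"
  let ?e = "E \<one>\<^bsub>A\<^esub> 0 0" and ?a = "E a 0 0"
  have "inc1 (connes_chain (T0 a)) \<ominus>\<^bsub>MC (Suc 0)\<^esub> Mat.connes_chain (inc0 (T0 a)) =
      Mat.d2 (Mat.T2 \<one>\<^bsub>Mat\<^esub> ?e ?a) \<oplus>\<^bsub>MC (Suc 0)\<^esub> \<ominus>\<^bsub>MC (Suc 0)\<^esub> Mat.T1 ?a \<one>\<^bsub>Mat\<^esub>"
    unfolding Mat.C.minus_eq[symmetric] using a r_pos
    by (simp add: connes_chain_T0 inc1_T1 inc0_T0 maps_add Mat.connes_chain_T0 Mat.d2_T2 E_mult_E
        Mat.C.diff_simps Mat.C.a_ac)
  moreover have "Mat.d2 (Mat.T2 \<one>\<^bsub>Mat\<^esub> ?e ?a) \<in> Mat.B1" using a by (auto intro: Mat.d2_in_B1)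
  moreover have "Mat.T1 ?a \<one>\<^bsub>Mat\<^esub> \<in> Mat.B1" using a by (auto intro: Mat.degenerate_in_B1)
  ultimately show "inc1 (connes_chain (T0 a)) \<ominus>\<^bsub>MC (Suc 0)\<^esub> Mat.connes_chain (inc0 (T0 a)) \<in> Mat.B1"
    using Mat.C.submoduleE(3,5)[OF Mat.B1_submodule] by simp
qed

definition courant_inc where
  "courant_inc = map_prod (quot_map Mat.Der (inner_derivations Mat) mat_der) (quot_map Mat.Z1_module Mat.B1 inc1)"

lemma courant_inc_iso: "courant_inc \<in> module_iso K (courant_module K A) (courant_module K Mat)"
  unfolding courant_inc_def courant_module_def One_nat_def by (rule prod_module_iso[OF outer_der_iso H1_iso])

lemma courant_inc_class:
  assumes D: "D \<in> derivations K A" and z: "z \<in> Z1"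
  shows "courant_inc (inner_derivations A +>\<^bsub>Der\<^esub> D, cl1 z) =
    (inner_derivations Mat +>\<^bsub>Mat.Der\<^esub> mat_der D, Mat.cl1 (inc1 z))"
proof -
  have "mat_der X \<in> inner_derivations Mat" if "X \<in> inner_derivations A" for X
    using that mat_der_inner scalar_closed unfolding inner_derivations_eq Mat.inner_derivations_eq by blast
  then show ?thesis
    using Out.quot_map_coset[OF Mat.Der_module Mat.inner_submodule mat_der_linear, of D]
      HZ.quot_map_coset[OF Mat.Z1_module Mat.B1_submodule_Z1 inc1_linear_Z1 inc1_B1, of z] D z
    by (simp add: courant_inc_def Der_simps cl1_restrict Mat.cl1_restrict)
qed

lemma courant_inc_bracket:
  assumes D: "D \<in> derivations K A" "D' \<in> derivations K A" and z: "z \<in> Z1" "z' \<in> Z1"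
  defines "e \<equiv> (inner_derivations A +>\<^bsub>Der\<^esub> D, cl1 z)" and "e' \<equiv> (inner_derivations A +>\<^bsub>Der\<^esub> D', cl1 z')"
  shows "courant_inc (courant_bracket K A e e') = courant_bracket K Mat (courant_inc e) (courant_inc e')"
proof -
  have zc: "z \<in> carrier (C (Suc 0))" "z' \<in> carrier (C (Suc 0))" using z Z1_subset by auto
  note cl = linear_map_closed[OF lie_chain_linear[OF D(1)] zc(2)] linear_map_closed[OF lie_chain_linear[OF D(2)] zc(1)]
    linear_map_closed[OF interior_chain_linear[OF D(2)] zc(1)]
  let ?l = "lie_chain D z' \<ominus>\<^bsub>C (Suc 0)\<^esub> lie_chain D' z" and ?i = "interior_chain D' z"
  have cc: "connes_chain ?i \<in> carrier (C (Suc 0))" "Mat.connes_chain (inc0 ?i) \<in> carrier (MC (Suc 0))"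
    using linear_map_closed[OF connes_chain_linear cl(3)] linear_map_closed[OF Mat.connes_chain_linear, of "inc0 ?i"] cl by auto
  have Z: "?l \<oplus>\<^bsub>C (Suc 0)\<^esub> connes_chain ?i \<in> Z1"
    using C.submoduleE(3,5)[OF Z1_submodule] lie_chain_Z1 D z connes_chain_Z1[OF cl(3)] unfolding C.minus_eq by simp
  have "Mat.cl1 (inc1 (?l \<oplus>\<^bsub>C (Suc 0)\<^esub> connes_chain ?i)) =
      Mat.cl1 (inc1 ?l \<oplus>\<^bsub>MC (Suc 0)\<^esub> Mat.connes_chain (inc0 ?i))"
  proof -
    have "(inc1 ?l \<oplus>\<^bsub>MC (Suc 0)\<^esub> inc1 (connes_chain ?i)) \<ominus>\<^bsub>MC (Suc 0)\<^esub> (inc1 ?l \<oplus>\<^bsub>MC (Suc 0)\<^esub> Mat.connes_chain (inc0 ?i)) =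
        inc1 (connes_chain ?i) \<ominus>\<^bsub>MC (Suc 0)\<^esub> Mat.connes_chain (inc0 ?i)"
      using cl cc by (simp add: Mat.C.diff_simps Mat.C.a_ac)
    then show ?thesis
      using cl cc connes_chain_inc[OF cl(3)] by (simp add: Mat.H1.coset_eq_iff maps_add)
  qed
  then show ?thesis
    unfolding e_def e'_def courant_bracket_class[OF D z]
    using cl by (simp add: courant_inc_class D z commutator_derivation Z inc1_Z1 mat_der_derivation
        Mat.courant_bracket_class mat_der_commutator lie_chain_inc1 interior_chain_inc1 zc maps_diff)
qed

lemma courant_inc_form:
  assumes D: "D \<in> derivations K A" "D' \<in> derivations K A" and z: "z \<in> Z1" "z' \<in> Z1"
  defines "e \<equiv> (inner_derivations A +>\<^bsub>Der\<^esub> D, cl1 z)" and "e' \<equiv> (inner_derivations A +>\<^bsub>Der\<^esub> D', cl1 z')"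
  shows "courant_form K Mat (courant_inc e) (courant_inc e') = quot_map (MC 0) Mat.B0 inc0 (courant_form K A e e')"
proof -
  have zc: "z \<in> carrier (C (Suc 0))" "z' \<in> carrier (C (Suc 0))" using z Z1_subset by auto
  note cl = linear_map_closed[OF interior_chain_linear[OF D(2)] zc(1)] linear_map_closed[OF interior_chain_linear[OF D(1)] zc(2)]
  have B: "\<And>w. w \<in> B0 \<Longrightarrow> inc0 w \<in> Mat.B0"
    by (auto simp: B0_def d1_inc1[symmetric] intro!: Mat.d1_in_B0)
  show ?thesis
    unfolding e_def e'_def courant_form_class[OF D z]
    using cl by (simp add: courant_inc_class D z inc1_Z1 mat_der_derivation Mat.courant_form_class interior_chain_inc1 zc
        H0.quot_map_coset[OF Mat.chains_module Mat.B0_submodule inc0_linear B] maps_add)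
qed

end

theorem proposition3p3:
  fixes K :: "('k, 'm) ring_scheme" and A :: "('k, 'a) module" and r :: nat
  assumes "assoc_algebra K A" and "r \<ge> 1"
  shows "\<exists>\<phi> \<Phi>.
    \<phi> \<in> module_iso K (hoch_homology K A 0) (hoch_homology K (mat_algebra A r) 0) \<and>
    \<Phi> \<in> module_iso K (courant_module K A) (courant_module K (mat_algebra A r)) \<and>
    (\<forall>e\<^sub>1\<in>carrier (courant_module K A). \<forall>e\<^sub>2\<in>carrier (courant_module K A).
       \<Phi> (courant_bracket K A e\<^sub>1 e\<^sub>2) = courant_bracket K (mat_algebra A r) (\<Phi> e\<^sub>1) (\<Phi> e\<^sub>2) \<and>
       courant_form K (mat_algebra A r) (\<Phi> e\<^sub>1) (\<Phi> e\<^sub>2) = \<phi> (courant_form K A e\<^sub>1 e\<^sub>2))"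
proof -
  interpret matrices K A r
    using assms by (simp add: matrices_def hochschild_def matrices_axioms_def)
  show ?thesis
    using H0_iso courant_inc_iso courant_inc_bracket courant_inc_form by (blast elim: courant_cases)
qed

end
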